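(* Let $X$ and $Y$ be two (not necessarily bounded) self-adjoint operators on a Hilbert space $H$ that are boolean independent w.r.t. a unit vector $\Omega\in H$, and assume that $\Omega$ is cyclic, i.e. that $$\overline{\mathrm{alg}\{h(X),h(Y);\,h\in C_b(\mathbb{R})\}\,\Omega}=H.$$ Then $X+Y$ is essentially self-adjoint, and the distribution w.r.t. $\Omega$ of the closure of $X+Y$ is equal to the additive boolean convolution of the distributions of $X$ and $Y$ w.r.t. $\Omega$, i.e. $$\mathcal{L}(X+Y,\Omega)=\mathcal{L}(X,\Omega)\uplus\mathcal{L}(Y,\Omega).$$
   Context: Inner products are linear in the second argument. $X+Y$ is defined on $\mathrm{Dom}\,X\cap\mathrm{Dom}\,Y$. For a self-adjoint operator $X$ and a unit vector $\Omega$, $\mathcal{L}(X,\Omega)$ is the probability measure $\mu$ on $\mathbb{R}$ with $\langle\Omega,h(X)\Omega\rangle=\int h\,\mathrm{d}\mu$ for all bounded continuous $h$; for an essentially self-adjoint operator it refers to the closure. $\mathrm{alg}\{\cdots\}$ is the algebra generated by the listed operators. Boolean independence: let $\mathbb{A}_k$ be the set of $(\varepsilon_1,\dots,\varepsilon_k)\in\{1,2\}^k$ with adjacent entries distinct. Two (not necessarily unital) $*$-algebras $\mathcal{A}_1,\mathcal{A}_2\subset\mathcal{B}(H)$ are boolean independent w.r.t. a unit vector $\Omega$ if $\langle\Omega,X_1\cdots X_k\Omega\rangle=\prod_{\kappa=1}^k\langle\Omega,X_\kappa\Omega\rangle$ for all $k\in\mathbb{N}$, $\varepsilon\in\mathbb{A}_k$,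 $X_1\in\mathcal{A}_{\varepsilon_1},\dots,X_k\in\mathcal{A}_{\varepsilon_k}$. Two normal operators $X,Y$ are boolean independent w.r.t. $\Omega$ if $\mathrm{alg}_0(X)=\{h(X);h\in C_b(\mathbb{C}),h(0)=0\}$ and $\mathrm{alg}_0(Y)=\{h(Y);h\in C_b(\mathbb{C}),h(0)=0\}$ are. Additive boolean convolution: for a probability measure $\mu$ on $\mathbb{R}$ and $z\in\mathbb{C}^+=\{\mathrm{Im}\,z>0\}$ put $G_\mu(z)=\int_{\mathbb{R}}\frac{1}{z-x}\,\mathrm{d}\mu(x)$, $F_\mu(z)=1/G_\mu(z)$. The map $\mu\mapsto F_\mu$ is a bijection from the probability measures on $\mathbb{R}$ onto the holomorphic maps $F:\mathbb{C}^+\to\mathbb{C}^+$ with $\inf_{z\in\mathbb{C}^+}\mathrm{Im}F(z)/\mathrm{Im}z=1$. $\mu\uplus\nu$ is the unique probability measure $\lambda$ on $\mathbb{R}$ with $F_\lambda(z)=F_\mu(z)+F_\nu(z)-z$ for $z\in\mathbb{C}^+$. *)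

theory Defs
  imports "HOL-Probability.Probability"
begin

text \<open>
  A complex Hilbert space is presented over the library's class of real inner product spaces, so
  that norm, topology and completeness are the library's. The real inner product is the real part
  of the complex one, and the complex one is linear in the second argument.
\<close>

class complex_hilbert_space = real_inner + complete_space +
  fixes scaleC :: "complex \<Rightarrow> 'a \<Rightarrow> 'a" (infixr "*\<^sub>C" 75)
    and cinner :: "'a \<Rightarrow> 'a \<Rightarrow> complex"
  assumes scaleC_add_right: "c *\<^sub>C (x + y) = c *\<^sub>C x + c *\<^sub>C y"
    and scaleC_add_left: "(c + d) *\<^sub>C x = c *\<^sub>C x + d *\<^sub>C x"
    and scaleC_scaleC: "c *\<^sub>C (d *\<^sub>C x) = (c * d) *\<^sub>C x"
    and scaleR_scaleC: "r *\<^sub>R x = complex_of_real r *\<^sub>C x"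
    and cinner_commute: "cinner x y = cnj (cinner y x)"
    and cinner_add_right: "cinner x (y + z) = cinner x y + cinner x z"
    and cinner_scaleC_right: "cinner x (c *\<^sub>C y) = c * cinner x y"
    and inner_eq_Re_cinner: "inner x y = Re (cinner x y)"


subsection \<open>Unbounded operators\<close>

text \<open>Unbounded operators are identified with their graphs, so the closure of an operator is the
  topological closure of its graph in the product space.\<close>

type_synonym 'a operator = "('a \<times> 'a) set"

definition linear_operator :: "'a::complex_hilbert_space operator \<Rightarrow> bool" where
  "linear_operator X \<longleftrightarrow> single_valued X \<and> (0, 0) \<in> X \<and>
     (\<forall>x u y v. (x, u) \<in> X \<longrightarrow> (y, v) \<in> X \<longrightarrow> (x + y, u + v) \<in> X) \<and>
     (\<forall>c x u. (x, u) \<in> X \<longrightarrow> (c *\<^sub>C x, c *\<^sub>C u) \<in> X)"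

definition densely_defined :: "'a::complex_hilbert_space operator \<Rightarrow> bool" where
  "densely_defined X \<longleftrightarrow> closure (Domain X) = UNIV"

definition op_adjoint :: "'a::complex_hilbert_space operator \<Rightarrow> 'a operator" where
  "op_adjoint X = {(y, z). \<forall>(x, u) \<in> X. cinner y u = cinner z x}"

definition selfadjoint :: "'a::complex_hilbert_space operator \<Rightarrow> bool" where
  "selfadjoint X \<longleftrightarrow> linear_operator X \<and> densely_defined X \<and> op_adjoint X = X"

definition essentially_selfadjoint :: "'a::complex_hilbert_space operator \<Rightarrow> bool" where
  "essentially_selfadjoint X \<longleftrightarrow>
     linear_operator X \<and> densely_defined X \<and> selfadjoint (closure X)"

definition op_sum :: "'a::complex_hilbert_space operator \<Rightarrow> 'a operator \<Rightarrow> 'a operator" where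
  "op_sum X Y = {(x, u + v) | x u v. (x, u) \<in> X \<and> (x, v) \<in> Y}"


subsection \<open>Spectral integrals and functional calculus\<close>

definition orthogonal_projection :: "('a::complex_hilbert_space \<Rightarrow> 'a) \<Rightarrow> bool" where
  "orthogonal_projection P \<longleftrightarrow>
     bounded_linear P \<and> (\<forall>c x. P (c *\<^sub>C x) = c *\<^sub>C P x) \<and>
     P \<circ> P = P \<and> (\<forall>x y. cinner x (P y) = cinner (P x) y)"

definition projection_valued_measure ::
    "(real set \<Rightarrow> 'a::complex_hilbert_space \<Rightarrow> 'a) \<Rightarrow> bool" where
  "projection_valued_measure E \<longleftrightarrow>
     (\<forall>B \<in> sets borel. orthogonal_projection (E B)) \<and> E UNIV = id \<and>
     (\<forall>A :: nat \<Rightarrow> real set. range A \<subseteq> sets borel \<longrightarrow> disjoint_family A \<longrightarrow>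
        (\<forall>\<psi>. (\<lambda>n. E (A n) \<psi>) sums E (\<Union>n. A n) \<psi>))"

definition vector_measure ::
    "(real set \<Rightarrow> 'a::complex_hilbert_space \<Rightarrow> 'a) \<Rightarrow> 'a \<Rightarrow> real measure" where
  "vector_measure E \<psi> =
     measure_of UNIV (sets borel) (\<lambda>B. ennreal (Re (cinner \<psi> (E B \<psi>))))"

text \<open>The operator \<open>T\<close> is the spectral integral of the Borel function \<open>f\<close> with respect to \<open>E\<close>: its
  domain consists of the vectors at which \<open>f\<close> is square integrable, and its quadratic form is given
  by integrating \<open>f\<close>. By polarization this determines \<open>T\<close>.\<close>

definition has_spectral_integral ::
    "(real set \<Rightarrow> 'a::complex_hilbert_space \<Rightarrow> 'a) \<Rightarrow> (real \<Rightarrow> complex) \<Rightarrow> 'a operator \<Rightarrow> bool" where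
  "has_spectral_integral E f T \<longleftrightarrow>
     linear_operator T \<and>
     Domain T = {\<psi>. integrable (vector_measure E \<psi>) (\<lambda>x. (cmod (f x))\<^sup>2)} \<and>
     (\<forall>(\<psi>, \<eta>) \<in> T. cinner \<psi> \<eta> = (\<integral>x. f x \<partial>vector_measure E \<psi>))"

text \<open>For self-adjoint \<open>X\<close> and bounded continuous \<open>h\<close>, \<open>fun_calc X h\<close> is the bounded operator
  \<open>h(X)\<close>, the spectral integral of \<open>h\<close> with respect to the spectral measure of \<open>X\<close>.\<close>

definition fun_calc ::
    "'a::complex_hilbert_space operator \<Rightarrow> (real \<Rightarrow> complex) \<Rightarrow> 'a \<Rightarrow> 'a" where
  "fun_calc X h = (THE T. \<exists>E. projection_valued_measure E \<and>
     has_spectral_integral E complex_of_real X \<and>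
     has_spectral_integral E h {(\<psi>, T \<psi>) | \<psi>. True})"

definition op_distribution :: "'a::complex_hilbert_space operator \<Rightarrow> 'a \<Rightarrow> real measure" where
  "op_distribution X \<Omega> = (THE \<mu>. real_distribution \<mu> \<and>
     (\<forall>h :: real \<Rightarrow> complex. h \<in> bcontfun \<longrightarrow>
        cinner \<Omega> (fun_calc X h \<Omega>) = (\<integral>x. h x \<partial>\<mu>)))"


subsection \<open>Generated algebras and boolean independence\<close>

inductive_set generated_algebra ::
    "('a::complex_hilbert_space \<Rightarrow> 'a) set \<Rightarrow> ('a \<Rightarrow> 'a) set"
  for S :: "('a \<Rightarrow> 'a) set" where
  zero: "(\<lambda>x. 0) \<in> generated_algebra S"
| gen: "T \<in> S \<Longrightarrow> T \<in> generated_algebra S"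
| add: "T \<in> generated_algebra S \<Longrightarrow> U \<in> generated_algebra S
    \<Longrightarrow> (\<lambda>x. T x + U x) \<in> generated_algebra S"
| scale: "T \<in> generated_algebra S \<Longrightarrow> (\<lambda>x. c *\<^sub>C T x) \<in> generated_algebra S"
| mult: "T \<in> generated_algebra S \<Longrightarrow> U \<in> generated_algebra S
    \<Longrightarrow> T \<circ> U \<in> generated_algebra S"

definition alternating_indices :: "nat \<Rightarrow> nat list set" where
  "alternating_indices k = {es. length es = k \<and> set es \<subseteq> {1, 2} \<and> distinct_adj es}"

text \<open>The fold applies the product of the operators in the list \<open>Ts\<close>, the last one first.\<close>

definition boolean_independent_algebras ::
    "('a::complex_hilbert_space \<Rightarrow> 'a) set \<Rightarrow> ('a \<Rightarrow> 'a) set \<Rightarrow> 'a \<Rightarrow> bool" where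
  "boolean_independent_algebras A1 A2 \<Omega> \<longleftrightarrow>
     (\<forall>k. \<forall>es \<in> alternating_indices k. \<forall>Ts.
        list_all2 (\<lambda>e T. T \<in> (if e = 1 then A1 else A2)) es Ts \<longrightarrow>
        cinner \<Omega> (foldr (\<lambda>T v. T v) Ts \<Omega>) = (\<Prod>T\<leftarrow>Ts. cinner \<Omega> (T \<Omega>)))"

text \<open>For self-adjoint \<open>X\<close> the spectrum is real, so \<open>h(X)\<close> for a function \<open>h\<close> on the complex
  plane is the functional calculus applied to the restriction of \<open>h\<close> to the real line.\<close>

definition alg0 :: "'a::complex_hilbert_space operator \<Rightarrow> ('a \<Rightarrow> 'a) set" where
  "alg0 X = {fun_calc X (\<lambda>x. h (complex_of_real x)) | h :: complex \<Rightarrow> complex.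
     h \<in> bcontfun \<and> h 0 = 0}"

definition boolean_independent ::
    "'a::complex_hilbert_space operator \<Rightarrow> 'a operator \<Rightarrow> 'a \<Rightarrow> bool" where
  "boolean_independent X Y \<Omega> \<longleftrightarrow> boolean_independent_algebras (alg0 X) (alg0 Y) \<Omega>"

definition cyclic_vector ::
    "'a::complex_hilbert_space operator \<Rightarrow> 'a operator \<Rightarrow> 'a \<Rightarrow> bool" where
  "cyclic_vector X Y \<Omega> \<longleftrightarrow>
     closure {T \<Omega> | T. T \<in> generated_algebra (fun_calc X ` bcontfun \<union> fun_calc Y ` bcontfun)}
       = UNIV"


subsection \<open>Additive boolean convolution\<close>

definition cauchy_transform :: "real measure \<Rightarrow> complex \<Rightarrow> complex" where
  "cauchy_transform \<mu> z = (\<integral>x. 1 / (z - complex_of_real x) \<partial>\<mu>)"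

definition reciprocal_cauchy_transform :: "real measure \<Rightarrow> complex \<Rightarrow> complex" where
  "reciprocal_cauchy_transform \<mu> z = 1 / cauchy_transform \<mu> z"

definition boolean_convolution :: "real measure \<Rightarrow> real measure \<Rightarrow> real measure" (infixl "\<uplus>" 65)
  where
  "\<mu> \<uplus> \<nu> = (THE \<rho>. real_distribution \<rho> \<and>
     (\<forall>z. Im z > 0 \<longrightarrow> reciprocal_cauchy_transform \<rho> z =
        reciprocal_cauchy_transform \<mu> z + reciprocal_cauchy_transform \<nu> z - z))"

end

theory Submission
  imports Defs
begin

text \<open>
  Write \<open>\<mu>\<close> and \<open>\<nu>\<close> for the distributions of \<open>X\<close> and \<open>Y\<close>. Boolean independence forces the two
  operators to live on almost disjoint parts of the space: a vector \<open>F(X) \<Omega>\<close>, made orthogonal to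
  \<open>\<Omega>\<close>, is annihilated by \<open>Y\<close>, because the squared norm of \<open>k(Y) (F(X) \<Omega> - m \<Omega>)\<close> is an
  alternating sum of moments that cancels (\<open>boolean_independent_annihilates_alg0\<close>,
  \<open>boolean_independent_kernel\<close>). Together with cyclicity, the vectors \<open>p(X) \<Omega> + q(Y) \<Omega>\<close> with bounded
  continuous \<open>p\<close> and \<open>q\<close> are dense. So \<open>H\<close> is \<open>L\<^sup>2(\<mu>)\<close> and \<open>L\<^sup>2(\<nu>)\<close> glued along the constants, and
  each operator acts by multiplication on its own part and as zero on the rest.

  In this picture the equation \<open>(X + Y - z) v = w\<close> can be solved explicitly for non-real \<open>z\<close>
  (\<open>op_sum_resolvent\<close>). A scalar factor \<open>1/G\<^sub>\<mu> + 1/G\<^sub>\<nu> - z\<close> has to be inverted; it is not zero since the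
  imaginary part of \<open>1/G\<close> dominates the one of \<open>z\<close>. Hence \<open>X + Y \<plusminus> i\<close> have dense range. The domain of
  \<open>X + Y\<close> is dense as well, although \<open>\<Omega>\<close> itself need not belong to it
  (\<open>op_sum_densely_defined\<close>), and the sum is essentially self-adjoint. Taking \<open>w\<close> to be a multiple of
  \<open>\<Omega>\<close> shows that the Cauchy transform of the distribution of the closure is the reciprocal of this
  factor, which is the defining equation of the boolean convolution.

  The functional calculus, the distributions and the convolution are defined by description, so the
  argument needs the spectral theorem for unbounded self-adjoint operators and the uniqueness of the
  objects described. Existence goes through the Cayley transform \<open>U\<close>: the numbers \<open>\<langle>\<psi>, U\<^sup>k \<psi>\<rangle>\<close> are
  the moments of a measure on the circle, a weak limit of Fejer means, and \<open>1\<close> has measure zero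
  because \<open>U\<close> has no fixed vector (\<open>line_measure_exists\<close>). The identity
  \<open>\<parallel>f(X) \<psi>\<parallel>\<^sup>2 = \<integral> |f|\<^sup>2 d\<mu>\<^sub>\<psi>\<close> then extends the calculus from powers of \<open>U\<close> to indicators of Borel sets
  (\<open>spectral_theorem\<close>). Uniqueness rests in all cases on one fact: a finite measure on the line is
  determined by its Cauchy transform (\<open>cauchy_transform_eqI\<close>).
\<close>

section \<open>Complex Hilbert spaces\<close>

lemma cinner_add_left:
  "cinner (x + y) z = cinner x z + cinner y (z :: 'a::complex_hilbert_space)"
  by (metis cinner_add_right cinner_commute complex_cnj_add)

lemma cinner_scaleC_left:
  "cinner (c *\<^sub>C x) y = cnj c * cinner x (y :: 'a::complex_hilbert_space)"
  by (metis cinner_commute cinner_scaleC_right complex_cnj_mult)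

lemma cinner_scaleR_right:
  "cinner x (r *\<^sub>R y) = of_real r * cinner x (y :: 'a::complex_hilbert_space)"
  by (simp add: scaleR_scaleC cinner_scaleC_right)

lemma cinner_scaleR_left:
  "cinner (r *\<^sub>R x) y = of_real r * cinner x (y :: 'a::complex_hilbert_space)"
  by (simp add: scaleR_scaleC cinner_scaleC_left)

lemma cinner_zero [simp]:
  "cinner x (0 :: 'a::complex_hilbert_space) = 0" "cinner (0 :: 'a) x = 0"
  using cinner_scaleR_right[of x 0 0] cinner_scaleR_left[of 0 0 x] by simp_all

lemma cinner_minus [simp]:
  "cinner x (- y :: 'a::complex_hilbert_space) = - cinner x y" "cinner (- x) y = - cinner x y"
  using cinner_scaleR_right[of x "-1" y] cinner_scaleR_left[of "-1" x y] by simp_all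

lemma cinner_diff_right:
  "cinner x (y - z :: 'a::complex_hilbert_space) = cinner x y - cinner x z"
  using cinner_add_right[of x y "- z"] by simp

lemma cinner_diff_left:
  "cinner (x - y) (z :: 'a::complex_hilbert_space) = cinner x z - cinner y z"
  using cinner_add_left[of x "- y" z] by simp

lemma cinner_sum_right:
  "cinner x (\<Sum>i\<in>A. f i :: 'a::complex_hilbert_space) = (\<Sum>i\<in>A. cinner x (f i))"
  by (induction A rule: infinite_finite_induct) (auto simp: cinner_add_right)

lemma cinner_sum_left:
  "cinner (\<Sum>i\<in>A. f i :: 'a::complex_hilbert_space) x = (\<Sum>i\<in>A. cinner (f i) x)"
  by (induction A rule: infinite_finite_induct) (auto simp: cinner_add_left)

lemmas cinner_simps = cinner_add_right cinner_add_left cinner_diff_right cinner_diff_left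
  cinner_scaleC_right cinner_scaleC_left cinner_scaleR_right cinner_scaleR_left

lemma scaleC_one [simp]: "1 *\<^sub>C x = (x :: 'a::complex_hilbert_space)"
  using scaleR_scaleC[of 1 x] by simp

lemma scaleC_zero_left [simp]: "0 *\<^sub>C x = (0 :: 'a::complex_hilbert_space)"
  using scaleR_scaleC[of 0 x] by simp

lemma scaleC_zero_right [simp]: "c *\<^sub>C (0 :: 'a::complex_hilbert_space) = 0"
  using scaleC_add_right[of c 0 "0::'a"] by simp

lemma scaleC_minus_left: "(- c) *\<^sub>C x = - (c *\<^sub>C (x :: 'a::complex_hilbert_space))"
  using scaleC_add_left[of c "- c" x] by (simp add: eq_neg_iff_add_eq_0 add.commute)

lemma scaleC_minus_right: "c *\<^sub>C (- x) = - (c *\<^sub>C (x :: 'a::complex_hilbert_space))"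
  using scaleC_add_right[of c x "- x"] by (simp add: eq_neg_iff_add_eq_0 add.commute)

lemma scaleC_diff_right: "c *\<^sub>C (x - y) = c *\<^sub>C x - c *\<^sub>C (y :: 'a::complex_hilbert_space)"
  using scaleC_add_right[of c x "- y"] by (simp add: scaleC_minus_right)

lemma scaleC_diff_left: "(c - d) *\<^sub>C x = c *\<^sub>C x - d *\<^sub>C (x :: 'a::complex_hilbert_space)"
  using scaleC_add_left[of c "- d" x] by (simp add: scaleC_minus_left)

lemmas scaleC_simps = scaleC_add_right scaleC_add_left scaleC_diff_right scaleC_diff_left
  scaleC_minus_left scaleC_minus_right scaleC_scaleC

lemma cinner_self: "cinner x x = of_real ((norm (x :: 'a::complex_hilbert_space))\<^sup>2)"
proof -
  have "Im (cinner x x) = 0"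
    using cinner_commute[of x x] by (metis complex_cnj_complex_of_real Reals_cnj_iff complex_is_Real_iff)
  moreover have "Re (cinner x x) = (norm x)\<^sup>2"
    using inner_eq_Re_cinner[of x x] by (simp add: power2_norm_eq_inner)
  ultimately show ?thesis by (simp add: complex_eq_iff)
qed

lemma norm_scaleC [simp]: "norm (c *\<^sub>C x) = cmod c * norm (x :: 'a::complex_hilbert_space)"
proof -
  have "of_real ((norm (c *\<^sub>C x))\<^sup>2) = cinner (c *\<^sub>C x) (c *\<^sub>C x)" by (simp only: cinner_self)
  also have "\<dots> = (cnj c * c) * cinner x x" by (simp add: cinner_simps)
  also have "\<dots> = of_real ((cmod c * norm x)\<^sup>2)"
    by (simp add: cinner_self power_mult_distrib complex_norm_square mult.commute
        del: of_real_power)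
  finally have "(norm (c *\<^sub>C x))\<^sup>2 = (cmod c * norm x)\<^sup>2" using of_real_eq_iff by blast
  then show ?thesis by (simp add: power2_eq_iff_nonneg)
qed

lemma cinner_Cauchy_Schwarz:
  "cmod (cinner x y) \<le> norm x * norm (y :: 'a::complex_hilbert_space)"
proof (cases "cinner x y = 0")
  case False
  \<comment> \<open>Rotating \<open>y\<close> by a phase makes the complex inner product equal to the real one.\<close>
  define c where "c = cnj (cinner x y) / cmod (cinner x y)"
  have "cinner x (c *\<^sub>C y) = of_real (cmod (cinner x y))"
    using False by (simp add: cinner_simps c_def field_simps power2_eq_square flip: complex_norm_square)
  then have "cmod (cinner x y) = inner x (c *\<^sub>C y)" by (simp add: inner_eq_Re_cinner)
  also have "\<dots> \<le> norm x * norm (c *\<^sub>C y)" by (rule norm_cauchy_schwarz)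
  also have "\<dots> = norm x * norm y" using False by (simp add: c_def norm_divide)
  finally show ?thesis .
qed auto

lemma bounded_bilinear_cinner:
  "bounded_bilinear (cinner :: 'a::complex_hilbert_space \<Rightarrow> 'a \<Rightarrow> complex)"
  by (standard, auto simp: cinner_simps scaleR_conv_of_real)
    (metis cinner_Cauchy_Schwarz mult.right_neutral)

lemmas tendsto_cinner = bounded_bilinear.tendsto[OF bounded_bilinear_cinner]

lemma bounded_linear_scaleC: "bounded_linear ((*\<^sub>C) c :: 'a::complex_hilbert_space \<Rightarrow> 'a)"
  by (rule bounded_linear_intro[where K = "cmod c"])
    (auto simp: scaleC_simps scaleR_scaleC mult.commute)

lemmas tendsto_scaleC = bounded_linear.tendsto[OF bounded_linear_scaleC]

lemma cinner_ext:
  assumes "\<And>x. cinner x u = cinner x (v :: 'a::complex_hilbert_space)"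
  shows "u = v"
proof -
  have "cinner (u - v) (u - v) = 0" using assms by (simp add: cinner_diff_right)
  then show ?thesis by (simp add: cinner_self)
qed

text \<open>Over the complex field a sesquilinear form is determined by its diagonal; this is the
  polarization identity, used in the form that a form with zero diagonal vanishes.\<close>

lemma sesquilinear_zero_diagonal:
  fixes T B :: "'a::complex_hilbert_space \<Rightarrow> 'a"
  assumes add: "\<And>x y. T (x + y) = T x + T y" "\<And>x y. B (x + y) = B x + B y"
    and scale: "\<And>c x. T (c *\<^sub>C x) = c *\<^sub>C T x" "\<And>c x. B (c *\<^sub>C x) = c *\<^sub>C B x"
    and diag: "\<And>x. cinner (T x) (B x) = 0"
  shows "cinner (T x) (B y) = 0"
proof -
  have "cinner (T x) (B y) + cinner (T y) (B x) = 0"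
    using diag[of "x + y"] diag[of x] diag[of y] by (simp add: add cinner_simps add.commute)
  moreover have "\<i> * cinner (T x) (B y) - \<i> * cinner (T y) (B x) = 0"
    using diag[of "x + \<i> *\<^sub>C y"] diag[of x] diag[of y] by (simp add: add scale cinner_simps)
  then have "cinner (T x) (B y) = cinner (T y) (B x)" by simp
  ultimately show ?thesis by simp
qed

subsection \<open>Adjoint pairs of everywhere defined operators\<close>

definition adjoint_pair :: "('a::complex_hilbert_space \<Rightarrow> 'a) \<Rightarrow> ('a \<Rightarrow> 'a) \<Rightarrow> bool" where
  "adjoint_pair T S \<longleftrightarrow> (\<forall>x y. cinner x (T y) = cinner (S x) y)"

lemma adjoint_pairD: "adjoint_pair T S \<Longrightarrow> cinner x (T y) = cinner (S x) y"
  by (simp add: adjoint_pair_def)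

lemma adjoint_pair_sym: "adjoint_pair T S \<Longrightarrow> adjoint_pair S T"
  unfolding adjoint_pair_def by (metis cinner_commute)

lemma adjoint_pair_add: "adjoint_pair T S \<Longrightarrow> T (x + y) = T x + T y"
  by (rule cinner_ext) (simp add: adjoint_pairD[of T S] cinner_add_right)

lemma adjoint_pair_scaleC: "adjoint_pair T S \<Longrightarrow> T (c *\<^sub>C x) = c *\<^sub>C T x"
  by (rule cinner_ext) (simp add: adjoint_pairD[of T S] cinner_scaleC_right)

lemma adjoint_pair_diff: "adjoint_pair T S \<Longrightarrow> T (x - y) = T x - T y"
  by (rule cinner_ext) (simp add: adjoint_pairD[of T S] cinner_diff_right)

lemma adjoint_pair_zero: "adjoint_pair T S \<Longrightarrow> T 0 = 0"
  using adjoint_pair_diff[of T S 0 0] by simp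

lemma adjoint_pair_eqI:
  fixes T S T' S' :: "'a::complex_hilbert_space \<Rightarrow> 'a"
  assumes "adjoint_pair T S" "adjoint_pair T' S'" "\<And>x. cinner x (T x) = cinner x (T' x)"
  shows "T = T'"
proof
  fix y
  have "cinner x (T y - T' y) = 0" for x
    by (rule sesquilinear_zero_diagonal[where T = "\<lambda>x. x" and B = "\<lambda>y. T y - T' y"])
      (use assms in \<open>simp_all add: adjoint_pair_add[OF assms(1)] adjoint_pair_add[OF assms(2)]
        adjoint_pair_scaleC[OF assms(1)] adjoint_pair_scaleC[OF assms(2)] scaleC_simps cinner_diff_right\<close>)
  then show "T y = T' y" using cinner_ext[of "T y" "T' y"] by (simp add: cinner_diff_right)
qed

lemma adjoint_pair_bounded_linear:
  assumes "adjoint_pair T S" "\<And>x. norm (T x) \<le> K * norm x"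
  shows "bounded_linear T"
  by (rule bounded_linear_intro[where K = K])
    (use assms in \<open>auto simp: adjoint_pair_add[OF assms(1)] adjoint_pair_scaleC[OF assms(1)]
       scaleR_scaleC mult.commute\<close>)

lemma adjoint_pair_norm_bound:
  assumes "adjoint_pair T S" "\<And>x. norm (T x) \<le> K * norm x"
  shows "norm (S x) \<le> K * norm x"
proof (cases "S x = 0")
  case False
  have "(norm (S x))\<^sup>2 = cmod (cinner (S x) (S x))" by (simp add: cinner_self norm_power)
  also have "\<dots> = cmod (cinner x (T (S x)))" using adjoint_pairD[OF assms(1)] by metis
  also have "\<dots> \<le> norm x * (K * norm (S x))"
    using cinner_Cauchy_Schwarz[of x "T (S x)"] mult_left_mono[OF assms(2)[of "S x"], of "norm x"]
    by (smt (verit) norm_ge_zero)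
  finally show ?thesis using False by (simp add: power2_eq_square mult.assoc mult.left_commute)
next
  case True
  have "0 \<le> K * norm x" using assms(2)[of x] norm_ge_zero order_trans by blast
  then show ?thesis using True by simp
qed

subsection \<open>Orthogonal complements\<close>

text \<open>In a complete space a closed subspace contains a point nearest to any given \<open>x\<close>: by the
  parallelogram law a minimizing sequence is a Cauchy sequence. The difference between \<open>x\<close> and the
  nearest point is orthogonal to the subspace, so it vanishes.\<close>

lemma closed_subspace_eq_UNIV:
  fixes M :: "'a::{real_inner,complete_space} set"
  assumes "closed M" and sub: "subspace M"
    and perp: "\<And>x. (\<And>m. m \<in> M \<Longrightarrow> inner x m = 0) \<Longrightarrow> x = 0"
  shows "M = UNIV"
proof -
  have "x \<in> M" for x
  proof -
    define d where "d = Inf ((\<lambda>m. (norm (x - m))\<^sup>2) ` M)"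
    have ne: "M \<noteq> {}" using subspace_0[OF sub] by auto
    have bdd: "bdd_below ((\<lambda>m. (norm (x - m))\<^sup>2) ` M)" by (rule bdd_belowI[of _ 0]) auto
    have dle: "d \<le> (norm (x - m))\<^sup>2" if "m \<in> M" for m
      unfolding d_def using bdd that by (intro cInf_lower) auto
    have "\<exists>m\<in>M. (norm (x - m))\<^sup>2 < d + inverse (real (Suc n))" for n
    proof -
      have "Inf ((\<lambda>m. (norm (x - m))\<^sup>2) ` M) < d + inverse (real (Suc n))"
        unfolding d_def by simp
      then show ?thesis using cInf_less_iff[OF _ bdd] ne by auto
    qed
    then obtain m where m: "\<And>n. m n \<in> M" "\<And>n. (norm (x - m n))\<^sup>2 < d + inverse (real (Suc n))"
      by metis
    have close: "(norm (m i - m j))\<^sup>2 \<le> 2 * inverse (real (Suc i)) + 2 * inverse (real (Suc j))" for i j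
    proof -
      have "(1/2) *\<^sub>R (m i + m j) \<in> M" using m(1) sub by (simp add: subspace_add subspace_scale)
      from dle[OF this] have "4 * d \<le> (norm (2 *\<^sub>R (x - (1/2) *\<^sub>R (m i + m j))))\<^sup>2"
        by (simp add: power_mult_distrib)
      also have "2 *\<^sub>R (x - (1/2) *\<^sub>R (m i + m j)) = (x - m i) + (x - m j)"
        by (simp add: scaleR_2 algebra_simps flip: scaleR_add_left)
      finally have "4 * d \<le> (norm ((x - m i) + (x - m j)))\<^sup>2" .
      moreover have "(norm ((x - m i) + (x - m j)))\<^sup>2 + (norm (m i - m j))\<^sup>2
          = 2 * (norm (x - m i))\<^sup>2 + 2 * (norm (x - m j))\<^sup>2"
        by (simp add: power2_norm_eq_inner inner_simps inner_commute)
      ultimately show ?thesis using m(2)[of i] m(2)[of j] by linarith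
    qed
    have "Cauchy m"
    proof (rule metric_CauchyI)
      fix e :: real assume e: "e > 0"
      obtain N where N: "inverse (real (Suc N)) < e\<^sup>2 / 4"
        using reals_Archimedean[of "e\<^sup>2 / 4"] e by auto
      have small: "inverse (real (Suc i)) < e\<^sup>2 / 4" if "i \<ge> N" for i
      proof -
        have "inverse (real (Suc i)) \<le> inverse (real (Suc N))" using that by (intro le_imp_inverse_le) auto
        then show ?thesis using N by linarith
      qed
      show "\<exists>N. \<forall>i\<ge>N. \<forall>j\<ge>N. dist (m i) (m j) < e"
      proof (intro exI allI impI)
        fix i j assume "i \<ge> N" "j \<ge> N"
        then have "(norm (m i - m j))\<^sup>2 < e\<^sup>2" using close[of i j] small[of i] small[of j] by linarith
        then show "dist (m i) (m j) < e" using e by (simp add: dist_norm power2_less_imp_less)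
      qed
    qed
    then obtain p where p: "m \<longlonglongrightarrow> p" using Cauchy_convergent convergent_def by blast
    have pM: "p \<in> M" using closed_sequentially[OF \<open>closed M\<close>] m(1) p by blast
    have "(\<lambda>n. (norm (x - m n))\<^sup>2) \<longlonglongrightarrow> (norm (x - p))\<^sup>2" by (intro tendsto_intros p)
    moreover have "(\<lambda>n. d + inverse (real (Suc n))) \<longlonglongrightarrow> d + 0"
      by (intro tendsto_add tendsto_const LIMSEQ_inverse_real_of_nat)
    ultimately have "(norm (x - p))\<^sup>2 \<le> d + 0"
      by (rule LIMSEQ_le) (use m(2) less_imp_le in blast)
    then have pd: "(norm (x - p))\<^sup>2 \<le> d" by simp
    have "inner (x - p) k = 0" if k: "k \<in> M" for k
    proof (cases "k = 0")
      case False
      define t where "t = inner (x - p) k / (norm k)\<^sup>2"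
      have "p + t *\<^sub>R k \<in> M" using pM k sub by (simp add: subspace_add subspace_scale)
      from dle[OF this] pd have "(norm (x - p))\<^sup>2 \<le> (norm (x - (p + t *\<^sub>R k)))\<^sup>2" by linarith
      also have "\<dots> = (norm (x - p))\<^sup>2 - 2 * t * inner (x - p) k + t\<^sup>2 * (norm k)\<^sup>2"
        by (simp only: power2_norm_eq_inner)
          (simp add: inner_simps inner_commute algebra_simps power2_eq_square)
      also have "\<dots> = (norm (x - p))\<^sup>2 - (inner (x - p) k)\<^sup>2 / (norm k)\<^sup>2"
        using False by (simp add: t_def field_simps power2_eq_square)
      finally have "(inner (x - p) k)\<^sup>2 / (norm k)\<^sup>2 \<le> 0" by linarith
      then show ?thesis using False by (simp add: divide_le_0_iff)
    qed auto
    then have "x - p = 0" by (rule perp)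
    then show "x \<in> M" using pM by simp
  qed
  then show ?thesis by auto
qed

section \<open>Symmetric operators and their resolvents\<close>

definition symmetric_operator :: "'a::complex_hilbert_space operator \<Rightarrow> bool" where
  "symmetric_operator X \<longleftrightarrow> (\<forall>(x, u) \<in> X. \<forall>(y, v) \<in> X. cinner x v = cinner u y)"

lemma symmetric_operatorD:
  "symmetric_operator X \<Longrightarrow> (x, u) \<in> X \<Longrightarrow> (y, v) \<in> X \<Longrightarrow> cinner x v = cinner u y"
  by (auto simp: symmetric_operator_def)

lemma symmetric_operator_norm:
  assumes "symmetric_operator X" "(x, u) \<in> X" "s = 1 \<or> s = -1"
  shows "(norm (u + (s * \<i>) *\<^sub>C x))\<^sup>2 = (norm u)\<^sup>2 + (norm x)\<^sup>2"
proof -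
  have eq: "cinner u x = cinner x u" using symmetric_operatorD[OF assms(1,2,2)] by simp
  have "complex_of_real ((norm (u + (s * \<i>) *\<^sub>C x))\<^sup>2)
      = cinner (u + (s * \<i>) *\<^sub>C x) (u + (s * \<i>) *\<^sub>C x)" by (simp only: cinner_self)
  also have "\<dots> = cinner u u + cinner x x" using assms(3) eq by (auto simp: cinner_simps algebra_simps)
  also have "\<dots> = complex_of_real ((norm u)\<^sup>2 + (norm x)\<^sup>2)" by (simp add: cinner_self)
  finally show ?thesis using of_real_eq_iff by blast
qed

lemma linear_operatorD:
  assumes "linear_operator X"
  shows "(x, u) \<in> X \<Longrightarrow> (y, v) \<in> X \<Longrightarrow> (x + y, u + v) \<in> X"
    "(x, u) \<in> X \<Longrightarrow> (c *\<^sub>C x, c *\<^sub>C u) \<in> X" "(0, 0) \<in> X"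
    "(x, u) \<in> X \<Longrightarrow> (x, v) \<in> X \<Longrightarrow> u = v"
  using assms by (auto simp: linear_operator_def single_valued_def)

lemma linear_operator_diff:
  assumes "linear_operator X" "(x, u) \<in> X" "(y, v) \<in> X"
  shows "(x - y, u - v) \<in> X"
  using linear_operatorD(1)[OF assms(1,2) linear_operatorD(2)[OF assms(1,3), of "-1"]]
  by (simp add: scaleC_minus_left)

lemma selfadjoint_symmetric: "selfadjoint X \<Longrightarrow> symmetric_operator X"
  unfolding selfadjoint_def symmetric_operator_def op_adjoint_def by blast

text \<open>The norm identity bounds \<open>x\<close> and \<open>u\<close> by \<open>u \<plusminus> i x\<close>, so that the ranges of \<open>X \<plusminus> i\<close> are closed when
  \<open>X\<close> is closed and symmetric; a range without orthogonal vectors is then the whole space.\<close>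

lemma symmetric_range_UNIV:
  fixes X :: "'a::complex_hilbert_space operator"
  assumes lin: "linear_operator X" and sym: "symmetric_operator X" and "closed X"
    and s: "s = 1 \<or> s = -1"
    and perp: "\<And>y. (\<And>x u. (x, u) \<in> X \<Longrightarrow> cinner y (u + (s * \<i>) *\<^sub>C x) = 0) \<Longrightarrow> y = 0"
  shows "\<exists>x. (x, w - (s * \<i>) *\<^sub>C x) \<in> X"
proof -
  define M where "M = {u + (s * \<i>) *\<^sub>C x | x u. (x, u) \<in> X}"
  have scale_M: "c *\<^sub>C m \<in> M" if "m \<in> M" for c m
  proof -
    obtain x u where "(x, u) \<in> X" "m = u + (s * \<i>) *\<^sub>C x" using \<open>m \<in> M\<close> M_def by auto
    then have "(c *\<^sub>C x, c *\<^sub>C u) \<in> X" "c *\<^sub>C m = c *\<^sub>C u + (s * \<i>) *\<^sub>C (c *\<^sub>C x)"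
      using linear_operatorD(2)[OF lin, of x u c] by (simp_all add: scaleC_simps mult.commute)
    then show ?thesis unfolding M_def by blast
  qed
  have sub: "subspace M"
  proof (rule subspaceI)
    show "0 \<in> M" unfolding M_def using linear_operatorD(3)[OF lin] by force
    fix a b assume "a \<in> M" "b \<in> M"
    then obtain x u y v where "(x, u) \<in> X" "a = u + (s * \<i>) *\<^sub>C x" "(y, v) \<in> X" "b = v + (s * \<i>) *\<^sub>C y"
      unfolding M_def by blast
    then have "(x + y, u + v) \<in> X" "a + b = (u + v) + (s * \<i>) *\<^sub>C (x + y)"
      using linear_operatorD(1)[OF lin, of x u y v] by (simp_all add: scaleC_simps)
    then show "a + b \<in> M" unfolding M_def by blast
  qed (simp add: scaleR_scaleC scale_M)
  have "closed M"
  proof (unfold closed_sequential_limits, intro allI impI)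
    fix a l assume al: "(\<forall>n. a n \<in> M) \<and> a \<longlonglongrightarrow> l"
    then have "\<forall>n. \<exists>x u. (x, u) \<in> X \<and> a n = u + (s * \<i>) *\<^sub>C x" unfolding M_def by blast
    then obtain x u where xu: "\<And>n. (x n, u n) \<in> X" "\<And>n. a n = u n + (s * \<i>) *\<^sub>C x n" by metis
    have nrm: "(norm (a i - a j))\<^sup>2 = (norm (u i - u j))\<^sup>2 + (norm (x i - x j))\<^sup>2" for i j
    proof -
      have "a i - a j = (u i - u j) + (s * \<i>) *\<^sub>C (x i - x j)" by (simp add: xu scaleC_simps)
      then show ?thesis
        using symmetric_operator_norm[OF sym linear_operator_diff[OF lin xu(1)[of i] xu(1)[of j]] s] by simp
    qed
    have le: "dist (x i) (x j) \<le> dist (a i) (a j)" for i j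
      unfolding dist_norm by (rule power2_le_imp_le) (simp_all add: nrm)
    have Ca: "Cauchy a" using al convergent_Cauchy convergent_def by blast
    have "Cauchy x"
    proof (rule metric_CauchyI)
      fix e :: real assume "e > 0"
      then show "\<exists>N. \<forall>i\<ge>N. \<forall>j\<ge>N. dist (x i) (x j) < e"
        using metric_CauchyD[OF Ca] le by (meson le_less_trans)
    qed
    then obtain p where p: "x \<longlonglongrightarrow> p" using Cauchy_convergent convergent_def by blast
    have "(\<lambda>n. a n - (s * \<i>) *\<^sub>C x n) \<longlonglongrightarrow> l - (s * \<i>) *\<^sub>C p"
      by (intro tendsto_diff tendsto_scaleC p) (use al in blast)
    then have "u \<longlonglongrightarrow> l - (s * \<i>) *\<^sub>C p" by (simp add: xu(2))
    then have "(\<lambda>n. (x n, u n)) \<longlonglongrightarrow> (p, l - (s * \<i>) *\<^sub>C p)" using p by (intro tendsto_Pair)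
    then have "(p, l - (s * \<i>) *\<^sub>C p) \<in> X"
      using closed_sequentially[OF \<open>closed X\<close>, of "\<lambda>n. (x n, u n)"] xu(1) by auto
    then show "l \<in> M" unfolding M_def
      by (intro CollectI exI[of _ p] exI[of _ "l - (s * \<i>) *\<^sub>C p"]) simp
  qed
  then have "M = UNIV"
  proof (rule closed_subspace_eq_UNIV[OF _ sub])
    fix y assume y: "\<And>m. m \<in> M \<Longrightarrow> inner y m = 0"
    have "cinner y m = 0" if "m \<in> M" for m
    proof -
      have "Re (cinner y m) = 0" "Re (cinner y (\<i> *\<^sub>C m)) = 0"
        using y[OF that] y[OF scale_M[OF that, of \<i>]] by (simp_all add: inner_eq_Re_cinner)
      then show ?thesis by (simp add: cinner_simps complex_eq_iff)
    qed
    then show "y = 0" by (intro perp) (auto simp: M_def)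
  qed
  then obtain x u where "(x, u) \<in> X" "w = u + (s * \<i>) *\<^sub>C x" unfolding M_def by blast
  then have "(x, w - (s * \<i>) *\<^sub>C x) \<in> X" by simp
  then show ?thesis by blast
qed

lemma closed_op_adjoint: "closed (op_adjoint X)"
proof -
  have "op_adjoint X = (\<Inter>(x, u)\<in>X. {p. cinner (fst p) u = cinner (snd p) x})"
    by (auto simp: op_adjoint_def)
  moreover have "closed {p. cinner (fst p) u = cinner (snd p) x}" for x u :: 'a
    by (intro closed_Collect_eq bounded_bilinear.continuous_on[OF bounded_bilinear_cinner]
        continuous_intros)
  ultimately show ?thesis by (auto intro!: closed_INT)
qed

lemma selfadjoint_range:
  assumes sa: "selfadjoint X" and s: "s = 1 \<or> s = -1"
  shows "\<exists>x. (x, w - (s * \<i>) *\<^sub>C x) \<in> X"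
proof (rule symmetric_range_UNIV[OF _ selfadjoint_symmetric[OF sa] _ s])
  have adj: "op_adjoint X = X" using sa by (simp add: selfadjoint_def)
  then show "closed X" by (metis closed_op_adjoint)
  show "linear_operator X" using sa by (simp add: selfadjoint_def)
  fix y assume y: "\<And>x u. (x, u) \<in> X \<Longrightarrow> cinner y (u + (s * \<i>) *\<^sub>C x) = 0"
  \<comment> \<open>A vector orthogonal to the range of \<open>X \<plusminus> i\<close> is an eigenvector of the adjoint for the
     eigenvalue \<open>\<plusminus> i\<close>, which a symmetric operator does not have.\<close>
  have "cnj s = s" using s by auto
  have "cinner y u = cinner ((s * \<i>) *\<^sub>C y) x" if "(x, u) \<in> X" for x u
    using y[OF that] \<open>cnj s = s\<close> by (simp add: cinner_simps eq_neg_iff_add_eq_0)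
  then have "(y, (s * \<i>) *\<^sub>C y) \<in> op_adjoint X" unfolding op_adjoint_def by auto
  then have "(y, (s * \<i>) *\<^sub>C y) \<in> X" by (simp only: adj)
  from symmetric_operatorD[OF selfadjoint_symmetric[OF sa] this this]
  have "cinner y y = 0" using s by (auto simp: cinner_simps)
  then show "y = 0" by (simp add: cinner_self)
qed

text \<open>Subtract from a vector \<open>y\<close> in the domain of the adjoint the vector \<open>x\<close> in the domain of \<open>Z\<close> with
  \<open>(Z + i) x = (Z\<^sup>* + i) y\<close>. The difference is orthogonal to the range of \<open>Z - i\<close>, hence zero.\<close>

lemma closed_symmetric_selfadjoint:
  fixes Z :: "'a::complex_hilbert_space operator"
  assumes lin: "linear_operator Z" and dense: "densely_defined Z" and sym: "symmetric_operator Z"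
    and ran: "\<And>w. \<exists>x. (x, w - \<i> *\<^sub>C x) \<in> Z" "\<And>w. \<exists>x. (x, w + \<i> *\<^sub>C x) \<in> Z"
  shows "selfadjoint Z"
proof -
  have "p \<in> Z" if "p \<in> op_adjoint Z" for p
  proof -
    obtain y w where p: "p = (y, w)" by fastforce
    have adj: "cinner y q = cinner w r" if "(r, q) \<in> Z" for r q
      using \<open>p \<in> op_adjoint Z\<close> that by (auto simp: op_adjoint_def p)
    obtain x where x: "(x, (w + \<i> *\<^sub>C y) - \<i> *\<^sub>C x) \<in> Z" using ran(1) by blast
    have "cinner (y - x) k = 0" for k
    proof -
      obtain r where r: "(r, k + \<i> *\<^sub>C r) \<in> Z" using ran(2) by blast
      have "cinner y k = cinner w r - \<i> * cinner y r"
        using adj[OF r] by (simp add: cinner_simps eq_diff_eq)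
      moreover have "cinner x k = cinner w r - \<i> * cinner y r"
        using symmetric_operatorD[OF sym x r] by (simp add: cinner_simps)
      ultimately show ?thesis by (simp add: cinner_diff_left)
    qed
    then have "y = x" using cinner_self[of "y - x"] by simp
    then show ?thesis using x p by simp
  qed
  moreover have "Z \<subseteq> op_adjoint Z" using sym by (auto simp: op_adjoint_def symmetric_operator_def)
  ultimately show ?thesis using lin dense by (auto simp: selfadjoint_def)
qed

text \<open>The criterion for essential self-adjointness: the deficiency spaces are trivial. Density
  of the domain is needed separately, since otherwise the closure of the graph need not be the
  graph of an operator.\<close>

lemma essentially_selfadjoint_criterion:
  fixes Z :: "'a::complex_hilbert_space operator"
  assumes lin: "linear_operator Z" and dense: "densely_defined Z" and sym: "symmetric_operator Z"
    and ran: "closure {u + \<i> *\<^sub>C x | x u. (x, u) \<in> Z} = UNIV"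
      "closure {u - \<i> *\<^sub>C x | x u. (x, u) \<in> Z} = UNIV"
  shows "essentially_selfadjoint Z"
proof -
  have sub: "Z \<subseteq> closure Z" by (rule closure_subset)
  have symc: "symmetric_operator (closure Z)"
    unfolding symmetric_operator_def
  proof (clarify)
    fix x u y v assume "(x, u) \<in> closure Z" "(y, v) \<in> closure Z"
    then obtain a b where ab: "\<And>n. a n \<in> Z" "a \<longlonglongrightarrow> (x, u)" "\<And>n. b n \<in> Z" "b \<longlonglongrightarrow> (y, v)"
      unfolding closure_sequential by auto
    have lim: "(\<lambda>n. fst (a n)) \<longlonglongrightarrow> x" "(\<lambda>n. snd (a n)) \<longlonglongrightarrow> u" "(\<lambda>n. fst (b n)) \<longlonglongrightarrow> y" "(\<lambda>n. snd (b n)) \<longlonglongrightarrow> v"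
      using tendsto_fst[OF ab(2)] tendsto_snd[OF ab(2)] tendsto_fst[OF ab(4)] tendsto_snd[OF ab(4)] by auto
    have "cinner (fst (a n)) (snd (b n)) = cinner (snd (a n)) (fst (b n))" for n
      using symmetric_operatorD[OF sym] ab(1,3) by (metis prod.collapse)
    then have "(\<lambda>n. cinner (fst (a n)) (snd (b n))) \<longlonglongrightarrow> cinner u y"
      using tendsto_cinner[OF lim(2,3)] by simp
    with tendsto_cinner[OF lim(1,4)] show "cinner x v = cinner u y" by (rule LIMSEQ_unique)
  qed
  have addc: "(x + y, u + v) \<in> closure Z" if xy: "(x, u) \<in> closure Z" "(y, v) \<in> closure Z" for x u y v
  proof -
    obtain a b where ab: "\<And>n. a n \<in> Z" "a \<longlonglongrightarrow> (x, u)" "\<And>n. b n \<in> Z" "b \<longlonglongrightarrow> (y, v)"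
      using xy unfolding closure_sequential by blast
    have "a n + b n \<in> Z" for n using linear_operatorD(1)[OF lin] ab(1,3)
      by (metis add_Pair prod.collapse)
    moreover have "(\<lambda>n. a n + b n) \<longlonglongrightarrow> (x + y, u + v)" using tendsto_add[OF ab(2,4)] by simp
    ultimately show ?thesis unfolding closure_sequential
      by (intro exI[of _ "\<lambda>n. a n + b n"]) auto
  qed
  have scalec: "(c *\<^sub>C x, c *\<^sub>C u) \<in> closure Z" if "(x, u) \<in> closure Z" for c x u
  proof -
    obtain a where a: "\<And>n. a n \<in> Z" "a \<longlonglongrightarrow> (x, u)"
      using \<open>(x, u) \<in> closure Z\<close> unfolding closure_sequential by blast
    have "(c *\<^sub>C fst (a n), c *\<^sub>C snd (a n)) \<in> Z" for n using linear_operatorD(2)[OF lin] a(1)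
      by (metis prod.collapse)
    moreover have "(\<lambda>n. (c *\<^sub>C fst (a n), c *\<^sub>C snd (a n))) \<longlonglongrightarrow> (c *\<^sub>C x, c *\<^sub>C u)"
      using tendsto_Pair[OF tendsto_scaleC[OF tendsto_fst[OF a(2)], of c] tendsto_scaleC[OF tendsto_snd[OF a(2)], of c]] by simp
    ultimately show ?thesis unfolding closure_sequential
      by (intro exI[of _ "\<lambda>n. (c *\<^sub>C fst (a n), c *\<^sub>C snd (a n))"]) auto
  qed
  have "u = v" if "(x, u) \<in> closure Z" "(x, v) \<in> closure Z" for x u v
  proof -
    have "(0, u - v) \<in> closure Z" using addc[OF that(1) scalec[OF that(2), of "-1"]]
      by (simp add: scaleC_minus_left)
    \<comment> \<open>A limit value at \<open>0\<close> is orthogonal to the dense domain.\<close>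
    then have orth: "cinner (u - v) y = 0" if "y \<in> Domain Z" for y
      using symmetric_operatorD[OF symc] that sub by fastforce
    have "closed {y. cinner (u - v) y = 0}"
      by (intro closed_Collect_eq bounded_bilinear.continuous_on[OF bounded_bilinear_cinner]
        continuous_intros)
    then have "closure (Domain Z) \<subseteq> {y. cinner (u - v) y = 0}"
      using orth by (intro closure_minimal) auto
    then have "cinner (u - v) (u - v) = 0" using dense unfolding densely_defined_def by auto
    then show ?thesis by (simp add: cinner_self)
  qed
  then have linc: "linear_operator (closure Z)"
    using addc scalec sub linear_operatorD(3)[OF lin]
    unfolding linear_operator_def single_valued_def by blast
  have densec: "densely_defined (closure Z)"
    using closure_mono[OF Domain_mono[OF sub]] dense unfolding densely_defined_def by auto
  have ranc: "\<exists>x. (x, w - (s * \<i>) *\<^sub>C x) \<in> closure Z" if s: "s = 1 \<or> s = -1" for s w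
  proof (rule symmetric_range_UNIV[OF linc symc closed_closure s])
    fix y assume y: "\<And>x u. (x, u) \<in> closure Z \<Longrightarrow> cinner y (u + (s * \<i>) *\<^sub>C x) = 0"
    have "closed {k. cinner y k = 0}"
      by (intro closed_Collect_eq bounded_bilinear.continuous_on[OF bounded_bilinear_cinner]
        continuous_intros)
    then have "closure {u + (s * \<i>) *\<^sub>C x | x u. (x, u) \<in> Z} \<subseteq> {k. cinner y k = 0}"
      using y sub by (intro closure_minimal) blast+
    moreover have "closure {u + (s * \<i>) *\<^sub>C x | x u. (x, u) \<in> Z} = UNIV"
      using s ran by (auto simp: scaleC_minus_left)
    ultimately have "cinner y y = 0" by auto
    then show "y = 0" by (simp add: cinner_self)
  qed
  have "selfadjoint (closure Z)"
    using ranc[of 1] ranc[of "-1"] by (intro closed_symmetric_selfadjoint linc densec symc) (auto simp: scaleC_minus_left)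
  then show ?thesis using lin dense by (simp add: essentially_selfadjoint_def)
qed

section \<open>The Cauchy transform determines a finite measure\<close>

lemma integral_poisson_kernel:
  "integrable lborel (\<lambda>s::real. inverse (1 + s\<^sup>2) / pi)"
  "(\<integral>s. inverse (1 + s\<^sup>2) / pi \<partial>lborel) = 1"
  using integrable_inverse_1_plus_square LBINT_inverse_1_plus_square
  by (simp_all add: set_integrable_def interval_integral_to_infinity_eq interval_lebesgue_integral_def
      set_lebesgue_integral_def)

lemma finite_borel_measure_integrable:
  fixes f :: "real \<Rightarrow> 'b::{banach,second_countable_topology}"
  assumes "finite_borel_measure M" "f \<in> borel_measurable borel" "\<And>x. norm (f x) \<le> B"
  shows "integrable M f"
proof -
  interpret finite_borel_measure M by fact
  show ?thesis
    using assms(2,3) by (intro integrable_const_bound[where B = B])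
      (auto simp: measurable_cong_sets[OF M_is_borel refl])
qed

lemma cauchy_kernel_bound:
  assumes "Im z \<noteq> 0"
  shows "cmod (1 / (z - complex_of_real x)) \<le> 1 / \<bar>Im z\<bar>"
proof -
  have "\<bar>Im z\<bar> \<le> cmod (z - complex_of_real x)" using abs_Im_le_cmod[of "z - complex_of_real x"] by simp
  then show ?thesis using assms by (simp add: norm_divide divide_simps)
qed

text \<open>Stieltjes inversion at the level of characteristic functions. Up to the factor \<open>-1/\<pi>\<close>, the
  imaginary part of the Cauchy transform at \<open>u + i e\<close> is the density of the convolution of the measure
  with a Cauchy distribution of scale \<open>e\<close>. Its Fourier transform is therefore the characteristic
  function of the measure, multiplied by the one of the Cauchy distribution, and this factor tends to
  \<open>1\<close> as \<open>e\<close> tends to \<open>0\<close>.\<close>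

lemma cauchy_transform_poisson:
  fixes t e :: real
  assumes M: "finite_borel_measure M" and e: "e > 0"
  shows "(\<integral>u. iexp (t * u) * complex_of_real (- Im (cauchy_transform M (Complex u e)) / pi) \<partial>lborel)
    = (\<integral>x. iexp (t * x) \<partial>M) * (\<integral>s. iexp (t * e * s) * complex_of_real (inverse (1 + s\<^sup>2) / pi) \<partial>lborel)"
proof -
  interpret finite_borel_measure M by fact
  note [measurable_cong] = M_is_borel
  interpret pair_sigma_finite M lborel ..
  define K where "K x u = - Im (1 / (Complex u e - complex_of_real x)) / pi" for x u :: real
  have [measurable]: "(\<lambda>u. Complex u e) \<in> borel_measurable borel"
    by (intro borel_measurable_continuous_onI continuous_intros)
  have [measurable]: "(\<lambda>(x, u). K x u) \<in> borel_measurable (M \<Otimes>\<^sub>M lborel)"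
    unfolding K_def by measurable
  have K: "K (x::real) (x + e * s) = inverse (1 + s\<^sup>2) / pi / e" for x s
  proof -
    have "K x (x + e * s) = e / ((e * s)\<^sup>2 + e\<^sup>2) / pi" by (simp add: K_def Im_divide)
    also have "(e * s)\<^sup>2 + e\<^sup>2 = e * (e * (1 + s\<^sup>2))" by (simp add: power2_eq_square algebra_simps)
    finally show ?thesis using e by (simp add: divide_inverse mult.assoc mult.left_commute)
  qed
  have Kpos: "K x u \<ge> 0" for x u
    using e by (simp add: K_def Im_divide Complex_eq divide_nonneg_nonneg)
  have subst: "(\<integral>u. f u * complex_of_real (K x u) \<partial>lborel)
      = (\<integral>s. f (x + e * s) * complex_of_real (inverse (1 + s\<^sup>2) / pi) \<partial>lborel)" for f :: "real \<Rightarrow> complex" and x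
  proof -
    have "(\<integral>u. f u * complex_of_real (K x u) \<partial>lborel)
        = \<bar>e\<bar> *\<^sub>R (\<integral>s. f (x + e * s) * complex_of_real (K x (x + e * s)) \<partial>lborel)"
      by (rule lborel_integral_real_affine) (use e in simp)
    also have "\<dots> = (\<integral>s. e *\<^sub>R (f (x + e * s) * complex_of_real (K x (x + e * s))) \<partial>lborel)"
      using e by simp
    also have "\<dots> = (\<integral>s. f (x + e * s) * complex_of_real (inverse (1 + s\<^sup>2) / pi) \<partial>lborel)"
      by (intro Bochner_Integration.integral_cong refl) (use e in \<open>simp add: K scaleR_conv_of_real\<close>)
    finally show ?thesis .
  qed
  have Kint: "integrable lborel (K x)" for x
    using lborel_integrable_real_affine_iff[of e "K x" x] integrable_divide[OF integral_poisson_kernel(1), of e] e by (simp add: K)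
  have K1: "(\<integral>u. K x u \<partial>lborel) = 1" for x
    using lborel_integral_real_affine[of e "K x" x] integral_poisson_kernel(2) e by (simp add: K)
  have int2: "integrable (M \<Otimes>\<^sub>M lborel) (\<lambda>(x, u). iexp (t * u) * complex_of_real (K x u))"
  proof (rule Fubini_integrable)
    show "integrable M (\<lambda>x. \<integral>u. norm (case (x, u) of (x, u) \<Rightarrow> iexp (t * u) * complex_of_real (K x u)) \<partial>lborel)"
      using K1 Kpos by (simp add: norm_mult)
    show "AE x in M. integrable lborel (\<lambda>u. case (x, u) of (x, u) \<Rightarrow> iexp (t * u) * complex_of_real (K x u))"
    proof (rule AE_I2)
      fix x
      have "integrable lborel (\<lambda>u. iexp (t * u) * complex_of_real (K x u))"
      proof (rule Bochner_Integration.integrable_bound[OF Kint[of x]])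
        show "(\<lambda>u. iexp (t * u) * complex_of_real (K x u)) \<in> borel_measurable lborel"
          unfolding K_def by measurable
        show "AE u in lborel. norm (iexp (t * u) * complex_of_real (K x u)) \<le> norm (K x u)"
          by (rule AE_I2) (simp add: norm_mult del: of_real_mult)
      qed
      then show "integrable lborel (\<lambda>u. case (x, u) of (x, u) \<Rightarrow> iexp (t * u) * complex_of_real (K x u))"
        by simp
    qed
  qed measurable
  have "- Im (cauchy_transform M (Complex u e)) / pi = (\<integral>x. K x u \<partial>M)" for u
  proof -
    have "integrable M (\<lambda>x. 1 / (Complex u e - complex_of_real x))"
      by (rule finite_borel_measure_integrable[OF M, where B = "1 / \<bar>e\<bar>"])
        (use cauchy_kernel_bound[of "Complex u e"] e in auto)
    then show ?thesis unfolding cauchy_transform_def K_def by simp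
  qed
  then have "(\<integral>u. iexp (t * u) * complex_of_real (- Im (cauchy_transform M (Complex u e)) / pi) \<partial>lborel)
      = (\<integral>u. (\<integral>x. iexp (t * u) * complex_of_real (K x u) \<partial>M) \<partial>lborel)"
    by simp
  also have "\<dots> = (\<integral>x. (\<integral>u. iexp (t * u) * complex_of_real (K x u) \<partial>lborel) \<partial>M)"
    by (rule Fubini_integral) (use int2 in simp)
  also have "\<dots> = (\<integral>x. (\<integral>s. iexp (t * x) * (iexp (t * e * s) * complex_of_real (inverse (1 + s\<^sup>2) / pi)) \<partial>lborel) \<partial>M)"
    by (simp add: subst distrib_left exp_add mult.assoc)
  finally show ?thesis by simp
qed

lemma iexp_poisson_limit:
  "(\<lambda>n. \<integral>s. iexp (t * inverse (real (Suc n)) * s) * complex_of_real (inverse (1 + s\<^sup>2) / pi) \<partial>lborel) \<longlonglongrightarrow> 1"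
proof -
  have "(\<lambda>n. \<integral>s. iexp (t * inverse (real (Suc n)) * s) * complex_of_real (inverse (1 + s\<^sup>2) / pi) \<partial>lborel)
    \<longlonglongrightarrow> (\<integral>s. complex_of_real (inverse (1 + s\<^sup>2) / pi) \<partial>lborel)"
  proof (rule integral_dominated_convergence[where w = "\<lambda>s. inverse (1 + s\<^sup>2) / pi"])
    show "AE s in lborel. (\<lambda>n. iexp (t * inverse (real (Suc n)) * s) * complex_of_real (inverse (1 + s\<^sup>2) / pi))
       \<longlonglongrightarrow> complex_of_real (inverse (1 + s\<^sup>2) / pi)"
    proof (rule AE_I2)
      fix s :: real
      have "(\<lambda>n. iexp (t * inverse (real (Suc n)) * s) * complex_of_real (inverse (1 + s\<^sup>2) / pi))
         \<longlonglongrightarrow> iexp (t * 0 * s) * complex_of_real (inverse (1 + s\<^sup>2) / pi)"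
        by (intro tendsto_intros LIMSEQ_inverse_real_of_nat)
      then show "(\<lambda>n. iexp (t * inverse (real (Suc n)) * s) * complex_of_real (inverse (1 + s\<^sup>2) / pi))
         \<longlonglongrightarrow> complex_of_real (inverse (1 + s\<^sup>2) / pi)" by simp
    qed
    show "AE s in lborel. norm (iexp (t * inverse (real (Suc n)) * s) * complex_of_real (inverse (1 + s\<^sup>2) / pi))
        \<le> inverse (1 + s\<^sup>2) / pi" for n
      by (rule AE_I2) (simp only: norm_mult norm_exp_i_times norm_of_real, simp)
  qed (use integral_poisson_kernel in measurable)
  also have "(\<integral>s. complex_of_real (inverse (1 + s\<^sup>2) / pi) \<partial>lborel) = 1"
    unfolding integral_complex_of_real integral_poisson_kernel by simp
  finally show ?thesis .
qed

theorem cauchy_transform_eqI: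
  assumes M: "finite_borel_measure M" and N: "finite_borel_measure N"
    and eq: "\<And>z. Im z > 0 \<Longrightarrow> cauchy_transform M z = cauchy_transform N z"
  shows "M = N"
proof -
  interpret M: finite_borel_measure M by fact
  interpret N: finite_borel_measure N by fact
  note [measurable_cong] = M.M_is_borel N.M_is_borel
  have char: "(\<integral>x. iexp (t * x) \<partial>M) = (\<integral>x. iexp (t * x) \<partial>N)" for t
  proof (rule LIMSEQ_unique)
    let ?c = "\<lambda>n. \<integral>s. iexp (t * inverse (real (Suc n)) * s) * complex_of_real (inverse (1 + s\<^sup>2) / pi) \<partial>lborel"
    show "(\<lambda>n. (\<integral>x. iexp (t * x) \<partial>M) * ?c n) \<longlonglongrightarrow> (\<integral>x. iexp (t * x) \<partial>M)"
      using tendsto_mult_left[OF iexp_poisson_limit[of t], of "\<integral>x. iexp (t * x) \<partial>M"] by simp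
    have fac: "(\<integral>x. iexp (t * x) \<partial>M) * ?c n = (\<integral>x. iexp (t * x) \<partial>N) * ?c n" for n
      using cauchy_transform_poisson[OF M, of "inverse (real (Suc n))" t]
        cauchy_transform_poisson[OF N, of "inverse (real (Suc n))" t] eq by simp
    show "(\<lambda>n. (\<integral>x. iexp (t * x) \<partial>M) * ?c n) \<longlonglongrightarrow> (\<integral>x. iexp (t * x) \<partial>N)"
      using tendsto_mult_left[OF iexp_poisson_limit[of t], of "\<integral>x. iexp (t * x) \<partial>N"]
      by (simp only: fac mult_1_right)
  qed
  define m where "m = measure M UNIV"
  have spM: "space M = UNIV" "space N = UNIV"
    using M.M_is_borel N.M_is_borel sets_eq_imp_space_eq space_borel by metis+
  have mN: "measure N UNIV = m" using char[of 0] spM by (simp add: m_def)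
  have emM: "emeasure M UNIV = ennreal m" "emeasure N UNIV = ennreal m"
    using mN m_def by (simp_all add: M.emeasure_eq_measure N.emeasure_eq_measure)
  show ?thesis
  proof (cases "m = 0")
    case True
    then show ?thesis
      using emM by (intro measure_eqI)
        (auto simp: M.M_is_borel N.M_is_borel dest!: sets.sets_into_space intro!: antisym
          intro: emeasure_mono[of _ UNIV, THEN order_trans] simp: spM)
  next
    case False
    then have m: "m > 0" by (simp add: m_def less_le)
    have rd: "real_distribution (density L (\<lambda>_. ennreal (1 / m)))"
      if "finite_borel_measure L" "emeasure L UNIV = ennreal m" for L
    proof -
      interpret L: finite_borel_measure L by fact
      have "space L = UNIV" using L.M_is_borel sets_eq_imp_space_eq space_borel by metis
      then show ?thesis using that(2) m L.M_is_borel
        by (intro real_distribution.intro prob_spaceI real_distribution_axioms.intro)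
          (auto simp: emeasure_density_const ennreal_mult[symmetric] simp flip: ennreal_1)
    qed
    have eqd: "density M (\<lambda>_. ennreal (1 / m)) = density N (\<lambda>_. ennreal (1 / m))"
      using m char
      by (intro Levy_uniqueness rd M N emM) (auto simp: char_def integral_density fun_eq_iff)
    show ?thesis
    proof (rule measure_eqI)
      fix A assume "A \<in> sets M"
      then have A: "A \<in> sets M" "A \<in> sets N" using M.M_is_borel N.M_is_borel by auto
      have "ennreal (1 / m) * emeasure M A = ennreal (1 / m) * emeasure N A"
        using arg_cong[OF eqd, of "\<lambda>L. emeasure L A"] A by (simp add: emeasure_density_const)
      then show "emeasure M A = emeasure N A"
        using m by (simp add: M.emeasure_eq_measure N.emeasure_eq_measure flip: ennreal_mult)
    qed (simp add: M.M_is_borel N.M_is_borel)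
  qed
qed

section \<open>Spectral measures of a unitary operator\<close>

lemma cis_measurable [measurable]: "cis \<in> borel_measurable borel"
  by (intro borel_measurable_continuous_onI continuous_intros)

lemma integral_cis_period:
  fixes m :: int
  shows "(\<integral>t. indicator {0..2 * pi} t *\<^sub>R cis (real_of_int m * t) \<partial>lborel) = (if m = 0 then 2 * pi else 0)"
proof (cases "m = 0")
  case True
  then show ?thesis by (simp add: scaleR_conv_of_real)
next
  case False
  have "(\<integral>t. indicator {0..2 * pi} t *\<^sub>R cis (real_of_int m * t) \<partial>lborel)
      = cis (real_of_int m * (2 * pi)) / (\<i> * m) - cis (real_of_int m * 0) / (\<i> * m)"
  proof (rule integral_FTC_atLeastAtMost)
    fix x
    have "((\<lambda>t. cis (real_of_int m * t)) has_vector_derivative (real_of_int m *\<^sub>R (\<i> * cis (real_of_int m * x)))) (at x within {0..2 * pi})"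
      unfolding cis_conv_exp
      by (rule vector_diff_chain_within[where g = iexp and f = "\<lambda>t. real_of_int m * t", unfolded comp_def])
        (auto intro!: derivative_eq_intros simp: has_real_derivative_iff_has_vector_derivative[symmetric])
    from has_vector_derivative_divide[OF this, of "\<i> * m"] False
    show "((\<lambda>t. cis (real_of_int m * t) / (\<i> * m)) has_vector_derivative cis (real_of_int m * x)) (at x within {0..2 * pi})"
      by (simp add: scaleR_conv_of_real)
  qed (auto intro!: continuous_intros)
  also have "cis (real_of_int m * (2 * pi)) = 1"
    using cis_multiple_2pi[of "real_of_int m"] by (simp add: mult.commute mult.left_commute)
  finally show ?thesis using False by simp
qed

lemma integrable_cis_period:
  "integrable lborel (\<lambda>t. indicator {0..2 * pi} t *\<^sub>R (c * cis (r * t)))"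
  using borel_integrable_atLeastAtMost'[of 0 "2 * pi" "\<lambda>t. c * cis (r * t)"]
  by (simp add: set_integrable_def continuous_intros)

context
  fixes U V :: "'a::complex_hilbert_space \<Rightarrow> 'a"
  assumes adj: "adjoint_pair U V" and VU: "\<And>x. V (U x) = x"
begin

lemma isometry_power_cinner: "cinner ((U ^^ j) x) ((U ^^ (j + k)) x) = cinner x ((U ^^ k) x)"
proof (induction j)
  case (Suc j)
  have "cinner (U a) (U b) = cinner a b" for a b
    using adjoint_pairD[OF adjoint_pair_sym[OF adj], of a "U b"] VU by simp
  then show ?case using Suc by simp
qed simp

text \<open>The Fejer mean: a trigonometric polynomial that is non-negative because it is a squared norm,
  and whose Fourier coefficients are the numbers \<open>\<langle>x, U\<^sup>k x\<rangle>\<close> up to a factor tending to \<open>1\<close>.\<close>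

definition fejer :: "'a \<Rightarrow> nat \<Rightarrow> real \<Rightarrow> real" where
  "fejer x n t = (norm (\<Sum>j<n. cis (- (real j * t)) *\<^sub>C (U ^^ j) x))\<^sup>2 / (2 * pi * real n)"

lemma fejer_nonneg: "fejer x n t \<ge> 0"
  by (simp add: fejer_def)

lemma fejer_expand:
  "complex_of_real (fejer x n t) =
    (\<Sum>j<n. \<Sum>l<n. cinner ((U ^^ j) x) ((U ^^ l) x) * cis ((real j - real l) * t)) / (2 * pi * real n)"
proof -
  have entry: "cinner (cis (- (real j * t)) *\<^sub>C a) (cis (- (real l * t)) *\<^sub>C b) = cinner a b * cis ((real j - real l) * t)"
    for j l and a b :: 'a
  proof -
    have "cis (- (real l * t)) * cis (real j * t) = cis ((real j - real l) * t)"
      by (simp add: cis_mult algebra_simps)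
    then show ?thesis by (simp add: cinner_simps cis_cnj mult.left_commute[of "cis (- (real l * t))"] flip: mult.assoc)
  qed
  have "complex_of_real ((norm (\<Sum>j<n. cis (- (real j * t)) *\<^sub>C (U ^^ j) x))\<^sup>2)
    = (\<Sum>j<n. \<Sum>l<n. cinner ((U ^^ j) x) ((U ^^ l) x) * cis ((real j - real l) * t))"
    unfolding cinner_self[symmetric] by (simp only: cinner_sum_left) (simp only: cinner_sum_right entry)
  then show ?thesis unfolding fejer_def by simp
qed

lemma fejer_measurable [measurable]: "fejer x n \<in> borel_measurable borel"
proof -
  have "fejer x n = (\<lambda>t. Re (complex_of_real (fejer x n t)))" by simp
  also have "\<dots> \<in> borel_measurable borel"
    unfolding fejer_expand by measurable
  finally show ?thesis .
qed

lemma fejer_moment: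
  assumes "n > k"
  shows "(\<integral>t. (indicator {0..2 * pi} t * fejer x n t) *\<^sub>R cis (real k * t) \<partial>lborel)
      = (real (n - k) / real n) * cinner x ((U ^^ k) x)"
    and "integrable lborel (\<lambda>t. (indicator {0..2 * pi} t * fejer x n t) *\<^sub>R cis (real k * t))"
proof -
  define c where "c j l = cinner ((U ^^ j) x) ((U ^^ l) x) / (2 * pi * real n)" for j l
  have eq: "(indicator {0..2 * pi} t * fejer x n t) *\<^sub>R cis (real k * t)
      = (\<Sum>j<n. \<Sum>l<n. indicator {0..2 * pi} t *\<^sub>R (c j l * cis (real_of_int (int j - int l + int k) * t)))" for t
  proof -
    have "cis (real_of_int (int j - int l + int k) * t) = cis ((real j - real l) * t) * cis (real k * t)" for j l
      by (simp add: cis_mult algebra_simps)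
    then show ?thesis unfolding scaleR_conv_of_real of_real_mult fejer_expand c_def
      by (simp add: sum_divide_distrib sum_distrib_left sum_distrib_right mult_ac)
  qed
  show "integrable lborel (\<lambda>t. (indicator {0..2 * pi} t * fejer x n t) *\<^sub>R cis (real k * t))"
    unfolding eq by (intro Bochner_Integration.integrable_sum integrable_cis_period)
  have "(\<integral>t. (indicator {0..2 * pi} t * fejer x n t) *\<^sub>R cis (real k * t) \<partial>lborel)
    = (\<Sum>j<n. \<Sum>l<n. \<integral>t. indicator {0..2 * pi} t *\<^sub>R (c j l * cis (real_of_int (int j - int l + int k) * t)) \<partial>lborel)"
    unfolding eq
    by (simp only: Bochner_Integration.integral_sum integrable_cis_period Bochner_Integration.integrable_sum)
  also have "\<dots> = (\<Sum>j<n. \<Sum>l<n. c j l * (\<integral>t. indicator {0..2 * pi} t *\<^sub>R cis (real_of_int (int j - int l + int k) * t) \<partial>lborel))"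
    by (simp only: mult_scaleR_right[symmetric] integral_mult_right_zero)
  also have "\<dots> = (\<Sum>j<n. \<Sum>l<n. if l = j + k then c j l * (2 * pi) else 0)"
    unfolding integral_cis_period by (intro sum.cong refl) auto
  also have "\<dots> = (\<Sum>j<n. if j + k < n then cinner x ((U ^^ k) x) / real n else 0)"
    by (intro sum.cong refl) (auto simp: c_def isometry_power_cinner sum.delta)
  also have "\<dots> = (\<Sum>j\<in>{..<n - k}. cinner x ((U ^^ k) x) / real n)"
    by (rule sum.mono_neutral_cong_right) auto
  finally show "(\<integral>t. (indicator {0..2 * pi} t * fejer x n t) *\<^sub>R cis (real k * t) \<partial>lborel)
      = (real (n - k) / real n) * cinner x ((U ^^ k) x)" by simp
qed

text \<open>Herglotz's theorem for the positive definite sequence \<open>\<langle>x, U\<^sup>k x\<rangle>\<close>: the Fejer means are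
  densities of probability measures on a compact interval, hence have a weak limit point.\<close>

lemma circle_measure_exists:
  assumes x: "norm x = 1"
  shows "\<exists>M. real_distribution M \<and> (\<forall>k. (\<integral>t. cis (real k * t) \<partial>M) = cinner x ((U ^^ k) x))"
proof -
  define D where "D n t = indicator {0..2 * pi} t * fejer x (Suc n) t" for n and t :: real
  define \<mu> where "\<mu> n = density lborel (\<lambda>t. ennreal (D n t))" for n
  have D0: "D n t \<ge> 0" for n t by (simp add: D_def fejer_nonneg)
  have [measurable]: "D n \<in> borel_measurable borel" for n unfolding D_def by measurable
  have mom: "(\<integral>t. cis (real k * t) \<partial>\<mu> n) = (real (Suc n - k) / real (Suc n)) * cinner x ((U ^^ k) x)"
    if "k \<le> n" for k n
  proof -
    have [measurable]: "(\<lambda>t. cis (real k * t)) \<in> borel_measurable borel"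
      by (intro borel_measurable_continuous_onI continuous_intros)
    show ?thesis unfolding \<mu>_def using that fejer_moment(1)[of k "Suc n" x] D0
      by (subst integral_density) (auto simp: D_def)
  qed
  have cD: "complex_of_real (\<integral>t. D n t \<partial>lborel) = 1" "integrable lborel (D n)" for n
  proof -
    have "integrable lborel (\<lambda>t. complex_of_real (D n t))"
      using fejer_moment(2)[of 0 "Suc n" x] by (simp add: D_def scaleR_conv_of_real)
    then show "integrable lborel (D n)" by (simp add: complex_of_real_integrable_eq)
    show "complex_of_real (\<integral>t. D n t \<partial>lborel) = 1"
      using fejer_moment(1)[of 0 "Suc n" x] x by (simp add: D_def scaleR_conv_of_real cinner_self
          flip: integral_complex_of_real)
  qed
  have nn: "(\<integral>\<^sup>+t. ennreal (D n t) \<partial>lborel) = 1" for n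
    using nn_integral_eq_integral[OF cD(2)] cD(1) D0 by (simp add: of_real_eq_1_iff)
  have rd: "real_distribution (\<mu> n)" for n
    by (intro real_distribution.intro prob_spaceI real_distribution_axioms.intro)
      (auto simp: \<mu>_def emeasure_density nn)
  have "tight \<mu>"
    unfolding tight_def
  proof (intro conjI allI impI rd)
    fix e :: real assume "e > 0"
    have "measure (\<mu> n) {-1<..2*pi} = 1" for n
    proof -
      have "emeasure (\<mu> n) {-1<..2*pi} = (\<integral>\<^sup>+t. ennreal (D n t) * indicator {-1<..2*pi} t \<partial>lborel)"
        by (simp add: \<mu>_def emeasure_density)
      also have "\<dots> = (\<integral>\<^sup>+t. ennreal (D n t) \<partial>lborel)"
        by (intro nn_integral_cong) (auto simp: D_def split: split_indicator)
      finally show ?thesis by (simp add: nn measure_def)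
    qed
    then show "\<exists>a b. a < b \<and> (\<forall>n. 1 - e < measure (\<mu> n) {a<..b})"
      using \<open>e > 0\<close> by (intro exI[of _ "-1"] exI[of _ "2 * pi"]) (use pi_gt_zero in \<open>auto intro: less_trans[of "-1" 0]\<close>)
  qed
  from tight_imp_convergent_subsubsequence[OF this strict_mono_id]
  obtain r M where r: "strict_mono r" and M: "real_distribution M" and conv: "weak_conv_m (\<mu> \<circ> id \<circ> r) M"
    by blast
  have "(\<integral>t. cis (real k * t) \<partial>M) = cinner x ((U ^^ k) x)" for k
  proof (rule LIMSEQ_unique)
    show "(\<lambda>n. \<integral>t. cis (real k * t) \<partial>((\<mu> \<circ> id \<circ> r) n)) \<longlonglongrightarrow> (\<integral>t. cis (real k * t) \<partial>M)"
    proof (rule weak_conv_imp_integral_bdd_continuous_conv[OF _ M conv, where B = 1])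
      have "continuous_on UNIV (\<lambda>t. cis (real k * t))" by (intro continuous_intros)
      then show "isCont (\<lambda>t. cis (real k * t)) t" for t by (simp add: continuous_on_eq_continuous_at)
    qed (simp_all add: rd)
    have "(\<lambda>n. real (Suc n - k) / real (Suc n)) \<longlonglongrightarrow> 1"
    proof (rule Lim_transform_eventually)
      have "(\<lambda>n. 1 - real k * inverse (real (Suc n))) \<longlonglongrightarrow> 1 - real k * 0"
        by (intro tendsto_intros LIMSEQ_inverse_real_of_nat)
      then show "(\<lambda>n. 1 - real k * inverse (real (Suc n))) \<longlonglongrightarrow> 1" by simp
      show "\<forall>\<^sub>F n in sequentially. 1 - real k * inverse (real (Suc n)) = real (Suc n - k) / real (Suc n)"
        using eventually_ge_at_top[of k] by eventually_elim (simp add: field_simps of_nat_diff)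
    qed
    then have "(\<lambda>n. (real (Suc n - k) / real (Suc n)) * cinner x ((U ^^ k) x)) \<longlonglongrightarrow> 1 * cinner x ((U ^^ k) x)"
      by (intro tendsto_mult tendsto_const) (metis of_real_1 tendsto_of_real)
    then have "(\<lambda>n. (real (Suc n - k) / real (Suc n)) * cinner x ((U ^^ k) x)) \<longlonglongrightarrow> cinner x ((U ^^ k) x)"
      by (simp only: mult_1_left)
    then have "(\<lambda>n. \<integral>t. cis (real k * t) \<partial>\<mu> n) \<longlonglongrightarrow> cinner x ((U ^^ k) x)"
    proof (rule Lim_transform_eventually)
      show "\<forall>\<^sub>F n in sequentially. (real (Suc n - k) / real (Suc n)) * cinner x ((U ^^ k) x)
          = (\<integral>t. cis (real k * t) \<partial>\<mu> n)"
        using eventually_ge_at_top[of k] by eventually_elim (simp add: mom)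
    qed
    from LIMSEQ_subseq_LIMSEQ[OF this r]
    show "(\<lambda>n. \<integral>t. cis (real k * t) \<partial>((\<mu> \<circ> id \<circ> r) n)) \<longlonglongrightarrow> cinner x ((U ^^ k) x)"
      by (simp add: comp_def)
  qed
  then show ?thesis using M by blast
qed

text \<open>The mean ergodic theorem, in the case without fixed vectors: the means of \<open>U\<^sup>k y\<close> tend to \<open>0\<close>
  for \<open>y\<close> in the range of \<open>1 - U\<close>, and this range is dense.\<close>

lemma mean_ergodic:
  assumes UV: "\<And>x. U (V x) = x" and nofix: "\<And>x. U x = x \<Longrightarrow> x = 0"
  shows "(\<lambda>n. inverse (real (Suc n)) *\<^sub>R (\<Sum>k<Suc n. (U ^^ k) x)) \<longlonglongrightarrow> 0"
proof -
  define A where "A n y = inverse (real (Suc n)) *\<^sub>R (\<Sum>k<Suc n. (U ^^ k) y)" for n y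
  have Uadd: "U (x + y) = U x + U y" for x y by (rule adjoint_pair_add[OF adj])
  have UscaleR: "U (r *\<^sub>R x) = r *\<^sub>R U x" for r x
    unfolding scaleR_scaleC by (rule adjoint_pair_scaleC[OF adj])
  have Udiff: "U (x - y) = U x - U y" for x y by (rule adjoint_pair_diff[OF adj])
  have normU: "norm (U x) = norm x" for x
  proof -
    have "cinner (U x) (U x) = cinner x x"
      using adjoint_pairD[OF adjoint_pair_sym[OF adj], of x "U x"] VU by simp
    then have "(norm (U x))\<^sup>2 = (norm x)\<^sup>2" unfolding cinner_self of_real_eq_iff .
    then show ?thesis by (simp add: power2_eq_iff_nonneg)
  qed
  have pow: "(U ^^ k) (x + y) = (U ^^ k) x + (U ^^ k) y" "(U ^^ k) (r *\<^sub>R x) = r *\<^sub>R (U ^^ k) x"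
    "(U ^^ k) (x - y) = (U ^^ k) x - (U ^^ k) y" "norm ((U ^^ k) x) = norm x" for k x y r
    by (induction k) (simp_all add: Uadd UscaleR Udiff normU)
  have Alin: "A n (x + y) = A n x + A n y" "A n (r *\<^sub>R x) = r *\<^sub>R A n x" "A n (x - y) = A n x - A n y" for n x y r
    by (simp_all add: A_def pow sum.distrib sum_subtractf scaleR_add_right scaleR_diff_right
        scaleR_sum_right mult.commute del: sum.lessThan_Suc)
  have Anorm: "norm (A n x) \<le> norm x" for n x
  proof -
    have "norm (\<Sum>k<Suc n. (U ^^ k) x) \<le> real (Suc n) * norm x"
      using sum_norm_le[of "{..<Suc n}" "\<lambda>k. (U ^^ k) x" "\<lambda>_. norm x"] by (simp add: pow)
    then have "inverse (real (Suc n)) * norm (\<Sum>k<Suc n. (U ^^ k) x) \<le> inverse (real (Suc n)) * (real (Suc n) * norm x)"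
      by (rule mult_left_mono) simp
    also have "\<dots> = norm x" by simp
    finally show ?thesis unfolding A_def norm_scaleR by simp
  qed
  define D where "D = {x. (\<lambda>n. A n x) \<longlonglongrightarrow> 0}"
  have "D = UNIV"
  proof (rule closed_subspace_eq_UNIV)
    show "subspace D"
      by (rule subspaceI) (auto simp: D_def Alin A_def[of _ 0] pow(2)[of _ 0, simplified]
          intro: tendsto_add_zero tendsto_mult_right_zero tendsto_eq_intros)
    show "closed D"
    proof (unfold closed_sequential_limits, intro allI impI)
      fix y l assume yl: "(\<forall>n. y n \<in> D) \<and> y \<longlonglongrightarrow> l"
      show "l \<in> D" unfolding D_def
      proof (intro CollectI LIMSEQ_I)
        fix e :: real assume e: "e > 0"
        obtain m where m: "norm (y m - l) < e / 2"
          using yl e LIMSEQ_D[of y l "e / 2"] by auto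
        obtain N where N: "\<And>n. n \<ge> N \<Longrightarrow> norm (A n (y m) - 0) < e / 2"
          using yl e LIMSEQ_D[of "\<lambda>n. A n (y m)" 0 "e / 2"] unfolding D_def by auto
        have "norm (A n l - 0) < e" if "n \<ge> N" for n
          using N[OF that] Anorm[of n "y m - l"] m norm_triangle_ineq4[of "A n (y m)" "A n (y m - l)"]
          by (simp add: Alin)
        then show "\<exists>N. \<forall>n\<ge>N. norm (A n l - 0) < e" by blast
      qed
    qed
    have ran: "y - U y \<in> D" for y
    proof -
      have tel: "(\<Sum>k<n. (U ^^ k) (y - U y)) = y - (U ^^ n) y" for n
        by (induction n) (simp_all add: pow funpow_swap1)
      have b: "norm (A n (y - U y)) \<le> inverse (real (Suc n)) * (2 * norm y)" for n
        using norm_triangle_ineq4[of y "(U ^^ Suc n) y"]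
        unfolding A_def tel norm_scaleR by (simp add: pow(4) mult_left_mono del: funpow.simps)
      have l: "(\<lambda>n. inverse (real (Suc n)) * (2 * norm y)) \<longlonglongrightarrow> 0"
        by (intro tendsto_mult_left_zero LIMSEQ_inverse_real_of_nat)
      show ?thesis unfolding D_def
        using Lim_null_comparison[OF always_eventually[OF allI[OF b]] l] by simp
    qed
    fix z assume "\<And>m. m \<in> D \<Longrightarrow> inner z m = 0"
    then have "Re (cinner z (y - U y)) = 0" for y using ran by (simp add: inner_eq_Re_cinner)
    then have "Re (cinner (z - V z) y) = 0" for y
      by (simp add: cinner_simps adjoint_pairD[OF adj])
    from this[of "z - V z"] have "V z = z" by (simp add: cinner_self)
    then have "U z = z" using UV[of z] by simp
    then show "z = 0" by (rule nofix)
  qed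
  then show ?thesis unfolding D_def A_def by auto
qed

lemma cayley_inverse:
  assumes "cmod w = 1" "w \<noteq> 1"
  defines "x \<equiv> Re (\<i> * (1 + w) / (1 - w))"
  shows "(complex_of_real x - \<i>) / (complex_of_real x + \<i>) = w"
proof -
  have w: "w * cnj w = 1" using assms(1) by (simp add: complex_norm_square[symmetric])
  have nz: "1 - w \<noteq> 0" using assms(2) by simp
  then have nz': "1 - cnj w \<noteq> 0" by (metis complex_cnj_one_iff eq_iff_diff_eq_0 complex_cnj_cnj complex_cnj_one)
  have "cnj (\<i> * (1 + w) / (1 - w)) = \<i> * (1 + w) / (1 - w)"
  proof -
    have "(- \<i> * (1 + cnj w)) * (1 - w) = \<i> * (1 + w) * (1 - cnj w)"
      using w by (simp add: algebra_simps)
    then have "(- \<i> * (1 + cnj w)) / (1 - cnj w) = \<i> * (1 + w) / (1 - w)"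
      by (subst frac_eq_eq[OF nz' nz])
    then show ?thesis by simp
  qed
  then have x: "complex_of_real x = \<i> * (1 + w) / (1 - w)"
    unfolding x_def by (simp add: Reals_cnj_iff)
  have "complex_of_real x - \<i> = w * (2 * \<i> / (1 - w))" "complex_of_real x + \<i> = 2 * \<i> / (1 - w)"
    unfolding x using nz by (simp_all add: field_simps)
  moreover have "2 * \<i> / (1 - w) \<noteq> 0" using nz by simp
  ultimately show ?thesis using nonzero_mult_div_cancel_right[of "2 * \<i> / (1 - w)" w] by simp
qed

text \<open>The measure on the circle is carried to the line by the inverse of
  \<open>x \<mapsto> (x - i) / (x + i)\<close>, which misses only the point \<open>1\<close>.\<close>

theorem line_measure_exists:
  assumes UV: "\<And>x. U (V x) = x" and nofix: "\<And>x. U x = x \<Longrightarrow> x = 0"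
  shows "\<exists>M. finite_borel_measure M \<and>
    (\<forall>k. (\<integral>t. ((complex_of_real t - \<i>) / (complex_of_real t + \<i>)) ^ k \<partial>M) = cinner x ((U ^^ k) x))"
proof (cases "x = 0")
  case True
  have "(U ^^ k) 0 = 0" for k by (induction k) (simp_all add: adjoint_pair_zero[OF adj])
  moreover have "finite_borel_measure (null_measure borel)"
    by (intro finite_borel_measure.intro finite_measureI finite_borel_measure_axioms.intro) auto
  ultimately show ?thesis using True by (intro exI[of _ "null_measure borel"]) (simp add: integral_null_measure)
next
  case False
  define y where "y = inverse (norm x) *\<^sub>R x"
  have x: "x = norm x *\<^sub>R y" and y: "norm y = 1" using False by (simp_all add: y_def)
  obtain M where M: "real_distribution M" and mom: "\<And>k. (\<integral>t. cis (real k * t) \<partial>M) = cinner y ((U ^^ k) y)"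
    using circle_measure_exists[OF y] by blast
  interpret M: real_distribution M by fact
  note [measurable_cong] = M.events_eq_borel
  \<comment> \<open>The value \<open>1\<close> of \<open>cis t\<close>, which the Cayley transform sends to infinity, has probability zero.\<close>
  have avg: "(\<lambda>n. \<integral>t. inverse (real (Suc n)) *\<^sub>R (\<Sum>k<Suc n. cis (real k * t)) \<partial>M) \<longlonglongrightarrow> 0"
  proof -
    have "(\<integral>t. inverse (real (Suc n)) *\<^sub>R (\<Sum>k<Suc n. cis (real k * t)) \<partial>M)
        = cinner y (inverse (real (Suc n)) *\<^sub>R (\<Sum>k<Suc n. (U ^^ k) y))" for n
    proof -
      have "integrable M (\<lambda>t. cis (real k * t))" for k
        by (rule M.integrable_const_bound[where B = 1]) (auto intro!: borel_measurable_continuous_onI continuous_intros)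
      then show ?thesis
        by (simp add: Bochner_Integration.integral_sum mom cinner_scaleR_right cinner_sum_right scaleR_conv_of_real
            del: sum.lessThan_Suc)
    qed
    then show ?thesis
      using tendsto_cinner[OF tendsto_const[of y] mean_ergodic[OF UV nofix, of y]] by simp
  qed
  have lim: "(\<lambda>n. \<integral>t. inverse (real (Suc n)) *\<^sub>R (\<Sum>k<Suc n. cis (real k * t)) \<partial>M)
      \<longlonglongrightarrow> (\<integral>t. indicator {t. cis t = 1} t \<partial>M)"
  proof (rule integral_dominated_convergence[where w = "\<lambda>_. 1"])
    have "closed {t. cis t = 1}" by (intro closed_Collect_eq continuous_intros)
    then show "(indicator {t. cis t = 1} :: real \<Rightarrow> complex) \<in> borel_measurable M"
      by (intro borel_measurable_indicator) (auto simp: borel_closed)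
    show "AE t in M. (\<lambda>n. inverse (real (Suc n)) *\<^sub>R (\<Sum>k<Suc n. cis (real k * t))) \<longlonglongrightarrow> indicator {t. cis t = 1} t"
    proof (rule AE_I2)
      fix t
      have pw: "cis (real k * t) = cis t ^ k" for k by (rule Complex.DeMoivre[symmetric])
      show "(\<lambda>n. inverse (real (Suc n)) *\<^sub>R (\<Sum>k<Suc n. cis (real k * t))) \<longlonglongrightarrow> indicator {t. cis t = 1} t"
      proof (cases "cis t = 1")
        case True
        then have "inverse (real (Suc n)) *\<^sub>R (\<Sum>k<Suc n. cis (real k * t)) = 1" for n
          by (simp add: pw scaleR_conv_of_real del: sum.lessThan_Suc of_nat_Suc)
        then show ?thesis using True by simp
      next
        case False
        have b: "norm (inverse (real (Suc n)) *\<^sub>R (\<Sum>k<Suc n. cis (real k * t))) \<le> inverse (real (Suc n)) * (2 / cmod (1 - cis t))" for n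
        proof -
          have "(\<Sum>k<Suc n. cis (real k * t)) = (1 - cis t ^ Suc n) / (1 - cis t)"
            unfolding pw using False by (simp add: sum_gp_strict del: sum.lessThan_Suc)
          moreover have "cmod (1 - cis t ^ Suc n) \<le> 2"
            using norm_triangle_ineq4[of 1 "cis t ^ Suc n"] by (simp add: norm_power norm_mult)
          ultimately show ?thesis
            by (simp add: norm_divide divide_right_mono mult_left_mono del: sum.lessThan_Suc power_Suc)
        qed
        have l: "(\<lambda>n. inverse (real (Suc n)) * (2 / cmod (1 - cis t))) \<longlonglongrightarrow> 0"
          by (intro tendsto_mult_left_zero LIMSEQ_inverse_real_of_nat)
        show ?thesis
          using Lim_null_comparison[OF always_eventually[OF allI[OF b]] l] False by simp
      qed
    qed
    show "AE t in M. norm (inverse (real (Suc n)) *\<^sub>R (\<Sum>k<Suc n. cis (real k * t))) \<le> 1" for n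
    proof (rule AE_I2)
      fix t
      have "norm (\<Sum>k<Suc n. cis (real k * t)) \<le> real (Suc n)"
        using sum_norm_le[of "{..<Suc n}" "\<lambda>k. cis (real k * t)" "\<lambda>_. 1"] by simp
      then show "norm (inverse (real (Suc n)) *\<^sub>R (\<Sum>k<Suc n. cis (real k * t))) \<le> 1"
        by (simp add: field_simps del: sum.lessThan_Suc)
    qed
  qed (auto intro!: borel_measurable_continuous_onI continuous_intros)
  have int0: "(\<integral>t. indicator {t. cis t = 1} t \<partial>M) = (0::complex)"
    by (rule LIMSEQ_unique[OF lim avg])
  have cl: "{t. cis t = 1} \<in> sets M"
    using closed_Collect_eq[of cis "\<lambda>_. 1"] by (auto simp: borel_closed continuous_intros)
  have ae: "AE t in M. cis t \<noteq> 1"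
  proof -
    have "(indicator {t. cis t = 1} t :: complex) = complex_of_real (indicator {t. cis t = 1} t)" for t
      by (simp split: split_indicator)
    then have "measure M {t. cis t = 1} = 0" using int0 cl by simp
    then show ?thesis using cl by (intro AE_I[of _ _ "{t. cis t = 1}"]) (auto simp: M.emeasure_eq_measure)
  qed
  \<comment> \<open>Where \<open>cis t = 1\<close> the value is \<open>0\<close> by the convention for division; this is a null set.\<close>
  define g where "g t = Re (\<i> * (1 + cis t) / (1 - cis t))" for t
  have [measurable]: "g \<in> borel_measurable borel"
  proof -
    have [measurable]: "cis \<in> borel_measurable borel" by (intro borel_measurable_continuous_onI continuous_intros)
    show ?thesis unfolding g_def by measurable
  qed
  have [measurable]: "(\<lambda>t. ((complex_of_real t - \<i>) / (complex_of_real t + \<i>)) ^ k) \<in> borel_measurable borel" for k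
    by measurable
  define N where "N = density (distr M borel g) (\<lambda>_. ennreal ((norm x)\<^sup>2))"
  have "finite_borel_measure N"
  proof (intro finite_borel_measure.intro finite_measureI finite_borel_measure_axioms.intro)
    have "emeasure (distr M borel g) UNIV = 1" using M.emeasure_space_1 by (subst emeasure_distr) auto
    then show "emeasure N (space N) \<noteq> \<infinity>" by (simp add: N_def emeasure_density_const)
  qed (simp add: N_def)
  moreover have "(\<integral>t. ((complex_of_real t - \<i>) / (complex_of_real t + \<i>)) ^ k \<partial>N) = cinner x ((U ^^ k) x)" for k
  proof -
    have "(\<integral>t. ((complex_of_real t - \<i>) / (complex_of_real t + \<i>)) ^ k \<partial>N)
        = of_real ((norm x)\<^sup>2) * (\<integral>t. ((complex_of_real t - \<i>) / (complex_of_real t + \<i>)) ^ k \<partial>distr M borel g)"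
      unfolding N_def by (subst integral_density) (auto simp: scaleR_conv_of_real)
    also have "(\<integral>t. ((complex_of_real t - \<i>) / (complex_of_real t + \<i>)) ^ k \<partial>distr M borel g)
        = (\<integral>t. ((complex_of_real (g t) - \<i>) / (complex_of_real (g t) + \<i>)) ^ k \<partial>M)"
      by (subst integral_distr) auto
    also have "\<dots> = (\<integral>t. cis (real k * t) \<partial>M)"
    proof (rule integral_cong_AE)
      show "AE t in M. ((complex_of_real (g t) - \<i>) / (complex_of_real (g t) + \<i>)) ^ k = cis (real k * t)"
        using ae by eventually_elim (simp add: g_def cayley_inverse Complex.DeMoivre)
    qed (auto intro!: borel_measurable_continuous_onI continuous_intros)
    also have "of_real ((norm x)\<^sup>2) * (\<integral>t. cis (real k * t) \<partial>M) = cinner x ((U ^^ k) x)"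
    proof -
      have lin: "(U ^^ k) (r *\<^sub>R z) = r *\<^sub>R (U ^^ k) z" for r z
        by (induction k) (simp_all add: scaleR_scaleC adjoint_pair_scaleC[OF adj])
      have "cinner x ((U ^^ k) x) = cinner (norm x *\<^sub>R y) ((U ^^ k) (norm x *\<^sub>R y))"
        by (simp only: x[symmetric])
      then show ?thesis unfolding mom lin by (simp add: cinner_simps power2_eq_square)
    qed
    finally show ?thesis .
  qed
  ultimately show ?thesis by blast
qed

end

section \<open>Functional calculus from a family of measures\<close>

text \<open>The map \<open>s \<mapsto> s (3 - s\<^sup>2) / 2\<close> of Newton and Schulz preserves the interval \<open>[-1, 1]\<close>, and its
  iterates converge to the sign function there. So a class of functions that is closed under polynomial
  operations and bounded limits contains the sign of each of its members with values in \<open>[-1, 1]\<close>.\<close>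

definition sign_step :: "real \<Rightarrow> real" where
  "sign_step s = s * (3 - s\<^sup>2) / 2"

lemma sign_step_pos:
  assumes "0 < s" "s \<le> 1"
  shows "s \<le> sign_step s" "sign_step s \<le> 1"
proof -
  have "s\<^sup>2 \<le> 1" using assms by (simp add: power_le_one)
  then show "s \<le> sign_step s" using assms mult_left_mono[of 2 "3 - s\<^sup>2" s] by (simp add: sign_step_def)
  have "1 - sign_step s = (1 - s)\<^sup>2 * (2 + s) / 2"
    by (simp add: sign_step_def power2_eq_square field_simps)
  moreover have "\<dots> \<ge> 0" using assms by simp
  ultimately show "sign_step s \<le> 1" by linarith
qed

lemma sign_step_iterate_pos:
  assumes "0 < s" "s \<le> 1"
  shows "s \<le> (sign_step ^^ n) s \<and> (sign_step ^^ n) s \<le> 1"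
proof (induction n)
  case (Suc n)
  then have "(sign_step ^^ n) s \<le> sign_step ((sign_step ^^ n) s)" "sign_step ((sign_step ^^ n) s) \<le> 1"
    using assms by (auto intro!: sign_step_pos)
  then show ?case using Suc by simp
qed (use assms in simp)

lemma sign_step_iterate_limit:
  assumes "0 < s" "s \<le> 1"
  shows "(\<lambda>n. (sign_step ^^ n) s) \<longlonglongrightarrow> 1"
proof -
  have "incseq (\<lambda>n. (sign_step ^^ n) s)"
  proof (rule incseq_SucI)
    fix n show "(sign_step ^^ n) s \<le> (sign_step ^^ Suc n) s"
      using sign_step_pos(1)[of "(sign_step ^^ n) s"] sign_step_iterate_pos[OF assms, of n] assms by auto
  qed
  then obtain L where L: "(\<lambda>n. (sign_step ^^ n) s) \<longlonglongrightarrow> L"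
    using incseq_convergent[of "\<lambda>n. (sign_step ^^ n) s" 1] sign_step_iterate_pos[OF assms] by blast
  have "(\<lambda>n. sign_step ((sign_step ^^ n) s)) \<longlonglongrightarrow> sign_step L"
    unfolding sign_step_def[of L] sign_step_def[of "(sign_step ^^ _) s"] by (intro tendsto_intros L) simp
  moreover have "(\<lambda>n. sign_step ((sign_step ^^ n) s)) \<longlonglongrightarrow> L" using LIMSEQ_Suc[OF L] by simp
  ultimately have "sign_step L = L" by (rule LIMSEQ_unique)
  moreover have "s \<le> L" using LIMSEQ_le_const[OF L] sign_step_iterate_pos[OF assms] by blast
  ultimately have "L\<^sup>2 = 1" "L > 0" using assms by (auto simp: sign_step_def)
  then have "L = 1" by (simp add: power2_eq_1_iff)
  then show ?thesis using L by simp
qed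

lemma sign_step_iterate_minus: "(sign_step ^^ n) (- s) = - (sign_step ^^ n) s"
  by (induction n) (simp_all add: sign_step_def)

lemma sign_step_iterate_zero: "(sign_step ^^ n) 0 = 0"
  by (induction n) (simp_all add: sign_step_def)

lemma sign_step_iterate_sgn:
  assumes "\<bar>s\<bar> \<le> 1"
  shows "(\<lambda>n. (sign_step ^^ n) s) \<longlonglongrightarrow> sgn s" "\<bar>(sign_step ^^ n) s\<bar> \<le> 1"
proof -
  consider "s > 0" | "s = 0" | "- s > 0" by linarith
  then have "(\<lambda>n. (sign_step ^^ n) s) \<longlonglongrightarrow> sgn s \<and> \<bar>(sign_step ^^ n) s\<bar> \<le> 1"
  proof cases
    case 1
    then show ?thesis using sign_step_iterate_limit[of s] sign_step_iterate_pos[of s n] assms by auto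
  next
    case 2
    then show ?thesis by (simp add: sign_step_iterate_zero)
  next
    case 3
    have "(\<lambda>n. - (sign_step ^^ n) (- s)) \<longlonglongrightarrow> - 1"
      by (intro tendsto_minus sign_step_iterate_limit) (use 3 assms in auto)
    then show ?thesis
      using 3 assms sign_step_iterate_pos[of "- s" n] by (auto simp: sign_step_iterate_minus)
  qed
  then show "(\<lambda>n. (sign_step ^^ n) s) \<longlonglongrightarrow> sgn s" "\<bar>(sign_step ^^ n) s\<bar> \<le> 1" by auto
qed

text \<open>The data are a set \<open>G\<close> of triples: a function, the operator it stands for and the adjoint of
  this operator. The set is closed under products and adjoints, and each operator in it has a
  quadratic form given by integration against the measures \<open>\<mu> \<psi>\<close>. Because
  \<open>\<parallel>T \<psi>\<parallel>\<^sup>2\<close> is the integral of \<open>|f|\<^sup>2\<close>, bounded pointwise limits of functions give strong limits of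
  operators, and the calculus extends to all functions obtained by such limits. The adjoint is
  carried along since strong limits do not commute with taking adjoints in general.\<close>

locale spectral_calculus =
  fixes G :: "((real \<Rightarrow> complex) \<times> ('a::complex_hilbert_space \<Rightarrow> 'a) \<times> ('a \<Rightarrow> 'a)) set"
    and \<mu> :: "'a \<Rightarrow> real measure"
  assumes fin: "finite_borel_measure (\<mu> \<psi>)"
    and gen_one: "(\<lambda>_. 1, \<lambda>v. v, \<lambda>v. v) \<in> G"
    and gen_borel: "(f, T, S) \<in> G \<Longrightarrow> f \<in> borel_measurable borel"
    and gen_bounded: "(f, T, S) \<in> G \<Longrightarrow> \<exists>B. \<forall>x. cmod (f x) \<le> B"
    and gen_adjoint: "(f, T, S) \<in> G \<Longrightarrow> adjoint_pair T S"
    and gen_integral: "(f, T, S) \<in> G \<Longrightarrow> cinner \<psi> (T \<psi>) = (\<integral>x. f x \<partial>\<mu> \<psi>)"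
    and gen_mult: "(f, T, S) \<in> G \<Longrightarrow> (g, T', S') \<in> G \<Longrightarrow> (\<lambda>x. f x * g x, \<lambda>v. T (T' v), \<lambda>v. S' (S v)) \<in> G"
    and gen_cnj: "(f, T, S) \<in> G \<Longrightarrow> (\<lambda>x. cnj (f x), S, T) \<in> G"
begin

text \<open>The uniform bound \<open>K\<close> in the limit rule makes boundedness of the limit operator part of the induction;
  for the limits that occur it follows from the bound \<open>B\<close> on the functions.\<close>

inductive represents :: "(real \<Rightarrow> complex) \<Rightarrow> ('a \<Rightarrow> 'a) \<Rightarrow> ('a \<Rightarrow> 'a) \<Rightarrow> bool" where
  gen: "(f, T, S) \<in> G \<Longrightarrow> represents f T S"
| add: "represents f T S \<Longrightarrow> represents g T' S' \<Longrightarrow> represents (\<lambda>x. f x + g x) (\<lambda>v. T v + T' v) (\<lambda>v. S v + S' v)"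
| scale: "represents f T S \<Longrightarrow> represents (\<lambda>x. c * f x) (\<lambda>v. c *\<^sub>C T v) (\<lambda>v. cnj c *\<^sub>C S v)"
| lim: "(\<And>n. represents (f n) (T n) (S n)) \<Longrightarrow> (\<And>n x. cmod (f n x) \<le> B) \<Longrightarrow> (\<And>n v. norm (T n v) \<le> K * norm v)
    \<Longrightarrow> (\<And>x. (\<lambda>n. f n x) \<longlonglongrightarrow> g x) \<Longrightarrow> (\<And>v. (\<lambda>n. T n v) \<longlonglongrightarrow> T' v) \<Longrightarrow> (\<And>v. (\<lambda>n. S n v) \<longlonglongrightarrow> S' v)
    \<Longrightarrow> represents g T' S'"

lemma sets_mu [measurable_cong, simp]: "sets (\<mu> \<psi>) = sets borel"
  using fin by (simp add: finite_borel_measure_def finite_borel_measure_axioms_def)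

lemma space_mu [simp]: "space (\<mu> \<psi>) = UNIV"
  using sets_eq_imp_space_eq[OF sets_mu] by simp

lemma finite_measure_mu: "finite_measure (\<mu> \<psi>)"
  using fin by (simp add: finite_borel_measure_def)

lemma integrable_mu:
  fixes f :: "real \<Rightarrow> 'b::{banach,second_countable_topology}"
  shows "f \<in> borel_measurable borel \<Longrightarrow> (\<And>x. norm (f x) \<le> B) \<Longrightarrow> integrable (\<mu> \<psi>) f"
  by (rule finite_borel_measure_integrable[OF fin])

lemma measure_mu_UNIV: "measure (\<mu> \<psi>) UNIV = (norm \<psi>)\<^sup>2"
proof -
  have "complex_of_real ((norm \<psi>)\<^sup>2) = of_real (measure (\<mu> \<psi>) UNIV)"
    using gen_integral[OF gen_one, of \<psi>] by (simp add: cinner_self scaleR_conv_of_real)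
  then show ?thesis using of_real_eq_iff by metis
qed

lemma gen_norm:
  assumes "(f, T, S) \<in> G"
  shows "\<exists>K. \<forall>v. norm (T v) \<le> K * norm v"
proof -
  obtain B where B: "\<And>x. cmod (f x) \<le> B" using gen_bounded[OF assms] by blast
  have B0: "B \<ge> 0" using B[of 0] norm_ge_zero order_trans by blast
  have fb: "f \<in> borel_measurable borel" by (rule gen_borel[OF assms])
  have "norm (T v) \<le> B * norm v" for v
  proof (rule power2_le_imp_le)
    have "complex_of_real ((norm (T v))\<^sup>2) = cinner v (S (T v))"
      using adjoint_pairD[OF adjoint_pair_sym[OF gen_adjoint[OF assms]], of v "T v"]
      by (simp only: cinner_self)
    also have "\<dots> = (\<integral>x. cnj (f x) * f x \<partial>\<mu> v)"
      by (rule gen_integral[OF gen_mult[OF gen_cnj[OF assms] assms]])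
    finally have "(norm (T v))\<^sup>2 = cmod (\<integral>x. cnj (f x) * f x \<partial>\<mu> v)"
      by (metis abs_power2 norm_of_real)
    also have "\<dots> \<le> (\<integral>x. cmod (cnj (f x) * f x) \<partial>\<mu> v)" by (rule integral_norm_bound)
    also have "\<dots> \<le> (\<integral>x. B\<^sup>2 \<partial>\<mu> v)"
    proof (rule integral_mono)
      show "integrable (\<mu> v) (\<lambda>x. cmod (cnj (f x) * f x))"
        using fb B by (intro integrable_mu[where B = "B * B"]) (auto simp: norm_mult intro!: mult_mono B0)
      show "cmod (cnj (f x) * f x) \<le> B\<^sup>2" for x
        using B[of x] by (simp add: norm_mult power2_eq_square mult_mono B0)
    qed (auto intro: integrable_mu[where B = "B\<^sup>2"])
    finally show "(norm (T v))\<^sup>2 \<le> (B * norm v)\<^sup>2"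
      by (simp add: measure_mu_UNIV power_mult_distrib mult.commute)
  qed (use B0 in simp)
  then show ?thesis by blast
qed

lemma represents_basic:
  assumes "represents f T S"
  shows "f \<in> borel_measurable borel" and "\<exists>B. \<forall>x. cmod (f x) \<le> B" and "adjoint_pair T S"
    and "\<exists>K. \<forall>v. norm (T v) \<le> K * norm v" and "cinner \<psi> (T \<psi>) = (\<integral>x. f x \<partial>\<mu> \<psi>)"
proof -
  have "f \<in> borel_measurable borel \<and> (\<exists>B. \<forall>x. cmod (f x) \<le> B) \<and> adjoint_pair T S
    \<and> (\<exists>K. \<forall>v. norm (T v) \<le> K * norm v) \<and> (\<forall>\<psi>. cinner \<psi> (T \<psi>) = (\<integral>x. f x \<partial>\<mu> \<psi>))"
    using assms
  proof induction
    case (gen f T S)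
    then show ?case using gen_borel gen_bounded gen_adjoint gen_norm gen_integral by blast
  next
    case (add f T S g T' S')
    obtain B K B' K' where BK: "\<And>x. cmod (f x) \<le> B" "\<And>v. norm (T v) \<le> K * norm v"
      "\<And>x. cmod (g x) \<le> B'" "\<And>v. norm (T' v) \<le> K' * norm v" using add.IH by blast
    have fb: "f \<in> borel_measurable borel" "g \<in> borel_measurable borel" using add.IH by blast+
    have adj: "adjoint_pair T S" "adjoint_pair T' S'" using add.IH by blast+
    have int: "cinner \<psi> (T \<psi>) = (\<integral>x. f x \<partial>\<mu> \<psi>)" "cinner \<psi> (T' \<psi>) = (\<integral>x. g x \<partial>\<mu> \<psi>)" for \<psi>
      using add.IH by blast+
    have "cmod (f x + g x) \<le> B + B'" for x using norm_triangle_mono[OF BK(1,3)] .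
    moreover have "norm (T v + T' v) \<le> (K + K') * norm v" for v
      using norm_triangle_mono[OF BK(2,4)] by (simp add: distrib_right)
    moreover have "cinner \<psi> (T \<psi> + T' \<psi>) = (\<integral>x. f x + g x \<partial>\<mu> \<psi>)" for \<psi>
      by (simp add: cinner_add_right int integrable_mu[OF fb(1) BK(1)] integrable_mu[OF fb(2) BK(3)])
    moreover have "(\<lambda>x. f x + g x) \<in> borel_measurable borel" using fb by simp
    moreover have "adjoint_pair (\<lambda>v. T v + T' v) (\<lambda>v. S v + S' v)"
      unfolding adjoint_pair_def by (simp add: cinner_simps adjoint_pairD[OF adj(1)] adjoint_pairD[OF adj(2)])
    ultimately show ?case by blast
  next
    case (scale f T S c)
    obtain B K where BK: "\<And>x. cmod (f x) \<le> B" "\<And>v. norm (T v) \<le> K * norm v" using scale.IH by blast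
    have fb: "f \<in> borel_measurable borel" using scale.IH by blast
    have adj: "adjoint_pair T S" using scale.IH by blast
    have int: "cinner \<psi> (T \<psi>) = (\<integral>x. f x \<partial>\<mu> \<psi>)" for \<psi> using scale.IH by blast
    have "cmod (c * f x) \<le> cmod c * B" for x
      unfolding norm_mult by (intro mult_left_mono BK) simp
    moreover have "norm (c *\<^sub>C T v) \<le> (cmod c * K) * norm v" for v
      unfolding norm_scaleC mult.assoc by (intro mult_left_mono BK) simp
    moreover have "(\<lambda>x. c * f x) \<in> borel_measurable borel" using fb by simp
    moreover have "adjoint_pair (\<lambda>v. c *\<^sub>C T v) (\<lambda>v. cnj c *\<^sub>C S v)"
      unfolding adjoint_pair_def by (simp add: cinner_simps adjoint_pairD[OF adj])
    moreover have "cinner \<psi> (c *\<^sub>C T \<psi>) = (\<integral>x. c * f x \<partial>\<mu> \<psi>)" for \<psi>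
      by (simp add: cinner_simps int)
    ultimately show ?case by blast
  next
    case (lim f T S B K g T' S')
    have fm: "f n \<in> borel_measurable borel" for n using lim.IH[of n] by blast
    have fint: "cinner \<psi> (T n \<psi>) = (\<integral>x. f n x \<partial>\<mu> \<psi>)" for n \<psi> using lim.IH[of n] by blast
    have gm: "g \<in> borel_measurable borel"
      by (rule borel_measurable_LIMSEQ_metric[OF fm lim.hyps(4)])
    have gb: "cmod (g x) \<le> B" for x
      by (rule LIMSEQ_le_const2[OF tendsto_norm[OF lim.hyps(4)]]) (use lim.hyps(2) in blast)
    have adj: "adjoint_pair T' S'"
      unfolding adjoint_pair_def
    proof (intro allI)
      fix x y
      have "cinner x (T n y) = cinner (S n x) y" for n using lim.IH[of n] adjoint_pairD by blast
      then show "cinner x (T' y) = cinner (S' x) y"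
        using tendsto_cinner[OF tendsto_const[of x] lim.hyps(5)[of y]]
          tendsto_cinner[OF lim.hyps(6)[of x] tendsto_const[of y]] by (simp add: LIMSEQ_unique)
    qed
    have Tb: "norm (T' v) \<le> K * norm v" for v
      by (rule LIMSEQ_le_const2[OF tendsto_norm[OF lim.hyps(5)]]) (use lim.hyps(3) in blast)
    have int: "cinner \<psi> (T' \<psi>) = (\<integral>x. g x \<partial>\<mu> \<psi>)" for \<psi>
    proof (rule LIMSEQ_unique)
      show "(\<lambda>n. cinner \<psi> (T n \<psi>)) \<longlonglongrightarrow> cinner \<psi> (T' \<psi>)"
        by (intro tendsto_cinner tendsto_const lim)
      have "(\<lambda>n. \<integral>x. f n x \<partial>\<mu> \<psi>) \<longlonglongrightarrow> (\<integral>x. g x \<partial>\<mu> \<psi>)"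
      proof (rule integral_dominated_convergence[where w = "\<lambda>_. B"])
        show "integrable (\<mu> \<psi>) (\<lambda>_. B)" by (rule integrable_mu[where B = "norm B"]) auto
        show "g \<in> borel_measurable (\<mu> \<psi>)" using gm by simp
        show "f n \<in> borel_measurable (\<mu> \<psi>)" for n using fm by simp
        show "AE x in \<mu> \<psi>. (\<lambda>n. f n x) \<longlonglongrightarrow> g x" by (rule AE_I2) (rule lim.hyps(4))
        show "AE x in \<mu> \<psi>. norm (f n x) \<le> B" for n by (rule AE_I2) (rule lim.hyps(2))
      qed
      then show "(\<lambda>n. cinner \<psi> (T n \<psi>)) \<longlonglongrightarrow> (\<integral>x. g x \<partial>\<mu> \<psi>)" by (simp add: fint)
    qed
    show ?case using gm gb adj Tb int by blast
  qed
  then show "f \<in> borel_measurable borel" and "\<exists>B. \<forall>x. cmod (f x) \<le> B" and "adjoint_pair T S"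
    and "\<exists>K. \<forall>v. norm (T v) \<le> K * norm v" and "cinner \<psi> (T \<psi>) = (\<integral>x. f x \<partial>\<mu> \<psi>)" by auto
qed

lemma represents_tendsto:
  assumes "represents f T S" and "a \<longlonglongrightarrow> b"
  shows "(\<lambda>n. T (a n)) \<longlonglongrightarrow> T b"
proof -
  obtain K where "\<And>v. norm (T v) \<le> K * norm v" using represents_basic(4)[OF assms(1)] by blast
  from adjoint_pair_bounded_linear[OF represents_basic(3)[OF assms(1)] this]
  show ?thesis using assms(2) by (rule bounded_linear.tendsto)
qed

lemma represents_cnj: "represents f T S \<Longrightarrow> represents (\<lambda>x. cnj (f x)) S T"
proof (induction rule: represents.induct)
  case (gen f T S)
  then show ?case by (intro represents.gen gen_cnj)
next
  case (add f T S g T' S')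
  then show ?case using represents.add[OF add.IH] by simp
next
  case (scale f T S c)
  then show ?case using represents.scale[OF scale.IH, of "cnj c"] by simp
next
  case (lim f T S B K g T' S')
  have bound: "norm (S n v) \<le> K * norm v" for n v
    by (rule adjoint_pair_norm_bound[OF represents_basic(3)[OF lim.hyps(1)] lim.hyps(3)])
  show ?case
    by (rule represents.lim[OF lim.IH _ bound, where B = B]) (use lim.hyps in \<open>auto simp: lim_cnj\<close>)
qed

lemma represents_mult:
  assumes "represents f T S" and "represents g T' S'"
  shows "represents (\<lambda>x. f x * g x) (\<lambda>v. T (T' v)) (\<lambda>v. S' (S v))"
  using assms(1)
proof induction
  case (gen f T S)
  have repf: "represents f T S" by (rule represents.gen[OF gen])
  have adj: "adjoint_pair T S" by (rule gen_adjoint[OF gen])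
  obtain K0 where K0: "\<And>v. norm (T v) \<le> K0 * norm v" using represents_basic(4)[OF repf] by blast
  have K: "norm (T v) \<le> \<bar>K0\<bar> * norm v" for v
    using K0[of v] mult_right_mono[OF abs_ge_self[of K0], of "norm v"] by simp
  obtain B where B: "\<And>x. cmod (f x) \<le> B" using gen_bounded[OF gen] by blast
  have B0: "B \<ge> 0" using B[of 0] norm_ge_zero order_trans by blast
  from assms(2) show ?case
  proof induction
    case (gen g T' S')
    then show ?case using \<open>(f, T, S) \<in> G\<close> by (intro represents.gen gen_mult)
  next
    case (add g T' S' h T'' S'')
    show ?case using represents.add[OF add.IH] by (simp add: distrib_left adjoint_pair_add[OF adj])
  next
    case (scale g T' S' c)
    show ?case using represents.scale[OF scale.IH, of c]
      by (simp add: mult.left_commute adjoint_pair_scaleC[OF adj])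
  next
    case (lim g T' S' B' K' h T'' S'')
    show ?case
    proof (rule represents.lim[OF lim.IH, where B = "B * B'" and K = "\<bar>K0\<bar> * K'"])
      show "cmod (f x * g n x) \<le> B * B'" for n x
        using B[of x] lim.hyps(2)[of n x] B0 by (simp add: norm_mult mult_mono)
      show "norm (T (T' n v)) \<le> \<bar>K0\<bar> * K' * norm v" for n v
        using K[of "T' n v"] mult_left_mono[OF lim.hyps(3)[of n v], of "\<bar>K0\<bar>"] by (simp add: mult.assoc)
      show "(\<lambda>n. f x * g n x) \<longlonglongrightarrow> f x * h x" for x by (intro tendsto_intros lim)
      show "(\<lambda>n. T (T' n v)) \<longlonglongrightarrow> T (T'' v)" for v by (intro represents_tendsto[OF repf] lim)
      show "(\<lambda>n. S' n (S v)) \<longlonglongrightarrow> S'' (S v)" for v by (rule lim)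
    qed
  qed
next
  case (add f T S h T'' S'')
  show ?case using represents.add[OF add.IH]
    by (simp add: distrib_right adjoint_pair_add[OF adjoint_pair_sym[OF represents_basic(3)[OF assms(2)]]])
next
  case (scale f T S c)
  show ?case using represents.scale[OF scale.IH, of c]
    by (simp add: mult.assoc adjoint_pair_scaleC[OF adjoint_pair_sym[OF represents_basic(3)[OF assms(2)]]])
next
  case (lim f T S B K h T'' S'')
  obtain B' where B': "\<And>x. cmod (g x) \<le> B'" using represents_basic(2)[OF assms(2)] by blast
  obtain K' where K': "\<And>v. norm (T' v) \<le> K' * norm v" using represents_basic(4)[OF assms(2)] by blast
  have B0: "B \<ge> 0" using lim.hyps(2)[of 0 0] norm_ge_zero order_trans by blast
  show ?case
  proof (rule represents.lim[OF lim.IH, where B = "B * B'" and K = "\<bar>K\<bar> * K'"])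
    show "cmod (f n x * g x) \<le> B * B'" for n x
      using B'[of x] lim.hyps(2)[of n x] B0 by (simp add: norm_mult mult_mono)
    show "norm (T n (T' v)) \<le> \<bar>K\<bar> * K' * norm v" for n v
    proof -
      have "norm (T n (T' v)) \<le> \<bar>K\<bar> * norm (T' v)"
        using lim.hyps(3)[of n "T' v"] mult_right_mono[OF abs_ge_self[of K], of "norm (T' v)"] by simp
      also have "\<dots> \<le> \<bar>K\<bar> * (K' * norm v)" by (intro mult_left_mono K') simp
      finally show ?thesis by (simp add: mult.assoc)
    qed
    show "(\<lambda>n. f n x * g x) \<longlonglongrightarrow> h x * g x" for x by (intro tendsto_intros lim)
    show "(\<lambda>n. T n (T' v)) \<longlonglongrightarrow> T'' (T' v)" for v by (rule lim)
    show "(\<lambda>n. S' (S n v)) \<longlonglongrightarrow> S' (S'' v)" for v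
      by (intro represents_tendsto[OF represents_cnj[OF assms(2)]] lim)
  qed
qed

lemma represents_diff:
  assumes "represents f T S" "represents g T' S'"
  shows "represents (\<lambda>x. f x - g x) (\<lambda>v. T v - T' v) (\<lambda>v. S v - S' v)"
  using represents.add[OF assms(1) represents.scale[OF assms(2), of "-1"]]
  by (simp add: scaleC_minus_left)

lemma represents_const: "represents (\<lambda>_. c) (\<lambda>v. c *\<^sub>C v) (\<lambda>v. cnj c *\<^sub>C v)"
  using represents.scale[OF represents.gen[OF gen_one], of c] by simp

lemma represents_unique: "represents f T S \<Longrightarrow> represents f T' S' \<Longrightarrow> T = T'"
  by (rule adjoint_pair_eqI[OF represents_basic(3) represents_basic(3)]) (simp_all add: represents_basic(5))

lemma represents_norm:
  assumes "represents f T S"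
  shows "(norm (T \<psi>))\<^sup>2 = (\<integral>x. (cmod (f x))\<^sup>2 \<partial>\<mu> \<psi>)"
proof -
  have "complex_of_real ((norm (T \<psi>))\<^sup>2) = cinner \<psi> (S (T \<psi>))"
    using adjoint_pairD[OF adjoint_pair_sym[OF represents_basic(3)[OF assms]], of \<psi> "T \<psi>"]
    by (simp only: cinner_self)
  also have "\<dots> = (\<integral>x. cnj (f x) * f x \<partial>\<mu> \<psi>)"
    by (rule represents_basic(5)[OF represents_mult[OF represents_cnj[OF assms] assms]])
  also have "\<dots> = (\<integral>x. complex_of_real ((cmod (f x))\<^sup>2) \<partial>\<mu> \<psi>)"
    by (intro Bochner_Integration.integral_cong refl) (metis complex_norm_square mult.commute)
  finally show ?thesis unfolding integral_complex_of_real of_real_eq_iff .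
qed

lemma represents_norm_le:
  assumes "represents f T S" and B: "\<And>x. cmod (f x) \<le> B"
  shows "norm (T v) \<le> B * norm v"
proof (rule power2_le_imp_le)
  have B0: "B \<ge> 0" using B[of 0] norm_ge_zero order_trans by blast
  show "0 \<le> B * norm v" using B0 by simp
  have "(norm (T v))\<^sup>2 = (\<integral>x. (cmod (f x))\<^sup>2 \<partial>\<mu> v)" by (rule represents_norm[OF assms(1)])
  also have "\<dots> \<le> (\<integral>x. B\<^sup>2 \<partial>\<mu> v)"
  proof (rule integral_mono)
    show "integrable (\<mu> v) (\<lambda>x. (cmod (f x))\<^sup>2)"
      using represents_basic(1)[OF assms(1)] B
      by (intro integrable_mu[where B = "B\<^sup>2"]) (auto simp: power_mono)
  qed (auto simp: power_mono B intro: integrable_mu[where B = "B\<^sup>2"])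
  finally show "(norm (T v))\<^sup>2 \<le> (B * norm v)\<^sup>2"
    by (simp add: measure_mu_UNIV power_mult_distrib mult.commute)
qed

text \<open>The functions \<open>f\<^sub>n\<close> converge in \<open>L\<^sup>2(\<mu> \<psi>)\<close> by dominated convergence, and the calculus is isometric
  on this space. The dominating function may be unbounded; this is what later recovers the domain of
  an unbounded operator.\<close>

lemma represents_Cauchy:
  assumes rep: "\<And>n. represents (f n) (T n) (S n)"
    and g: "integrable (\<mu> \<psi>) (\<lambda>x. (g x)\<^sup>2)"
    and dom: "\<And>n x. cmod (f n x) \<le> g x" and lim: "\<And>x. (\<lambda>n. f n x) \<longlonglongrightarrow> h x"
  shows "Cauchy (\<lambda>n. T n \<psi>)"
proof -
  have [measurable]: "f n \<in> borel_measurable borel" for n by (rule represents_basic(1)[OF rep])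
  have [measurable]: "h \<in> borel_measurable borel" by (rule borel_measurable_LIMSEQ_metric[of f, OF _ lim]) measurable
  have hg: "cmod (h x) \<le> g x" for x
    by (rule LIMSEQ_le_const2[OF tendsto_norm[OF lim]]) (use dom in blast)
  have bound: "(cmod (f n x - h x))\<^sup>2 \<le> 4 * (g x)\<^sup>2" for n x
  proof -
    have "cmod (f n x - h x) \<le> 2 * g x" using norm_triangle_ineq4[of "f n x" "h x"] dom[of n x] hg[of x] by linarith
    then have "(cmod (f n x - h x))\<^sup>2 \<le> (2 * g x)\<^sup>2" by (rule power_mono) simp
    then show ?thesis by (simp add: power_mult_distrib)
  qed
  have int: "integrable (\<mu> \<psi>) (\<lambda>x. (cmod (f n x - h x))\<^sup>2)" for n
    by (rule Bochner_Integration.integrable_bound[OF integrable_mult_right[OF g, of 4]]) (use bound in auto)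
  have "(\<lambda>n. \<integral>x. (cmod (f n x - h x))\<^sup>2 \<partial>\<mu> \<psi>) \<longlonglongrightarrow> (\<integral>x. 0 \<partial>\<mu> \<psi>)"
  proof (rule integral_dominated_convergence[where w = "\<lambda>x. 4 * (g x)\<^sup>2"])
    show "AE x in \<mu> \<psi>. (\<lambda>n. (cmod (f n x - h x))\<^sup>2) \<longlonglongrightarrow> 0"
    proof (rule AE_I2)
      fix x
      have "(\<lambda>n. (cmod (f n x - h x))\<^sup>2) \<longlonglongrightarrow> (cmod (h x - h x))\<^sup>2" by (intro tendsto_intros lim)
      then show "(\<lambda>n. (cmod (f n x - h x))\<^sup>2) \<longlonglongrightarrow> 0" by simp
    qed
  qed (use g bound in auto)
  then have to0: "(\<lambda>n. \<integral>x. (cmod (f n x - h x))\<^sup>2 \<partial>\<mu> \<psi>) \<longlonglongrightarrow> 0" by simp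
  have dist: "(norm (T n \<psi> - T m \<psi>))\<^sup>2 \<le> 2 * (\<integral>x. (cmod (f n x - h x))\<^sup>2 \<partial>\<mu> \<psi>) + 2 * (\<integral>x. (cmod (f m x - h x))\<^sup>2 \<partial>\<mu> \<psi>)" for n m
  proof -
    have pt: "(cmod (f n x - f m x))\<^sup>2 \<le> 2 * (cmod (f n x - h x))\<^sup>2 + 2 * (cmod (f m x - h x))\<^sup>2" for x
    proof -
      have "cmod (f n x - f m x) \<le> cmod (f n x - h x) + cmod (f m x - h x)"
        using norm_triangle_ineq4[of "f n x - h x" "f m x - h x"] by simp
      then have "(cmod (f n x - f m x))\<^sup>2 \<le> (cmod (f n x - h x) + cmod (f m x - h x))\<^sup>2" by (rule power_mono) simp
      also have "\<dots> \<le> 2 * (cmod (f n x - h x))\<^sup>2 + 2 * (cmod (f m x - h x))\<^sup>2"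
        using sum_squares_bound[of "cmod (f n x - h x)" "cmod (f m x - h x)"] by (simp add: power2_sum)
      finally show ?thesis .
    qed
    have "(norm (T n \<psi> - T m \<psi>))\<^sup>2 = (\<integral>x. (cmod (f n x - f m x))\<^sup>2 \<partial>\<mu> \<psi>)"
      by (rule represents_norm[OF represents_diff[OF rep rep]])
    also have "\<dots> \<le> (\<integral>x. 2 * (cmod (f n x - h x))\<^sup>2 + 2 * (cmod (f m x - h x))\<^sup>2 \<partial>\<mu> \<psi>)"
      by (rule integral_mono_AE')
        (use int pt in \<open>auto intro!: Bochner_Integration.integrable_add integrable_mult_right\<close>)
    also have "\<dots> = 2 * (\<integral>x. (cmod (f n x - h x))\<^sup>2 \<partial>\<mu> \<psi>) + 2 * (\<integral>x. (cmod (f m x - h x))\<^sup>2 \<partial>\<mu> \<psi>)"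
      using int by simp
    finally show ?thesis .
  qed
  show ?thesis
  proof (rule metric_CauchyI)
    fix e :: real assume e: "e > 0"
    then have "e\<^sup>2 / 4 > 0" by simp
    then obtain N where N: "\<And>n. n \<ge> N \<Longrightarrow> norm ((\<integral>x. (cmod (f n x - h x))\<^sup>2 \<partial>\<mu> \<psi>) - 0) < e\<^sup>2 / 4"
      using LIMSEQ_D[OF to0] by blast
    show "\<exists>N. \<forall>n\<ge>N. \<forall>m\<ge>N. dist (T n \<psi>) (T m \<psi>) < e"
    proof (intro exI allI impI)
      fix n m assume "n \<ge> N" "m \<ge> N"
      then have "(norm (T n \<psi> - T m \<psi>))\<^sup>2 < e\<^sup>2" using dist[of n m] N[of n] N[of m] by simp
      then show "dist (T n \<psi>) (T m \<psi>) < e"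
        using e by (simp add: dist_norm power2_less_imp_less)
    qed
  qed
qed

lemma represents_limit:
  assumes rep: "\<And>n. represents (f n) (T n) (S n)"
    and bound: "\<And>n x. cmod (f n x) \<le> B" and lim: "\<And>x. (\<lambda>n. f n x) \<longlonglongrightarrow> h x"
  shows "\<exists>T' S'. represents h T' S' \<and> (\<forall>v. (\<lambda>n. T n v) \<longlonglongrightarrow> T' v)"
proof -
  have g: "integrable (\<mu> v) (\<lambda>x. B\<^sup>2)" for v by (rule integrable_mu[where B = "B\<^sup>2"]) auto
  have "\<exists>w. (\<lambda>n. T n v) \<longlonglongrightarrow> w" for v
    using represents_Cauchy[OF rep g bound lim] Cauchy_convergent convergent_def by blast
  then obtain T' where T': "\<And>v. (\<lambda>n. T n v) \<longlonglongrightarrow> T' v" by metis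
  have "Cauchy (\<lambda>n. S n v)" for v
    by (rule represents_Cauchy[OF represents_cnj[OF rep] g, where h = "\<lambda>x. cnj (h x)"])
      (use bound lim in \<open>auto simp: lim_cnj\<close>)
  then have "\<exists>w. (\<lambda>n. S n v) \<longlonglongrightarrow> w" for v using Cauchy_convergent convergent_def by blast
  then obtain S' where S': "\<And>v. (\<lambda>n. S n v) \<longlonglongrightarrow> S' v" by metis
  have "represents h T' S'"
    by (rule represents.lim[OF rep bound represents_norm_le[OF rep bound] lim T' S'])
  then show ?thesis using T' by blast
qed

definition representable :: "(real \<Rightarrow> complex) \<Rightarrow> bool" where
  "representable f \<longleftrightarrow> (\<exists>T S. represents f T S)"

lemma representable_add: "representable f \<Longrightarrow> representable g \<Longrightarrow> representable (\<lambda>x. f x + g x)"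
  unfolding representable_def using represents.add by blast

lemma representable_mult: "representable f \<Longrightarrow> representable g \<Longrightarrow> representable (\<lambda>x. f x * g x)"
  unfolding representable_def using represents_mult by blast

lemma representable_diff: "representable f \<Longrightarrow> representable g \<Longrightarrow> representable (\<lambda>x. f x - g x)"
  unfolding representable_def using represents_diff by blast

lemma representable_const: "representable (\<lambda>_. c)"
  unfolding representable_def using represents_const by blast

lemma representable_cnj: "representable f \<Longrightarrow> representable (\<lambda>x. cnj (f x))"
  unfolding representable_def using represents_cnj by blast

lemma representable_sum:
  assumes "\<And>i. i \<in> I \<Longrightarrow> representable (f i)"
  shows "representable (\<lambda>x. \<Sum>i\<in>I. f i x)"
  using assms by (induction I rule: infinite_finite_induct) (auto intro: representable_const representable_add)

lemma representable_limit:
  assumes "\<And>n. representable (f n)" "\<And>n x. cmod (f n x) \<le> B" "\<And>x. (\<lambda>n. f n x) \<longlonglongrightarrow> h x"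
  shows "representable h"
proof -
  obtain T S where "\<And>n. represents (f n) (T n) (S n)"
    using assms(1) unfolding representable_def by metis
  from represents_limit[OF this assms(2,3)] show ?thesis unfolding representable_def by blast
qed

lemma representable_indicator_pos:
  assumes h: "representable (\<lambda>x. complex_of_real (h x))" and bound: "\<And>x. \<bar>h x\<bar> \<le> 1"
  shows "representable (\<lambda>x. complex_of_real (indicator {x. h x > 0} x))"
proof -
  have "representable (\<lambda>x. complex_of_real ((sign_step ^^ n) (h x)))" for n
  proof (induction n)
    case (Suc n)
    have "representable (\<lambda>x. complex_of_real ((sign_step ^^ n) (h x)) *
       ((3 - complex_of_real ((sign_step ^^ n) (h x)) * complex_of_real ((sign_step ^^ n) (h x))) * (1/2)))"
      by (intro representable_mult representable_diff representable_const Suc)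
    moreover have "complex_of_real ((sign_step ^^ Suc n) y) = complex_of_real ((sign_step ^^ n) y) *
       ((3 - complex_of_real ((sign_step ^^ n) y) * complex_of_real ((sign_step ^^ n) y)) * (1/2))" for y
      by (simp add: sign_step_def[of "(sign_step ^^ n) y"] power2_eq_square)
    ultimately show ?case by (simp only:)
  qed (use h in simp)
  then have "representable (\<lambda>x. complex_of_real (sgn (h x)))"
    by (rule representable_limit[where B = 1]) (use sign_step_iterate_sgn[OF bound] in \<open>auto intro!: tendsto_of_real\<close>)
  then have "representable (\<lambda>x. complex_of_real (sgn (h x)) * ((1 + complex_of_real (sgn (h x))) * (1/2)))"
    by (intro representable_mult representable_add representable_const)
  also have "(\<lambda>x. complex_of_real (sgn (h x)) * ((1 + complex_of_real (sgn (h x))) * (1/2)))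
      = (\<lambda>x. complex_of_real (indicator {x. h x > 0} x))"
    by (auto simp: fun_eq_iff sgn_if)
  finally show ?thesis .
qed

lemma representable_indicator_borel:
  assumes half: "\<And>a. representable (\<lambda>x. complex_of_real (indicator {a<..} x))"
    and A: "A \<in> sets borel"
  shows "representable (\<lambda>x. complex_of_real (indicator A x))"
proof -
  have "{a<..} \<inter> {b<..} = {max a b<..}" for a b :: real by auto
  then have "Int_stable (range (\<lambda>a::real. {a<..}))" by (auto simp: Int_stable_def)
  moreover have "range (\<lambda>a::real. {a<..}) \<subseteq> Pow UNIV" by simp
  moreover have "A \<in> sigma_sets UNIV (range (\<lambda>a::real. {a<..}))"
    using A unfolding borel_Ioi by simp
  ultimately show ?thesis
  proof (induction rule: sigma_sets_induct_disjoint)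
    case (basic A)
    then show ?case using half by auto
  next
    case empty
    then show ?case using representable_const[of 0] by simp
  next
    case (compl A)
    have "representable (\<lambda>x. 1 - complex_of_real (indicator A x))"
      by (intro representable_diff representable_const compl)
    then show ?case by (simp add: indicator_compl Compl_eq_Diff_UNIV[symmetric])
  next
    case (union A)
    have sum: "representable (\<lambda>x. \<Sum>i<n. complex_of_real (indicator (A i) x))" for n
      by (intro representable_sum union.IH)
    have "(\<Sum>i<n. complex_of_real (indicator (A i) x)) = complex_of_real (indicator (\<Union>i<n. A i) x)" for n x
    proof -
      have "disjoint_family_on A {..<n}" using union.hyps(1) by (rule disjoint_family_on_mono[rotated]) simp
      then have "(indicator (\<Union>i<n. A i) x :: real) = (\<Sum>i<n. indicator (A i) x)"
        by (intro indicator_UN_disjoint) simp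
      then show ?thesis by simp
    qed
    then have rep: "representable (\<lambda>x. complex_of_real (indicator (\<Union>i<n. A i) x))" for n
      using sum[of n] by (simp only:)
    have lim: "(\<lambda>n. complex_of_real (indicator (\<Union>i<n. A i) x)) \<longlonglongrightarrow> complex_of_real (indicator (\<Union>i. A i) x)" for x
      by (intro tendsto_of_real LIMSEQ_indicator_UN)
    show ?case by (rule representable_limit[OF rep _ lim, where B = 1]) (simp add: indicator_def)
  qed
qed

end

section \<open>Projection-valued measures\<close>

definition bounded_borel :: "(real \<Rightarrow> complex) \<Rightarrow> bool" where
  "bounded_borel f \<longleftrightarrow> f \<in> borel_measurable borel \<and> (\<exists>B. \<forall>x. cmod (f x) \<le> B)"

lemma bounded_borelI: "f \<in> borel_measurable borel \<Longrightarrow> (\<And>x. cmod (f x) \<le> B) \<Longrightarrow> bounded_borel f"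
  unfolding bounded_borel_def by blast

lemma bounded_borel_indicator: "A \<in> sets borel \<Longrightarrow> bounded_borel (\<lambda>x. complex_of_real (indicator A x))"
  by (rule bounded_borelI[where B = 1]) (auto simp: indicator_def)

lemma bounded_borel_cnj:
  assumes "bounded_borel f"
  shows "bounded_borel (\<lambda>x. cnj (f x))"
proof -
  have "cnj \<in> borel_measurable borel" by (intro borel_measurable_continuous_onI continuous_intros)
  from measurable_compose[OF _ this] show ?thesis using assms unfolding bounded_borel_def by auto
qed

lemma bounded_borel_mult: "bounded_borel f \<Longrightarrow> bounded_borel g \<Longrightarrow> bounded_borel (\<lambda>x. f x * g x)"
  unfolding bounded_borel_def
  by (auto simp: norm_mult intro!: exI[of _ "_ * _"] mult_mono dest: spec intro: order_trans[OF norm_ge_zero])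

lemma bounded_borel_add:
  assumes "bounded_borel f" "bounded_borel g"
  shows "bounded_borel (\<lambda>x. f x + g x)"
proof -
  obtain B C where "\<And>x. cmod (f x) \<le> B" "\<And>x. cmod (g x) \<le> C" using assms unfolding bounded_borel_def by blast
  then have "cmod (f x + g x) \<le> B + C" for x by (rule norm_triangle_mono)
  then show ?thesis using assms unfolding bounded_borel_def by auto
qed

lemma bounded_borel_const: "bounded_borel (\<lambda>_. c)"
  unfolding bounded_borel_def by auto

lemma cmod_shift_i: "(cmod (complex_of_real x + \<i>))\<^sup>2 = x\<^sup>2 + 1" "(cmod (complex_of_real x - \<i>))\<^sup>2 = x\<^sup>2 + 1"
  by (simp_all add: cmod_power2)

lemma shift_i_nonzero: "complex_of_real x + \<i> \<noteq> 0" "complex_of_real x - \<i> \<noteq> 0"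
  by (simp_all add: complex_eq_iff)

locale borel_spectral_calculus = spectral_calculus +
  assumes representable_indicator: "A \<in> sets borel \<Longrightarrow> representable (\<lambda>x. complex_of_real (indicator A x))"
begin

lemma representable_bounded_borel:
  assumes "bounded_borel f"
  shows "representable f"
proof -
  obtain B where B: "\<And>x. cmod (f x) \<le> B" using assms bounded_borel_def by blast
  have "f \<in> borel_measurable borel" using assms by (simp add: bounded_borel_def)
  from borel_measurable_implies_sequence_metric[OF this, of 0]
  obtain F where F': "(\<forall>i. simple_function borel (F i)) \<and> (\<forall>x\<in>space borel. (\<lambda>i. F i x) \<longlonglongrightarrow> f x) \<and>
    (\<forall>i. \<forall>x\<in>space borel. dist (F i x) 0 \<le> 2 * dist (f x) 0)" ..
  have F: "simple_function borel (F i)" "(\<lambda>i. F i x) \<longlonglongrightarrow> f x" "cmod (F i x) \<le> 2 * cmod (f x)" for i x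
    using F'[THEN conjunct1, rule_format, of i] F'[THEN conjunct2, THEN conjunct1, rule_format, of x]
      F'[THEN conjunct2, THEN conjunct2, rule_format, of x i] by simp_all
  have "representable (F i)" for i
  proof -
    have "F i x = (\<Sum>y\<in>F i ` space borel. indicator (F i -` {y} \<inter> space borel) x *\<^sub>R y)" for x
      by (rule simple_function_indicator_representation_banach[OF F(1)]) simp
    then have eq: "F i = (\<lambda>x. \<Sum>y\<in>range (F i). complex_of_real (indicator (F i -` {y}) x) * y)"
      unfolding space_borel Int_UNIV_right scaleR_conv_of_real by (rule ext)
    have sets: "F i -` {y} \<in> sets borel" for y
      using simple_functionD(2)[OF F(1)[of i], of "{y}"] by simp
    show ?thesis
      by (subst eq) (intro representable_sum representable_mult representable_const representable_indicator sets)
  qed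
  moreover have "cmod (F i x) \<le> 2 * B" for i x using F(3)[of i x] B[of x] by linarith
  ultimately show ?thesis using F(2) by (rule representable_limit)
qed

definition calc :: "(real \<Rightarrow> complex) \<Rightarrow> 'a \<Rightarrow> 'a" where
  "calc f = (SOME T. \<exists>S. represents f T S)"

lemma calc_eqI: "represents f T S \<Longrightarrow> calc f = T"
  unfolding calc_def by (rule some_equality) (auto intro: represents_unique)

lemma represents_calc:
  assumes "bounded_borel f"
  shows "represents f (calc f) (calc (\<lambda>x. cnj (f x)))"
proof -
  obtain T S where TS: "represents f T S"
    using representable_bounded_borel[OF assms] unfolding representable_def by blast
  then show ?thesis using calc_eqI[OF TS] calc_eqI[OF represents_cnj[OF TS]] by simp
qed

definition spectral_projection :: "real set \<Rightarrow> 'a \<Rightarrow> 'a" where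
  "spectral_projection A = calc (\<lambda>x. complex_of_real (indicator A x))"

lemma represents_spectral_projection:
  "A \<in> sets borel \<Longrightarrow>
    represents (\<lambda>x. complex_of_real (indicator A x)) (spectral_projection A) (spectral_projection A)"
  using represents_calc[OF bounded_borel_indicator[of A]] by (simp add: spectral_projection_def)

lemma projection_valued_measure_spectral_projection: "projection_valued_measure spectral_projection"
  unfolding projection_valued_measure_def
proof (intro conjI ballI allI impI)
  fix A :: "real set" assume A: "A \<in> sets borel"
  let ?E = "spectral_projection A"
  note rep = represents_spectral_projection[OF A]
  note adj = represents_basic(3)[OF rep]
  have "?E \<circ> ?E = ?E"
  proof -
    have "complex_of_real (indicator A x) * complex_of_real (indicator A x) = complex_of_real (indicator A x)" for x
      by (simp split: split_indicator)
    then have "represents (\<lambda>x. complex_of_real (indicator A x)) (\<lambda>v. ?E (?E v)) (\<lambda>v. ?E (?E v))"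
      using represents_mult[OF rep rep] by (simp only:)
    from represents_unique[OF this rep] show ?thesis by (simp add: comp_def)
  qed
  moreover obtain K where "\<And>v. norm (?E v) \<le> K * norm v" using represents_basic(4)[OF rep] by blast
  then have "bounded_linear ?E" by (rule adjoint_pair_bounded_linear[OF adj])
  ultimately show "orthogonal_projection ?E"
    unfolding orthogonal_projection_def using adjoint_pair_scaleC[OF adj] adjoint_pairD[OF adj] by blast
next
  have "represents (\<lambda>_. 1) (spectral_projection UNIV) (spectral_projection UNIV)"
    using represents_spectral_projection[of UNIV] by simp
  from represents_unique[OF this represents_const] show "spectral_projection UNIV = id"
    by (simp add: fun_eq_iff)
next
  fix A :: "nat \<Rightarrow> real set" and \<psi>
  assume A: "range A \<subseteq> sets borel" and disj: "disjoint_family A"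
  let ?f = "\<lambda>n x. complex_of_real (indicator (\<Union>i<n. A i) x)"
  have An: "A i \<in> sets borel" for i using A by auto
  have rep: "represents (?f n) (\<lambda>v. \<Sum>i<n. spectral_projection (A i) v) (\<lambda>v. \<Sum>i<n. spectral_projection (A i) v)" for n
  proof (induction n)
    case 0
    then show ?case using represents_const[of 0] by simp
  next
    case (Suc n)
    have "A n \<inter> A i = {}" if "i < n" for i
      using disj that unfolding disjoint_family_on_def by (metis UNIV_I less_irrefl)
    then have "A n \<inter> (\<Union>i<n. A i) = {}" by blast
    moreover have "(\<Union>i<Suc n. A i) = A n \<union> (\<Union>i<n. A i)" by (simp add: lessThan_Suc)
    ultimately have "?f (Suc n) x = ?f n x + complex_of_real (indicator (A n) x)" for x
      by (auto simp: indicator_def)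
    then have eq: "?f (Suc n) = (\<lambda>x. ?f n x + complex_of_real (indicator (A n) x))" by (rule ext)
    show ?case unfolding eq using represents.add[OF Suc represents_spectral_projection[OF An[of n]]] by simp
  qed
  have lim: "(\<lambda>n. ?f n x) \<longlonglongrightarrow> complex_of_real (indicator (\<Union>i. A i) x)" for x
    by (intro tendsto_of_real LIMSEQ_indicator_UN)
  obtain T S where TS: "represents (\<lambda>x. complex_of_real (indicator (\<Union>i. A i) x)) T S"
      "\<And>v. (\<lambda>n. \<Sum>i<n. spectral_projection (A i) v) \<longlonglongrightarrow> T v"
    using represents_limit[OF rep _ lim, of 1] by (auto simp: indicator_def)
  have "T = spectral_projection (\<Union>i. A i)"
    by (rule represents_unique[OF TS(1) represents_spectral_projection]) (use An in blast)
  then show "(\<lambda>n. spectral_projection (A n) \<psi>) sums spectral_projection (\<Union>n. A n) \<psi>"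
    using TS(2) by (simp add: sums_def)
qed

lemma measure_spectral_projection:
  assumes "A \<in> sets borel"
  shows "cinner \<psi> (spectral_projection A \<psi>) = of_real (measure (\<mu> \<psi>) A)"
  using represents_basic(5)[OF represents_spectral_projection[OF assms], of \<psi>] assms by simp

lemma vector_measure_spectral_projection: "vector_measure spectral_projection \<psi> = \<mu> \<psi>"
proof -
  have "vector_measure spectral_projection \<psi> = measure_of UNIV (sets borel) (emeasure (\<mu> \<psi>))"
    unfolding vector_measure_def
  proof (rule measure_of_eq)
    fix A :: "real set" assume "A \<in> sigma_sets UNIV (sets borel)"
    then have A: "A \<in> sets borel" using sets.sigma_sets_eq[of "borel :: real measure"] by simp
    show "ennreal (Re (cinner \<psi> (spectral_projection A \<psi>))) = emeasure (\<mu> \<psi>) A"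
      using measure_spectral_projection[OF A] finite_measure.emeasure_eq_measure[OF finite_measure_mu] by simp
  qed simp
  also have "\<dots> = \<mu> \<psi>" using measure_of_of_measure[of "\<mu> \<psi>"] by simp
  finally show ?thesis .
qed

text \<open>The measure of \<open>A\<close> at \<open>T \<psi>\<close> is \<open>\<langle>\<psi>, T\<^sup>* E(A) T \<psi>\<rangle>\<close>, and the product of the three operators represents
  \<open>|f|\<^sup>2\<close> times the indicator of \<open>A\<close>.\<close>

lemma mu_represents:
  assumes rep: "represents f T S"
  shows "\<mu> (T \<psi>) = density (\<mu> \<psi>) (\<lambda>x. ennreal ((cmod (f x))\<^sup>2))"
proof (rule measure_eqI)
  fix A assume "A \<in> sets (\<mu> (T \<psi>))"
  then have A: "A \<in> sets borel" by simp
  have fb [measurable]: "f \<in> borel_measurable borel" by (rule represents_basic(1)[OF rep])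
  obtain B where B: "\<And>x. cmod (f x) \<le> B" using represents_basic(2)[OF rep] by blast
  have "complex_of_real (measure (\<mu> (T \<psi>)) A) = cinner \<psi> (S (spectral_projection A (T \<psi>)))"
    unfolding measure_spectral_projection[OF A, symmetric]
    using adjoint_pairD[OF adjoint_pair_sym[OF represents_basic(3)[OF rep]]] by simp
  also have "\<dots> = (\<integral>x. cnj (f x) * (complex_of_real (indicator A x) * f x) \<partial>\<mu> \<psi>)"
    by (rule represents_basic(5)[OF represents_mult[OF represents_cnj[OF rep]
          represents_mult[OF represents_spectral_projection[OF A] rep]]])
  also have "\<dots> = (\<integral>x. complex_of_real ((cmod (f x))\<^sup>2 * indicator A x) \<partial>\<mu> \<psi>)"
    by (intro Bochner_Integration.integral_cong refl)
      (simp add: complex_norm_square mult_ac del: of_real_power)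
  finally have meas: "measure (\<mu> (T \<psi>)) A = (\<integral>x. (cmod (f x))\<^sup>2 * indicator A x \<partial>\<mu> \<psi>)"
    unfolding integral_complex_of_real of_real_eq_iff .
  have int: "integrable (\<mu> \<psi>) (\<lambda>x. (cmod (f x))\<^sup>2 * indicator A x)"
    using A by (intro integrable_mu[where B = "B\<^sup>2"]) (auto simp: indicator_def power_mono B intro: order_trans[OF _ power_mono[OF B]])
  have "emeasure (density (\<mu> \<psi>) (\<lambda>x. ennreal ((cmod (f x))\<^sup>2))) A
      = (\<integral>\<^sup>+x. ennreal ((cmod (f x))\<^sup>2 * indicator A x) \<partial>\<mu> \<psi>)"
    using A by (subst emeasure_density) (auto intro!: nn_integral_cong simp: indicator_def)
  also have "\<dots> = ennreal (measure (\<mu> (T \<psi>)) A)"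
    unfolding meas by (rule nn_integral_eq_integral[OF int]) simp
  finally show "emeasure (\<mu> (T \<psi>)) A = emeasure (density (\<mu> \<psi>) (\<lambda>x. ennreal ((cmod (f x))\<^sup>2))) A"
    using finite_measure.emeasure_eq_measure[OF finite_measure_mu] by simp
qed simp

lemma integrable_mu_represents:
  fixes g :: "real \<Rightarrow> 'b::{banach,second_countable_topology}"
  assumes rep: "represents f T S" and g: "g \<in> borel_measurable borel"
  shows "integrable (\<mu> (T \<psi>)) g \<longleftrightarrow> integrable (\<mu> \<psi>) (\<lambda>x. (cmod (f x))\<^sup>2 *\<^sub>R g x)"
    and "(\<integral>x. g x \<partial>\<mu> (T \<psi>)) = (\<integral>x. (cmod (f x))\<^sup>2 *\<^sub>R g x \<partial>\<mu> \<psi>)"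
  unfolding mu_represents[OF rep] using g represents_basic(1)[OF rep]
  by (simp_all add: integrable_density integral_density)

text \<open>The quadratic form of \<open>X\<close> at \<open>R \<phi>\<close> is an integral against the measure of \<open>\<phi>\<close>, because \<open>R\<close> is in the
  calculus. A vector \<open>\<psi>\<close> at which the identity is square
  integrable is in the domain since \<open>\<psi> = R \<eta>\<close>, where \<open>\<eta>\<close> is the limit of the vectors
  \<open>\<eta>\<^sub>n\<close> obtained by applying the truncation of \<open>x + i\<close> to \<open>[-n, n]\<close>.\<close>

lemma has_spectral_integral_of_resolvent:
  assumes lin: "linear_operator X"
    and R: "\<And>w. (R w, w - \<i> *\<^sub>C R w) \<in> X" and ran: "\<And>x u. (x, u) \<in> X \<Longrightarrow> x = R (u + \<i> *\<^sub>C x)"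
    and rep: "represents (\<lambda>x. 1 / (complex_of_real x + \<i>)) R S"
  shows "has_spectral_integral spectral_projection complex_of_real X"
  unfolding has_spectral_integral_def vector_measure_spectral_projection
proof (intro conjI lin)
  let ?r = "\<lambda>x. 1 / (complex_of_real x + \<i>)"
  have r2: "(cmod (?r x))\<^sup>2 = 1 / (x\<^sup>2 + 1)" for x
    by (simp add: norm_divide power_divide cmod_shift_i)
  have pos: "0 < x\<^sup>2 + (1::real)" for x by (simp add: add_nonneg_pos)
  show "Domain X = {\<psi>. integrable (\<mu> \<psi>) (\<lambda>x. (cmod (complex_of_real x))\<^sup>2)}"
  proof (intro equalityI subsetI)
    fix \<psi> assume "\<psi> \<in> Domain X"
    then obtain \<phi> where \<phi>: "\<psi> = R \<phi>" using ran by blast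
    have "integrable (\<mu> \<phi>) (\<lambda>x. (cmod (?r x))\<^sup>2 *\<^sub>R x\<^sup>2)"
      unfolding r2
    proof (rule integrable_mu[where B = 1])
      show "norm ((1 / (x\<^sup>2 + 1)) *\<^sub>R x\<^sup>2) \<le> 1" for x :: real
        using pos[of x] by (simp add: abs_of_pos)
    qed measurable
    then show "\<psi> \<in> {\<psi>. integrable (\<mu> \<psi>) (\<lambda>x. (cmod (complex_of_real x))\<^sup>2)}"
      using integrable_mu_represents(1)[OF rep, of "\<lambda>x. x\<^sup>2" \<phi>] \<phi> by simp
  next
    fix \<psi> assume "\<psi> \<in> {\<psi>. integrable (\<mu> \<psi>) (\<lambda>x. (cmod (complex_of_real x))\<^sup>2)}"
    then have sq: "integrable (\<mu> \<psi>) (\<lambda>x. x\<^sup>2)" by simp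
    define J where "J n = {- real n..real n}" for n
    define f where "f n x = complex_of_real (indicator (J n) x) * (complex_of_real x + \<i>)" for n x
    have Jb [measurable]: "J n \<in> sets borel" for n by (simp add: J_def)
    have fb: "bounded_borel (f n)" for n
    proof (rule bounded_borelI[where B = "real n + 1"])
      show "f n \<in> borel_measurable borel" unfolding f_def by measurable
      show "cmod (f n x) \<le> real n + 1" for x
        using norm_triangle_ineq[of "complex_of_real x" \<i>] by (auto simp: f_def J_def indicator_def norm_mult)
    qed
    have ev: "\<forall>\<^sub>F n in sequentially. x \<in> J n" for x
      using eventually_ge_at_top[of "nat \<lceil>\<bar>x\<bar>\<rceil>"] by eventually_elim (auto simp: J_def)
    have "Cauchy (\<lambda>n. calc (f n) \<psi>)"
    proof (rule represents_Cauchy[OF represents_calc[OF fb]])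
      have "integrable (\<mu> \<psi>) (\<lambda>x. x\<^sup>2 + 1)"
        by (intro Bochner_Integration.integrable_add sq integrable_mu[where B = 1]) auto
      then show "integrable (\<mu> \<psi>) (\<lambda>x. (cmod (complex_of_real x + \<i>))\<^sup>2)" by (simp add: cmod_shift_i)
      show "cmod (f n x) \<le> cmod (complex_of_real x + \<i>)" for n x by (auto simp: f_def indicator_def norm_mult)
      show "(\<lambda>n. f n x) \<longlonglongrightarrow> complex_of_real x + \<i>" for x
        by (rule tendsto_eventually) (use ev[of x] in \<open>eventually_elim, simp add: f_def\<close>)
    qed
    then obtain \<eta> where \<eta>: "(\<lambda>n. calc (f n) \<psi>) \<longlonglongrightarrow> \<eta>" using Cauchy_convergent convergent_def by blast
    have "R (calc (f n) \<psi>) = spectral_projection (J n) \<psi>" for n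
    proof -
      have "(\<lambda>x. ?r x * f n x) = (\<lambda>x. complex_of_real (indicator (J n) x))"
        using shift_i_nonzero by (simp add: f_def fun_eq_iff)
      with represents_mult[OF rep represents_calc[OF fb[of n]]]
      have "represents (\<lambda>x. complex_of_real (indicator (J n) x)) (\<lambda>v. R (calc (f n) v))
          (\<lambda>v. calc (\<lambda>x. cnj (f n x)) (S v))" by simp
      from represents_unique[OF this represents_spectral_projection[OF Jb]] show ?thesis by metis
    qed
    then have "(\<lambda>n. spectral_projection (J n) \<psi>) \<longlonglongrightarrow> R \<eta>"
      using represents_tendsto[OF rep \<eta>] by simp
    moreover have "(\<lambda>n. spectral_projection (J n) \<psi>) \<longlonglongrightarrow> \<psi>"
    proof -
      have to1: "(\<lambda>n. complex_of_real (indicator (J n) x)) \<longlonglongrightarrow> 1" for x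
        by (rule tendsto_eventually) (use ev[of x] in \<open>eventually_elim, simp\<close>)
      have "\<exists>T' S'. represents (\<lambda>_. 1) T' S' \<and> (\<forall>v. (\<lambda>n. spectral_projection (J n) v) \<longlonglongrightarrow> T' v)"
        by (rule represents_limit[OF represents_spectral_projection[OF Jb] _ to1, where B = 1])
          (simp split: split_indicator)
      then obtain T' S' where T': "represents (\<lambda>_. 1) T' S'" "\<And>v. (\<lambda>n. spectral_projection (J n) v) \<longlonglongrightarrow> T' v"
        by blast
      have "T' = (\<lambda>v. v)" using represents_unique[OF T'(1) represents_const] by simp
      then show ?thesis using T'(2) by simp
    qed
    ultimately have "\<psi> = R \<eta>" using LIMSEQ_unique by blast
    then show "\<psi> \<in> Domain X" using R[of \<eta>] by auto
  qed
  show "\<forall>(\<psi>, \<eta>)\<in>X. cinner \<psi> \<eta> = (\<integral>x. complex_of_real x \<partial>\<mu> \<psi>)"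
  proof clarify
    fix \<psi> \<eta> assume "(\<psi>, \<eta>) \<in> X"
    then obtain \<phi> where \<phi>: "\<psi> = R \<phi>" "\<eta> = \<phi> - \<i> *\<^sub>C R \<phi>"
      using ran[of \<psi> \<eta>] by (metis add_diff_cancel_right')
    note repc = represents_cnj[OF rep]
    have "cinner \<psi> \<eta> = cinner \<phi> (S (\<phi> - \<i> *\<^sub>C R \<phi>))"
      unfolding \<phi> using adjoint_pairD[OF represents_basic(3)[OF repc]] by simp
    also have "\<dots> = cinner \<phi> (S \<phi> - \<i> *\<^sub>C S (R \<phi>))"
      using adjoint_pair_diff[OF represents_basic(3)[OF repc]] adjoint_pair_scaleC[OF represents_basic(3)[OF repc]] by simp
    also have "\<dots> = (\<integral>x. cnj (?r x) - \<i> * (cnj (?r x) * ?r x) \<partial>\<mu> \<phi>)"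
      by (rule represents_basic(5)[OF represents_diff[OF repc represents.scale[OF represents_mult[OF repc rep]]]])
    also have "\<dots> = (\<integral>x. (cmod (?r x))\<^sup>2 *\<^sub>R complex_of_real x \<partial>\<mu> \<phi>)"
    proof (intro Bochner_Integration.integral_cong refl)
      fix x
      have p: "(complex_of_real x + \<i>) * (complex_of_real x - \<i>) = complex_of_real (x\<^sup>2 + 1)"
        by (simp add: algebra_simps power2_eq_square)
      have c: "cnj (?r x) = 1 / (complex_of_real x - \<i>)" by simp
      have "cnj (?r x) - \<i> * (cnj (?r x) * ?r x)
          = complex_of_real x / ((complex_of_real x + \<i>) * (complex_of_real x - \<i>))"
        unfolding c using shift_i_nonzero[of x] by (simp add: divide_simps) 
      then show "cnj (?r x) - \<i> * (cnj (?r x) * ?r x) = (cmod (?r x))\<^sup>2 *\<^sub>R complex_of_real x"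
        unfolding p r2 by (simp add: scaleR_conv_of_real)
    qed
    also have "\<dots> = (\<integral>x. complex_of_real x \<partial>\<mu> \<psi>)"
      unfolding \<phi>(1) by (rule integrable_mu_represents(2)[OF rep, symmetric]) simp
    finally show "cinner \<psi> \<eta> = (\<integral>x. complex_of_real x \<partial>\<mu> \<psi>)" .
  qed
qed

text \<open>Conversely, the spectral integral of the identity has the operator \<open>T\<close> represented by
  \<open>1 / (x - z)\<close> as its resolvent: the quadratic form of \<open>X\<close> gives
  \<open>\<langle>T \<psi>, X T \<psi> - \<psi> - z T \<psi>\<rangle> = 0\<close> for all \<open>\<psi>\<close>; by polarization and density of the range of \<open>T\<close>
  the second vector is zero.\<close>

lemma resolvent_of_spectral_integral:
  assumes lin: "linear_operator X"
    and dom: "Domain X = {\<psi>. integrable (\<mu> \<psi>) (\<lambda>x. (cmod (complex_of_real x))\<^sup>2)}"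
    and form: "\<And>\<psi> \<eta>. (\<psi>, \<eta>) \<in> X \<Longrightarrow> cinner \<psi> \<eta> = (\<integral>x. complex_of_real x \<partial>\<mu> \<psi>)"
    and z: "Im z \<noteq> 0" and rep: "represents (\<lambda>x. 1 / (complex_of_real x - z)) T S"
  shows "(T \<psi>, \<psi> + z *\<^sub>C T \<psi>) \<in> X"
proof -
  let ?r = "\<lambda>x. 1 / (complex_of_real x - z)"
  have nz: "complex_of_real x - z \<noteq> 0" for x using z by (auto simp: complex_eq_iff)
  note adj = represents_basic(3)[OF rep] and repc = represents_cnj[OF rep]
  have ran: "T \<psi> \<in> Domain X" for \<psi>
  proof -
    have "integrable (\<mu> \<psi>) (\<lambda>x. (cmod (?r x))\<^sup>2 *\<^sub>R x\<^sup>2)"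
    proof (rule integrable_mu[where B = "(1 + cmod z / \<bar>Im z\<bar>)\<^sup>2"])
      fix x
      have "complex_of_real x * ?r x = 1 + z * ?r x" using nz[of x] by (simp add: field_simps)
      then have "cmod (complex_of_real x * ?r x) \<le> 1 + cmod z * cmod (?r x)"
        by (simp only:) (metis norm_triangle_ineq norm_mult norm_one)
      also have "\<dots> \<le> 1 + cmod z / \<bar>Im z\<bar>"
        using mult_left_mono[OF cauchy_kernel_bound[OF z, of x], of "cmod z"]
        by (simp add: norm_divide norm_minus_commute)
      finally have "(cmod (complex_of_real x * ?r x))\<^sup>2 \<le> (1 + cmod z / \<bar>Im z\<bar>)\<^sup>2" by (rule power_mono) simp
      then show "norm ((cmod (?r x))\<^sup>2 *\<^sub>R x\<^sup>2) \<le> (1 + cmod z / \<bar>Im z\<bar>)\<^sup>2"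
        by (simp add: norm_mult norm_divide power_mult_distrib power_divide)
    qed measurable
    then show ?thesis unfolding dom using integrable_mu_represents(1)[OF rep, of "\<lambda>x. x\<^sup>2" \<psi>] by simp
  qed
  then have "\<forall>\<psi>. \<exists>\<eta>. (T \<psi>, \<eta>) \<in> X" by (simp add: Domain_iff)
  then obtain XT where XT: "\<And>\<psi>. (T \<psi>, XT \<psi>) \<in> X" by metis
  have XTadd: "XT (x + y) = XT x + XT y" for x y
    using linear_operatorD(4)[OF lin XT[of "x + y"]] linear_operatorD(1)[OF lin XT[of x] XT[of y]]
    by (simp add: adjoint_pair_add[OF adj])
  have XTscale: "XT (c *\<^sub>C x) = c *\<^sub>C XT x" for c x
    using linear_operatorD(4)[OF lin XT[of "c *\<^sub>C x"]] linear_operatorD(2)[OF lin XT[of x], of c]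
    by (simp add: adjoint_pair_scaleC[OF adj])
  define B where "B x = XT x - (x + z *\<^sub>C T x)" for x
  have diag: "cinner (T x) (B x) = 0" for x
  proof -
    have "cinner (T x) (x + z *\<^sub>C T x) = cinner x (S x + z *\<^sub>C S (T x))"
      by (simp add: cinner_simps adjoint_pairD[OF adjoint_pair_sym[OF adj]])
    also have "\<dots> = (\<integral>x. cnj (?r x) + z * (cnj (?r x) * ?r x) \<partial>\<mu> x)"
      by (rule represents_basic(5)[OF represents.add[OF repc represents.scale[OF represents_mult[OF repc rep]]]])
    also have "\<dots> = (\<integral>x. (cmod (?r x))\<^sup>2 *\<^sub>R complex_of_real x \<partial>\<mu> x)"
    proof (intro Bochner_Integration.integral_cong refl)
      fix x
      have "cnj (?r x) + z * (cnj (?r x) * ?r x) = cnj (?r x) * (1 + z * ?r x)" by (simp add: distrib_left)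
      also have "1 + z * ?r x = ?r x * complex_of_real x" using nz[of x] by (simp add: field_simps)
      also have "cnj (?r x) * (?r x * complex_of_real x) = (?r x * cnj (?r x)) * complex_of_real x"
        by (simp only: mult_ac)
      also have "?r x * cnj (?r x) = complex_of_real ((cmod (?r x))\<^sup>2)" by (rule complex_norm_square[symmetric])
      finally show "cnj (?r x) + z * (cnj (?r x) * ?r x) = (cmod (?r x))\<^sup>2 *\<^sub>R complex_of_real x"
        by (simp only: scaleR_conv_of_real)
    qed
    also have "\<dots> = (\<integral>x. complex_of_real x \<partial>\<mu> (T x))"
      by (rule integrable_mu_represents(2)[OF rep, symmetric]) simp
    also have "\<dots> = cinner (T x) (XT x)" by (rule form[OF XT, symmetric])
    finally show ?thesis by (simp add: B_def cinner_diff_right)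
  qed
  have orth: "cinner (T x) (B y) = 0" for x y
    by (rule sesquilinear_zero_diagonal[where T = T and B = B, OF adjoint_pair_add[OF adj] _ adjoint_pair_scaleC[OF adj] _ diag])
      (simp_all add: B_def XTadd XTscale adjoint_pair_add[OF adj] adjoint_pair_scaleC[OF adj] scaleC_simps mult.commute)
  \<comment> \<open>The adjoint of \<open>T\<close> is injective, since its function has no zero.\<close>
  have inj: "v = 0" if "S v = 0" for v
  proof -
    have "(\<integral>x. (cmod (cnj (?r x)))\<^sup>2 \<partial>\<mu> v) = 0" using represents_norm[OF repc, of v] that by simp
    moreover have "integrable (\<mu> v) (\<lambda>x. (cmod (cnj (?r x)))\<^sup>2)"
      using cauchy_kernel_bound[of "cnj z"] z
      by (intro integrable_mu[where B = "(1 / \<bar>Im z\<bar>)\<^sup>2"]) (auto simp: norm_divide norm_minus_commute power_mono)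
    ultimately have "AE x in \<mu> v. (cmod (cnj (?r x)))\<^sup>2 = 0"
      by (subst integral_nonneg_eq_0_iff_AE[symmetric]) auto
    moreover have "(cmod (cnj (?r x)))\<^sup>2 \<noteq> 0" for x
      unfolding complex_mod_cnj using nz[of x] by simp
    ultimately have "AE x in \<mu> v. False" by (simp only:)
    then have "emeasure (\<mu> v) UNIV = 0" using AE_iff_measurable[of UNIV "\<mu> v" "\<lambda>_. False"] by simp
    then have "measure (\<mu> v) UNIV = 0" by (simp add: measure_def)
    then show ?thesis by (simp add: measure_mu_UNIV)
  qed
  have "cinner x (S (B \<psi>)) = 0" for x
    using orth[of x \<psi>] adjoint_pairD[OF adjoint_pair_sym[OF adj]] by simp
  then have "S (B \<psi>) = 0" using cinner_self[of "S (B \<psi>)"] by simp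
  then have "B \<psi> = 0" by (rule inj)
  then show ?thesis using XT[of \<psi>] by (simp add: B_def)
qed

end

subsection \<open>The calculus of a projection-valued measure\<close>

definition pvm_generators :: "(real set \<Rightarrow> 'a::complex_hilbert_space \<Rightarrow> 'a) \<Rightarrow>
    ((real \<Rightarrow> complex) \<times> ('a \<Rightarrow> 'a) \<times> ('a \<Rightarrow> 'a)) set" where
  "pvm_generators E = {(\<lambda>x. complex_of_real (indicator A x), E A, E A) | A. A \<in> sets borel}"

lemma pvm_generatorsI:
  "A \<in> sets borel \<Longrightarrow> (\<lambda>x. complex_of_real (indicator A x), E A, E A) \<in> pvm_generators E"
  unfolding pvm_generators_def by (intro CollectI exI[of _ A] conjI refl)

context
  fixes E :: "real set \<Rightarrow> 'a::complex_hilbert_space \<Rightarrow> 'a"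
  assumes pvm: "projection_valued_measure E"
begin

lemma pvm_adjoint: "A \<in> sets borel \<Longrightarrow> adjoint_pair (E A) (E A)"
  using pvm unfolding projection_valued_measure_def orthogonal_projection_def adjoint_pair_def by blast

lemma pvm_idem: "A \<in> sets borel \<Longrightarrow> E A (E A v) = E A v"
  using pvm unfolding projection_valued_measure_def orthogonal_projection_def by (metis comp_apply)

lemma pvm_sums:
  "range A \<subseteq> sets borel \<Longrightarrow> disjoint_family A \<Longrightarrow> (\<lambda>n. E (A n) \<psi>) sums E (\<Union>n::nat. A n) \<psi>"
  using pvm unfolding projection_valued_measure_def by blast

lemma pvm_norm: "A \<in> sets borel \<Longrightarrow> cinner v (E A v) = of_real ((norm (E A v))\<^sup>2)"
  unfolding cinner_self[symmetric]
  by (metis adjoint_pairD pvm_adjoint pvm_idem)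

lemma pvm_contraction:
  assumes "A \<in> sets borel"
  shows "norm (E A v) \<le> norm v"
proof (cases "E A v = 0")
  case False
  have "(norm (E A v))\<^sup>2 = cmod (cinner v (E A v))" by (simp add: pvm_norm[OF assms] norm_power)
  also have "\<dots> \<le> norm v * norm (E A v)" by (rule cinner_Cauchy_Schwarz)
  finally show ?thesis using False by (simp add: power2_eq_square)
qed simp

lemma pvm_empty: "E {} v = 0"
proof -
  have "(\<lambda>n::nat. E {} v) sums E (\<Union>n::nat. {}) v"
    using pvm_sums[of "\<lambda>_. {}"] by (simp add: disjoint_family_on_def)
  then have "(\<lambda>n::nat. E {} v) \<longlonglongrightarrow> 0" using sums_summable summable_LIMSEQ_zero by blast
  then show ?thesis by (simp add: LIMSEQ_const_iff)
qed

lemma pvm_Un: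
  assumes "A \<in> sets borel" "B \<in> sets borel" "A \<inter> B = {}"
  shows "E (A \<union> B) v = E A v + E B v"
proof -
  have "(\<lambda>n. E (binaryset A B n) v) sums E (\<Union>n. binaryset A B n) v"
    using assms by (intro pvm_sums) (auto simp: binaryset_def disjoint_family_on_def)
  moreover have "(\<lambda>n. E (binaryset A B n) v) sums (\<Sum>n\<in>{0,1}. E (binaryset A B n) v)"
    by (rule sums_finite) (auto simp: binaryset_def pvm_empty)
  ultimately have "E (\<Union>n. binaryset A B n) v = (\<Sum>n\<in>{0,1}. E (binaryset A B n) v)"
    by (rule sums_unique2)
  then show ?thesis by (simp add: UN_binaryset_eq) (simp add: binaryset_def)
qed

text \<open>Additivity alone makes the projections of disjoint sets orthogonal, because the sum of two projections
  is a projection only if their ranges are orthogonal.\<close>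

lemma pvm_disjoint:
  assumes A: "A \<in> sets borel" and B: "B \<in> sets borel" and "A \<inter> B = {}"
  shows "E A (E B v) = 0"
proof -
  define x where "x = E B v"
  have AB: "A \<union> B \<in> sets borel" using A B by simp
  \<comment> \<open>The projection of \<open>x\<close> to the larger set is not longer than \<open>x\<close>, which leaves no room for a
     component in \<open>E A\<close>.\<close>
  have "complex_of_real ((norm (E (A \<union> B) x))\<^sup>2) = cinner x (E A x + E B x)"
    using pvm_norm[OF AB, of x] pvm_Un[OF assms, of x] by simp
  also have "\<dots> = complex_of_real ((norm (E A x))\<^sup>2 + (norm x)\<^sup>2)"
    using pvm_norm[OF A, of x] pvm_norm[OF B, of x] pvm_idem[OF B, of v] by (simp add: cinner_add_right x_def)
  finally have "(norm (E A x))\<^sup>2 + (norm x)\<^sup>2 = (norm (E (A \<union> B) x))\<^sup>2" using of_real_eq_iff by metis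
  moreover have "(norm (E (A \<union> B) x))\<^sup>2 \<le> (norm x)\<^sup>2" using pvm_contraction[OF AB] by (simp add: power_mono)
  ultimately have "(norm (E A x))\<^sup>2 \<le> 0" by linarith
  then show ?thesis by (simp add: x_def)
qed

lemma pvm_Int:
  assumes A: "A \<in> sets borel" and B: "B \<in> sets borel"
  shows "E A (E B v) = E (A \<inter> B) v"
proof -
  have s: "A \<inter> B \<in> sets borel" "A - B \<in> sets borel" "B - A \<in> sets borel" using assms by auto
  have d: "(A \<inter> B) \<inter> (A - B) = {}" "(A \<inter> B) \<inter> (B - A) = {}" by auto
  have eA: "E A w = E (A \<inter> B) w + E (A - B) w" for w
    using pvm_Un[OF s(1,2) d(1), of w] by (simp add: Int_Diff_Un)
  have eB: "E B w = E (A \<inter> B) w + E (B - A) w" for w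
    using pvm_Un[OF s(1,3) d(2), of w] by (simp add: Int_commute[of A B] Int_Diff_Un)
  have "E A (E B v) = E (A \<inter> B) (E B v)" using pvm_disjoint[OF s(2) B, of v] eA by auto
  also have "\<dots> = E (A \<inter> B) (E (A \<inter> B) v) + E (A \<inter> B) (E (B - A) v)"
    by (simp add: eB adjoint_pair_add[OF pvm_adjoint[OF s(1)]])
  also have "E (A \<inter> B) (E (B - A) v) = 0" by (rule pvm_disjoint[OF s(1,3)]) auto
  finally show ?thesis by (simp add: pvm_idem[OF s(1)])
qed

lemma sets_vector_measure [simp]: "sets (vector_measure E \<psi>) = sets borel"
  unfolding vector_measure_def using sets.sigma_sets_eq[of "borel :: real measure"] by simp

lemma emeasure_vector_measure:
  assumes "A \<in> sets borel"
  shows "emeasure (vector_measure E \<psi>) A = ennreal (Re (cinner \<psi> (E A \<psi>)))"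
proof (rule emeasure_measure_of[OF vector_measure_def])
  show "countably_additive (sets (vector_measure E \<psi>)) (\<lambda>B. ennreal (Re (cinner \<psi> (E B \<psi>))))"
  proof (rule countably_additiveI)
    fix A :: "nat \<Rightarrow> real set"
    assume A: "range A \<subseteq> sets (vector_measure E \<psi>)" "disjoint_family A"
    have "(\<lambda>n. Re (cinner \<psi> (E (A n) \<psi>))) sums Re (cinner \<psi> (E (\<Union>n. A n) \<psi>))"
      using bounded_linear.sums[OF bounded_linear_compose[OF bounded_linear_Re
          bounded_bilinear.bounded_linear_right[OF bounded_bilinear_cinner]] pvm_sums[OF _ A(2)]] A(1)
      by simp
    moreover have "0 \<le> Re (cinner \<psi> (E (A n) \<psi>))" for n
      using A(1) pvm_norm[of "A n" \<psi>] by (simp add: image_subset_iff)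
    ultimately show "(\<Sum>i. ennreal (Re (cinner \<psi> (E (A i) \<psi>)))) = ennreal (Re (cinner \<psi> (E (\<Union>i. A i) \<psi>)))"
      by (intro suminf_ennreal_eq) auto
  qed
qed (use assms in \<open>auto simp: positive_def pvm_empty\<close>)

theorem pvm_calculus: "borel_spectral_calculus (pvm_generators E) (vector_measure E)"
proof -
  interpret spectral_calculus "pvm_generators E" "vector_measure E"
  proof (rule spectral_calculus.intro)
    fix \<psi> :: 'a
    show fin: "finite_borel_measure (vector_measure E \<psi>)"
    proof (intro finite_borel_measure.intro finite_measureI finite_borel_measure_axioms.intro)
      have "space (vector_measure E \<psi>) = UNIV"
        using sets_eq_imp_space_eq[OF sets_vector_measure] by simp
      then show "emeasure (vector_measure E \<psi>) (space (vector_measure E \<psi>)) \<noteq> \<infinity>"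
        by (simp add: emeasure_vector_measure)
    qed simp
    have "(\<lambda>x. complex_of_real (indicator UNIV x), E UNIV, E UNIV) \<in> pvm_generators E"
      by (rule pvm_generatorsI) simp
    moreover have "E UNIV = (\<lambda>v. v)" using pvm unfolding projection_valued_measure_def id_def by blast
    ultimately show "(\<lambda>_. 1, \<lambda>v. v, \<lambda>v. v) \<in> pvm_generators E" by simp
    fix f T S assume "(f, T, S) \<in> pvm_generators E"
    then obtain A where A: "A \<in> sets borel" and f: "f = (\<lambda>x. complex_of_real (indicator A x))" "T = E A" "S = E A"
      unfolding pvm_generators_def by blast
    show "f \<in> borel_measurable borel" "\<exists>B. \<forall>x. cmod (f x) \<le> B"
      using bounded_borel_indicator[OF A] unfolding f bounded_borel_def by auto
    show "adjoint_pair T S" unfolding f by (rule pvm_adjoint[OF A])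
    have "measure (vector_measure E \<psi>) A = (norm (E A \<psi>))\<^sup>2"
      by (simp add: measure_def emeasure_vector_measure[OF A] pvm_norm[OF A])
    then show "cinner \<psi> (T \<psi>) = (\<integral>x. f x \<partial>vector_measure E \<psi>)"
      unfolding f using A by (simp add: pvm_norm[OF A] del: of_real_power)
    show "(\<lambda>x. cnj (f x), S, T) \<in> pvm_generators E"
      unfolding f complex_cnj_complex_of_real by (rule pvm_generatorsI[OF A])
    fix g T' S' assume "(g, T', S') \<in> pvm_generators E"
    then obtain B where B: "B \<in> sets borel" and g: "g = (\<lambda>x. complex_of_real (indicator B x))" "T' = E B" "S' = E B"
      unfolding pvm_generators_def by blast
    have fg: "(\<lambda>x. f x * g x) = (\<lambda>x. complex_of_real (indicator (A \<inter> B) x))"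
      by (simp add: f g fun_eq_iff indicator_inter_arith)
    have "(\<lambda>v. T (T' v)) = E (A \<inter> B)" "(\<lambda>v. S' (S v)) = E (A \<inter> B)"
      using pvm_Int[OF A B] pvm_Int[OF B A] by (simp_all add: f g Int_commute fun_eq_iff)
    then show "(\<lambda>x. f x * g x, \<lambda>v. T (T' v), \<lambda>v. S' (S v)) \<in> pvm_generators E"
      unfolding fg using pvm_generatorsI[of "A \<inter> B" E] A B by simp
  qed
  show ?thesis
  proof
    fix A :: "real set" assume "A \<in> sets borel"
    then have "(\<lambda>x. complex_of_real (indicator A x), E A, E A) \<in> pvm_generators E"
      by (rule pvm_generatorsI)
    then show "representable (\<lambda>x. complex_of_real (indicator A x))"
      unfolding representable_def using represents.gen by blast
  qed
qed

end

section \<open>The spectral theorem\<close>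

lemma resolvent_unique:
  assumes lin: "linear_operator X" and sym: "symmetric_operator X" and z: "Im z \<noteq> 0"
    and "(x, w + z *\<^sub>C x) \<in> X" "(y, w + z *\<^sub>C y) \<in> X"
  shows "x = y"
proof -
  have "(x - y, z *\<^sub>C (x - y)) \<in> X"
    using linear_operator_diff[OF lin assms(4,5)] by (simp add: scaleC_diff_right)
  from symmetric_operatorD[OF sym this this]
  have "(z - cnj z) * cinner (x - y) (x - y) = 0" by (simp add: cinner_scaleC_left cinner_scaleC_right algebra_simps)
  moreover have "z - cnj z \<noteq> 0" using z by (auto simp: complex_eq_iff)
  ultimately show ?thesis by (simp add: cinner_self)
qed

text \<open>The Cayley transform \<open>U = (X - i) (X + i)\<^sup>-\<^sup>1\<close> is unitary without fixed vectors. The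
  powers of \<open>U\<close> and of its inverse generate a calculus for the integer powers of
  \<open>c x = (x - i) / (x + i)\<close>. It contains \<open>1 / (x + i)\<close> and its conjugate, hence
  \<open>(x - a) / (x\<^sup>2 + 1)\<close>; the sign of this function gives the half-lines, and these generate the Borel sets.\<close>

theorem spectral_theorem:
  fixes X :: "'a::complex_hilbert_space operator"
  assumes sa: "selfadjoint X"
  shows "\<exists>E. projection_valued_measure E \<and> has_spectral_integral E complex_of_real X"
proof -
  have lin: "linear_operator X" using sa by (simp add: selfadjoint_def)
  have sym: "symmetric_operator X" by (rule selfadjoint_symmetric[OF sa])
  have "\<forall>w. \<exists>x. (x, w - \<i> *\<^sub>C x) \<in> X" using selfadjoint_range[OF sa, of 1] by simp
  then obtain R where R: "\<And>w. (R w, w - \<i> *\<^sub>C R w) \<in> X" by metis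
  have "\<forall>w. \<exists>x. (x, w + \<i> *\<^sub>C x) \<in> X" using selfadjoint_range[OF sa, of "-1"] by (simp add: scaleC_minus_left)
  then obtain R' where R': "\<And>w. (R' w, w + \<i> *\<^sub>C R' w) \<in> X" by metis
  have Runiq: "x = R w" if "(x, w - \<i> *\<^sub>C x) \<in> X" for x w
    by (rule resolvent_unique[OF lin sym, of "- \<i>" _ w]) (use that R[of w] in \<open>simp_all add: scaleC_minus_left\<close>)
  have R'uniq: "x = R' w" if "(x, w + \<i> *\<^sub>C x) \<in> X" for x w
    by (rule resolvent_unique[OF lin sym _ that R']) simp
  have adjR: "cinner x (R y) = cinner (R' x) y" for x y
  proof -
    have "cinner (R' x) (y - \<i> *\<^sub>C R y) = cinner (x + \<i> *\<^sub>C R' x) (R y)"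
      by (rule symmetric_operatorD[OF sym R' R])
    then show ?thesis by (simp add: cinner_simps)
  qed
  define U where "U v = v - (2 * \<i>) *\<^sub>C R v" for v
  define V where "V v = v + (2 * \<i>) *\<^sub>C R' v" for v
  have adj: "adjoint_pair U V"
    unfolding adjoint_pair_def U_def V_def by (simp add: cinner_simps adjR)
  have two: "(2 * \<i>) *\<^sub>C x = \<i> *\<^sub>C x + \<i> *\<^sub>C x" for x :: 'a
    by (simp flip: scaleC_add_left)
  have "R' (U v) = R v" for v
    by (rule R'uniq[symmetric]) (use R[of v] in \<open>simp add: U_def two\<close>)
  then have VU: "V (U v) = v" for v unfolding V_def by (simp add: U_def)
  have "R (V v) = R' v" for v
    by (rule Runiq[symmetric]) (use R'[of v] in \<open>simp add: V_def two\<close>)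
  then have UV: "U (V v) = v" for v unfolding U_def by (simp add: V_def)
  have nofix: "v = 0" if "U v = v" for v
  proof -
    have "R v = 0" using that norm_scaleC[of "2 * \<i>" "R v"] by (simp add: U_def)
    then have "(0, v) \<in> X" using R[of v] by simp
    then show ?thesis using linear_operatorD(3,4)[OF lin] by blast
  qed
  define c where "c x = (complex_of_real x - \<i>) / (complex_of_real x + \<i>)" for x :: real
  note nz = shift_i_nonzero
  have c1: "c x * cnj (c x) = 1" for x using nz[of x] by (simp add: c_def)
  have cn: "cmod (c x) = 1" for x
  proof -
    have "(cmod (c x))\<^sup>2 = 1" using c1[of x] complex_norm_square[of "c x"] of_real_eq_1_iff by metis
    then show ?thesis using norm_ge_zero[of "c x"] unfolding power2_eq_1_iff by linarith
  qed
  have [measurable]: "c \<in> borel_measurable borel" unfolding c_def by measurable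
  have [measurable]: "cnj \<in> borel_measurable borel" by (intro borel_measurable_continuous_onI continuous_intros)
  have "\<forall>\<psi>. \<exists>M. finite_borel_measure M \<and> (\<forall>k. (\<integral>x. c x ^ k \<partial>M) = cinner \<psi> ((U ^^ k) \<psi>))"
    using line_measure_exists[OF adj VU UV nofix] unfolding c_def by blast
  then obtain \<mu> where \<mu>: "\<And>\<psi>. finite_borel_measure (\<mu> \<psi>)"
    and mom: "\<And>\<psi> k. (\<integral>x. c x ^ k \<partial>\<mu> \<psi>) = cinner \<psi> ((U ^^ k) \<psi>)" by metis
  have VUn: "(V ^^ n) ((U ^^ n) v) = v" "(U ^^ n) ((V ^^ n) v) = v" for n v
    by (induction n arbitrary: v) (simp_all add: VU UV funpow_swap1)
  have UVcomm: "(U ^^ m) ((V ^^ n) v) = (V ^^ n) ((U ^^ m) v)" for m n v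
  proof -
    have 1: "U ((V ^^ n) v) = (V ^^ n) (U v)" for n v
    proof (cases n)
      case (Suc k)
      have "U ((V ^^ Suc k) v) = (V ^^ k) v" by (simp add: UV)
      moreover have "(V ^^ Suc k) (U v) = (V ^^ k) v" by (simp add: funpow_swap1 VU)
      ultimately show ?thesis using Suc by simp
    qed simp
    show ?thesis by (induction m arbitrary: v) (simp_all add: 1)
  qed
  have adjn: "adjoint_pair (U ^^ n) (V ^^ n)" for n
  proof (induction n)
    case (Suc n)
    have "cinner x ((U ^^ Suc n) y) = cinner ((V ^^ Suc n) x) y" for x y
    proof -
      have "(V ^^ Suc n) x = (V ^^ n) (V x)" by (simp add: funpow_swap1)
      then show ?thesis by (simp only: funpow.simps comp_apply adjoint_pairD[OF adj] adjoint_pairD[OF Suc])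
    qed
    then show ?case by (simp add: adjoint_pair_def)
  qed (simp add: adjoint_pair_def)
  define G where "G = {(\<lambda>x. c x ^ m * cnj (c x) ^ n, \<lambda>v. (U ^^ m) ((V ^^ n) v), \<lambda>v. (U ^^ n) ((V ^^ m) v)) | m n. True}"
  have GI: "(\<lambda>x. c x ^ m * cnj (c x) ^ n, \<lambda>v. (U ^^ m) ((V ^^ n) v), \<lambda>v. (U ^^ n) ((V ^^ m) v)) \<in> G" for m n
    unfolding G_def by blast
  interpret spectral_calculus G \<mu>
  proof (rule spectral_calculus.intro)
    fix \<psi> :: 'a
    show "finite_borel_measure (\<mu> \<psi>)" by (rule \<mu>)
    show "(\<lambda>_. 1, \<lambda>v. v, \<lambda>v. v) \<in> G" using GI[of 0 0] by simp
    fix f T S assume "(f, T, S) \<in> G"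
    then obtain m n where f: "f = (\<lambda>x. c x ^ m * cnj (c x) ^ n)"
      "T = (\<lambda>v. (U ^^ m) ((V ^^ n) v))" "S = (\<lambda>v. (U ^^ n) ((V ^^ m) v))" unfolding G_def by blast
    show "f \<in> borel_measurable borel" unfolding f by measurable
    show "\<exists>B. \<forall>x. cmod (f x) \<le> B" by (rule exI[of _ 1]) (simp add: f norm_mult norm_power cn)
    show "adjoint_pair T S" unfolding adjoint_pair_def f
      using adjoint_pairD[OF adjn] adjoint_pairD[OF adjoint_pair_sym[OF adjn]] UVcomm by metis
    show "cinner \<psi> (T \<psi>) = (\<integral>x. f x \<partial>\<mu> \<psi>)"
    proof (cases "n \<le> m")
      case True
      then obtain k where k: "m = k + n" using le_Suc_ex by (metis add.commute)
      have "f x = c x ^ k" for x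
        using c1[of x] by (simp add: f k power_add mult.assoc flip: power_mult_distrib)
      moreover have "T \<psi> = (U ^^ k) \<psi>" by (simp add: f k funpow_add VUn)
      ultimately show ?thesis using mom by simp
    next
      case False
      then obtain k where k: "n = k + m" using le_Suc_ex by (metis add.commute nat_le_linear)
      have "f x = cnj (c x ^ k)" for x
        using c1[of x] by (simp add: f k power_add mult_ac flip: power_mult_distrib)
      moreover have "T \<psi> = (V ^^ k) \<psi>" by (simp add: f k funpow_add UVcomm[of m k] VUn)
      moreover have "cinner \<psi> ((V ^^ k) \<psi>) = cnj (cinner \<psi> ((U ^^ k) \<psi>))"
        using adjoint_pairD[OF adjn] cinner_commute by metis
      moreover have "(\<integral>x. cnj (c x ^ k) \<partial>\<mu> \<psi>) = cnj (\<integral>x. c x ^ k \<partial>\<mu> \<psi>)" by (rule Bochner_Integration.integral_cnj)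
      ultimately show ?thesis by (simp only: mom)
    qed
    show "(\<lambda>x. cnj (f x), S, T) \<in> G" using GI[of n m] by (simp add: f mult.commute)
    fix g T' S' assume "(g, T', S') \<in> G"
    then obtain k l where g: "g = (\<lambda>x. c x ^ k * cnj (c x) ^ l)"
      "T' = (\<lambda>v. (U ^^ k) ((V ^^ l) v))" "S' = (\<lambda>v. (U ^^ l) ((V ^^ k) v))" unfolding G_def by blast
    have "T (T' v) = (U ^^ (m + k)) ((V ^^ (n + l)) v)" for v
      by (simp add: f g funpow_add UVcomm[of k n])
    moreover have "S' (S v) = (U ^^ (n + l)) ((V ^^ (m + k)) v)" for v
      unfolding add.commute[of n] add.commute[of m] by (simp add: f g funpow_add UVcomm[of n k])
    moreover have "f x * g x = c x ^ (m + k) * cnj (c x) ^ (n + l)" for x by (simp add: f g power_add mult_ac)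
    ultimately show "(\<lambda>x. f x * g x, \<lambda>v. T (T' v), \<lambda>v. S' (S v)) \<in> G" using GI[of "m + k" "n + l"] by simp
  qed
  let ?r = "\<lambda>x. 1 / (complex_of_real x + \<i>)"
  have "represents c U V" using represents.gen[OF GI[of 1 0]] by simp
  from represents.scale[OF represents_diff[OF represents.gen[OF gen_one] this], of "1 / (2 * \<i>)"]
  have "represents (\<lambda>x. 1 / (2 * \<i>) * (1 - c x)) (\<lambda>v. (1 / (2 * \<i>)) *\<^sub>C (v - U v)) (\<lambda>v. cnj (1 / (2 * \<i>)) *\<^sub>C (v - V v))" .
  moreover have "1 / (2 * \<i>) * (1 - c x) = ?r x" for x using nz[of x] by (simp add: c_def field_simps)
  moreover have "(1 / (2 * \<i>)) *\<^sub>C (v - U v) = R v" for v by (simp add: U_def scaleC_scaleC)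
  ultimately have rep: "represents ?r R (\<lambda>v. cnj (1 / (2 * \<i>)) *\<^sub>C (v - V v))" by simp
  then have repr: "representable ?r" unfolding representable_def by blast
  have half: "representable (\<lambda>x. complex_of_real (indicator {a<..} x))" for a
  proof -
    define h where "h x = (x - a) / (x\<^sup>2 + 1) / (1 + \<bar>a\<bar>)" for x :: real
    have pos: "0 < x\<^sup>2 + (1::real)" for x by (simp add: add_nonneg_pos)
    have "representable (\<lambda>x. ((?r x + cnj (?r x)) * (1/2) - of_real a * (?r x * cnj (?r x))) * (1 / of_real (1 + \<bar>a\<bar>)))"
      by (intro representable_mult representable_diff representable_add representable_const representable_cnj repr)
    moreover have "((?r x + cnj (?r x)) * (1/2) - of_real a * (?r x * cnj (?r x))) * (1 / of_real (1 + \<bar>a\<bar>)) = of_real (h x)" for x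
    proof -
      have p: "(complex_of_real x + \<i>) * (complex_of_real x - \<i>) = complex_of_real (x\<^sup>2 + 1)"
        by (simp add: algebra_simps power2_eq_square)
      have c: "cnj (?r x) = 1 / (complex_of_real x - \<i>)" by simp
      have e1: "(?r x + cnj (?r x)) * (1/2) = of_real x / ((complex_of_real x + \<i>) * (complex_of_real x - \<i>))"
        unfolding c using nz[of x] by (simp add: divide_simps)
      have e2: "?r x * cnj (?r x) = 1 / ((complex_of_real x + \<i>) * (complex_of_real x - \<i>))"
        unfolding c by simp
      have "((?r x + cnj (?r x)) * (1/2) - of_real a * (?r x * cnj (?r x))) * (1 / of_real (1 + \<bar>a\<bar>))
        = (of_real x / of_real (x\<^sup>2 + 1) - of_real a * (1 / of_real (x\<^sup>2 + 1))) * (1 / complex_of_real (1 + \<bar>a\<bar>))"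
        by (simp only: e1 e2 p)
      also have "\<dots> = of_real (h x)" by (simp add: h_def diff_divide_distrib)
      finally show ?thesis .
    qed
    ultimately have "representable (\<lambda>x. complex_of_real (h x))" by simp
    moreover have "\<bar>h x\<bar> \<le> 1" for x
    proof -
      have "\<bar>x\<bar> \<le> x\<^sup>2 + 1" using sum_squares_bound[of 1 "\<bar>x\<bar>"] by simp
      moreover have "0 \<le> \<bar>a\<bar> * x\<^sup>2" by simp
      moreover have "(x\<^sup>2 + 1) * (1 + \<bar>a\<bar>) = x\<^sup>2 + 1 + \<bar>a\<bar> + \<bar>a\<bar> * x\<^sup>2" by (simp add: algebra_simps)
      ultimately have "\<bar>x - a\<bar> \<le> (x\<^sup>2 + 1) * (1 + \<bar>a\<bar>)"
        using abs_triangle_ineq4[of x a] by linarith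
      then show ?thesis unfolding h_def using pos[of x] by (simp add: abs_mult divide_divide_eq_left)
    qed
    ultimately have "representable (\<lambda>x. complex_of_real (indicator {x. h x > 0} x))"
      by (rule representable_indicator_pos)
    moreover have "h x > 0 \<longleftrightarrow> x > a" for x
    proof -
      have d: "0 < (x\<^sup>2 + 1) * (1 + \<bar>a\<bar>)" using pos by (intro mult_pos_pos) auto
      show ?thesis unfolding h_def divide_divide_eq_left pos_less_divide_eq[OF d] by simp
    qed
    then have "{x. h x > 0} = {a<..}" by auto
    ultimately show ?thesis by simp
  qed
  interpret borel_spectral_calculus G \<mu>
    by standard (rule representable_indicator_borel[OF half])
  have ran: "x = R (u + \<i> *\<^sub>C x)" if "(x, u) \<in> X" for x u
    by (rule Runiq) (use that in simp)
  have "has_spectral_integral spectral_projection complex_of_real X"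
    by (rule has_spectral_integral_of_resolvent[OF lin R ran rep])
  then show ?thesis using projection_valued_measure_spectral_projection by blast
qed

section \<open>The functional calculus of a self-adjoint operator\<close>

lemma bounded_borel_resolvent:
  assumes "Im z \<noteq> 0"
  shows "bounded_borel (\<lambda>x. 1 / (complex_of_real x - z))"
  by (rule bounded_borelI[where B = "1 / \<bar>Im z\<bar>"])
    (use cauchy_kernel_bound[OF assms] in \<open>auto simp: norm_divide norm_minus_commute\<close>)

locale selfadjoint_spectral =
  fixes X :: "'a::complex_hilbert_space operator" and E :: "real set \<Rightarrow> 'a \<Rightarrow> 'a"
  assumes sa: "selfadjoint X" and pvm: "projection_valued_measure E"
    and spectral: "has_spectral_integral E complex_of_real X"
begin

sublocale borel_spectral_calculus "pvm_generators E" "vector_measure E"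
  by (rule pvm_calculus[OF pvm])

lemma linear_X: "linear_operator X"
  using sa by (simp add: selfadjoint_def)

lemma symmetric_X: "symmetric_operator X"
  by (rule selfadjoint_symmetric[OF sa])

lemma resolvent_in:
  assumes z: "Im z \<noteq> 0"
  defines "T \<equiv> calc (\<lambda>x. 1 / (complex_of_real x - z))"
  shows "(T \<psi>, \<psi> + z *\<^sub>C T \<psi>) \<in> X"
  unfolding T_def
  by (rule resolvent_of_spectral_integral[OF linear_X _ _ z represents_calc[OF bounded_borel_resolvent[OF z]]])
    (use spectral in \<open>auto simp: has_spectral_integral_def\<close>)

lemma cauchy_transform_resolvent:
  assumes z: "Im z \<noteq> 0" and x: "(x, \<psi> + z *\<^sub>C x) \<in> X"
  shows "cauchy_transform (vector_measure E \<psi>) z = - cinner \<psi> x"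
proof -
  have "x = calc (\<lambda>t. 1 / (complex_of_real t - z)) \<psi>"
    by (rule resolvent_unique[OF linear_X symmetric_X z x resolvent_in[OF z]])
  then have "cinner \<psi> x = (\<integral>t. 1 / (complex_of_real t - z) \<partial>vector_measure E \<psi>)"
    using represents_basic(5)[OF represents_calc[OF bounded_borel_resolvent[OF z]]] by simp
  also have "\<dots> = (\<integral>t. - (1 / (z - complex_of_real t)) \<partial>vector_measure E \<psi>)"
    by (intro Bochner_Integration.integral_cong refl) (metis minus_diff_eq minus_divide_right)
  finally show ?thesis by (simp add: cauchy_transform_def)
qed

end

text \<open>The Cauchy transform of the spectral measure at \<open>\<psi>\<close> is the matrix coefficient of the resolvent
  at \<open>\<psi>\<close>, whence two projection-valued measures of the same operator have the same spectral
  measures.\<close>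

lemma vector_measure_unique:
  assumes "selfadjoint_spectral X E" "selfadjoint_spectral X E'"
  shows "vector_measure E \<psi> = vector_measure E' \<psi>"
proof -
  interpret E: selfadjoint_spectral X E by fact
  interpret E': selfadjoint_spectral X E' by fact
  show ?thesis
  proof (rule cauchy_transform_eqI[OF E.fin E'.fin])
    fix z :: complex assume "Im z > 0"
    then have z: "Im z \<noteq> 0" by simp
    show "cauchy_transform (vector_measure E \<psi>) z = cauchy_transform (vector_measure E' \<psi>) z"
      using E.cauchy_transform_resolvent[OF z E.resolvent_in[OF z]]
        E'.cauchy_transform_resolvent[OF z E.resolvent_in[OF z]] by simp
  qed
qed

text \<open>The defining description of \<open>h(X)\<close> has a unique solution: the spectral measures do not depend on the
  choice of the projection-valued measure, they fix the quadratic form of the operator, and polarization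
  does the rest.\<close>

lemma (in selfadjoint_spectral) fun_calc_eq_calc:
  assumes h: "bounded_borel h"
  shows "fun_calc X h = calc h"
  unfolding fun_calc_def
proof (rule the_equality)
  note rep = represents_calc[OF h]
  note adj = represents_basic(3)[OF rep]
  obtain B where B: "\<And>x. cmod (h x) \<le> B" using h bounded_borel_def by blast
  have hm: "h \<in> borel_measurable borel" using h bounded_borel_def by blast
  have "linear_operator {(\<psi>, calc h \<psi>) | \<psi>. True}"
    unfolding linear_operator_def single_valued_def
    by (auto simp: adjoint_pair_add[OF adj] adjoint_pair_scaleC[OF adj] adjoint_pair_zero[OF adj])
  moreover have "integrable (vector_measure E \<psi>) (\<lambda>x. (cmod (h x))\<^sup>2)" for \<psi>
    using hm by (intro integrable_mu[where B = "B\<^sup>2"]) (auto simp: power_mono B)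
  ultimately have "has_spectral_integral E h {(\<psi>, calc h \<psi>) | \<psi>. True}"
    using represents_basic(5)[OF rep] unfolding has_spectral_integral_def by auto
  then show "\<exists>E. projection_valued_measure E \<and> has_spectral_integral E complex_of_real X
      \<and> has_spectral_integral E h {(\<psi>, calc h \<psi>) | \<psi>. True}" using pvm spectral by blast
  fix T assume "\<exists>E. projection_valued_measure E \<and> has_spectral_integral E complex_of_real X
      \<and> has_spectral_integral E h {(\<psi>, T \<psi>) | \<psi>. True}"
  then obtain E' where E': "projection_valued_measure E'" "has_spectral_integral E' complex_of_real X"
    "has_spectral_integral E' h {(\<psi>, T \<psi>) | \<psi>. True}" by blast
  have "selfadjoint_spectral X E'" using sa E' by unfold_locales
  from vector_measure_unique[OF selfadjoint_spectral_axioms this]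
  have diag: "cinner \<psi> (T \<psi>) = cinner \<psi> (calc h \<psi>)" for \<psi>
    using E'(3) represents_basic(5)[OF rep] unfolding has_spectral_integral_def by auto
  have linT: "linear_operator {(\<psi>, T \<psi>) | \<psi>. True}" using E'(3) unfolding has_spectral_integral_def by blast
  have Tadd: "T (x + y) = T x + T y" for x y
    using linear_operatorD(1)[OF linT, of x "T x" y "T y"] by auto
  have Tscale: "T (c *\<^sub>C x) = c *\<^sub>C T x" for c x
    using linear_operatorD(2)[OF linT, of x "T x" c] by auto
  have orth: "cinner x (T y - calc h y) = 0" for x y
    by (rule sesquilinear_zero_diagonal[where T = "\<lambda>x. x" and B = "\<lambda>y. T y - calc h y"])
      (simp_all add: Tadd Tscale adjoint_pair_add[OF adj] adjoint_pair_scaleC[OF adj] scaleC_simps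
        cinner_diff_right diag)
  show "T = calc h"
  proof
    fix y show "T y = calc h y" by (rule cinner_ext) (use orth in \<open>simp add: cinner_diff_right\<close>)
  qed
qed

lemma selfadjoint_spectral_exists: "selfadjoint X \<Longrightarrow> \<exists>E. selfadjoint_spectral X E"
  using spectral_theorem unfolding selfadjoint_spectral_def by blast

context
  fixes X :: "'a::complex_hilbert_space operator"
  assumes sa: "selfadjoint X"
begin

lemma fun_calc_adjoint:
  assumes "bounded_borel h"
  shows "adjoint_pair (fun_calc X h) (fun_calc X (\<lambda>x. cnj (h x)))"
proof -
  obtain E where "selfadjoint_spectral X E" using selfadjoint_spectral_exists[OF sa] by blast
  then interpret selfadjoint_spectral X E .
  show ?thesis unfolding fun_calc_eq_calc[OF assms] fun_calc_eq_calc[OF bounded_borel_cnj[OF assms]]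
    by (rule represents_basic(3)[OF represents_calc[OF assms]])
qed

lemma fun_calc_mult:
  assumes "bounded_borel f" "bounded_borel g"
  shows "fun_calc X (\<lambda>x. f x * g x) v = fun_calc X f (fun_calc X g v)"
proof -
  obtain E where "selfadjoint_spectral X E" using selfadjoint_spectral_exists[OF sa] by blast
  then interpret selfadjoint_spectral X E .
  show ?thesis
    unfolding fun_calc_eq_calc[OF assms(1)] fun_calc_eq_calc[OF assms(2)] fun_calc_eq_calc[OF bounded_borel_mult[OF assms]]
    using calc_eqI[OF represents_mult[OF represents_calc[OF assms(1)] represents_calc[OF assms(2)]]] by simp
qed

lemma fun_calc_add:
  assumes "bounded_borel f" "bounded_borel g"
  shows "fun_calc X (\<lambda>x. f x + g x) v = fun_calc X f v + fun_calc X g v"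
proof -
  obtain E where "selfadjoint_spectral X E" using selfadjoint_spectral_exists[OF sa] by blast
  then interpret selfadjoint_spectral X E .
  show ?thesis
    unfolding fun_calc_eq_calc[OF assms(1)] fun_calc_eq_calc[OF assms(2)] fun_calc_eq_calc[OF bounded_borel_add[OF assms]]
    using calc_eqI[OF represents.add[OF represents_calc[OF assms(1)] represents_calc[OF assms(2)]]] by simp
qed

lemma fun_calc_const: "fun_calc X (\<lambda>_. c) v = c *\<^sub>C v"
proof -
  obtain E where "selfadjoint_spectral X E" using selfadjoint_spectral_exists[OF sa] by blast
  then interpret selfadjoint_spectral X E .
  show ?thesis
    unfolding fun_calc_eq_calc[OF bounded_borel_const] calc_eqI[OF represents_const] ..
qed

lemma fun_calc_scale:
  assumes "bounded_borel f"
  shows "fun_calc X (\<lambda>x. c * f x) v = c *\<^sub>C fun_calc X f v"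
  using fun_calc_mult[OF bounded_borel_const assms] by (simp add: fun_calc_const)

lemma fun_calc_limit:
  assumes f: "\<And>n. bounded_borel (f n)" and B: "\<And>n x. cmod (f n x) \<le> B"
    and conv: "\<And>x. (\<lambda>n. f n x) \<longlonglongrightarrow> h x" and h: "bounded_borel h"
  shows "(\<lambda>n. fun_calc X (f n) v) \<longlonglongrightarrow> fun_calc X h v"
proof -
  obtain E where "selfadjoint_spectral X E" using selfadjoint_spectral_exists[OF sa] by blast
  then interpret selfadjoint_spectral X E .
  obtain T S where T: "represents h T S" "\<And>v. (\<lambda>n. calc (f n) v) \<longlonglongrightarrow> T v"
    using represents_limit[OF represents_calc[OF f] B conv] by blast
  have "T = calc h" using calc_eqI[OF T(1)] by simp
  then show ?thesis using T(2) by (simp add: fun_calc_eq_calc[OF h] fun_calc_eq_calc[OF f])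
qed

text \<open>A bounded function of \<open>X\<close> maps into the domain of \<open>X\<close> when its product with the identity is
  still bounded, because it then factors through the resolvent.\<close>

lemma fun_calc_in_operator:
  assumes h: "bounded_borel h" and xh: "bounded_borel (\<lambda>x. complex_of_real x * h x)"
  shows "(fun_calc X h v, fun_calc X (\<lambda>x. complex_of_real x * h x) v) \<in> X"
proof -
  obtain E where "selfadjoint_spectral X E" using selfadjoint_spectral_exists[OF sa] by blast
  then interpret selfadjoint_spectral X E .
  let ?r = "\<lambda>x. 1 / (complex_of_real x - \<i>)"
  define g where "g x = complex_of_real x * h x + (- \<i>) * h x" for x
  have r: "bounded_borel ?r" by (rule bounded_borel_resolvent) simp
  have g: "bounded_borel g" unfolding g_def
    by (intro bounded_borel_add xh bounded_borel_mult bounded_borel_const h)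
  have "complex_of_real x - \<i> \<noteq> 0" for x by (simp add: complex_eq_iff)
  then have "h = (\<lambda>x. ?r x * g x)" by (auto simp: g_def fun_eq_iff field_simps)
  then have "fun_calc X h v = calc ?r (fun_calc X g v)"
    using fun_calc_mult[OF r g] by (metis fun_calc_eq_calc[OF r])
  moreover have "fun_calc X g v = fun_calc X (\<lambda>x. complex_of_real x * h x) v + (- \<i>) *\<^sub>C fun_calc X h v"
    unfolding g_def fun_calc_add[OF xh bounded_borel_mult[OF bounded_borel_const h]] fun_calc_scale[OF h] ..
  ultimately show ?thesis
    using resolvent_in[of \<i> "fun_calc X g v"] by (simp add: scaleC_minus_left)
qed

end

lemma (in finite_borel_measure) real_distribution_of_mass:
  assumes "measure M UNIV = 1"
  shows "real_distribution M"
proof -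
  have "space M = UNIV" using sets_eq_imp_space_eq[OF M_is_borel] by simp
  then show ?thesis using assms M_is_borel
    by (intro real_distribution.intro prob_spaceI real_distribution_axioms.intro) (auto simp: emeasure_eq_measure)
qed

lemma bcontfun_bounded_borel:
  fixes h :: "real \<Rightarrow> complex"
  assumes "h \<in> bcontfun"
  shows "bounded_borel h"
proof -
  have "continuous_on UNIV h" "bounded (range h)" using assms by (auto simp: bcontfun_def)
  then show ?thesis unfolding bounded_borel_def bounded_iff by (auto intro: borel_measurable_continuous_onI)
qed

lemma cauchy_kernel_bcontfun:
  assumes "Im z \<noteq> 0"
  shows "(\<lambda>x. 1 / (z - complex_of_real x)) \<in> bcontfun"
proof -
  have "z - complex_of_real x \<noteq> 0" for x using assms by (auto simp: complex_eq_iff)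
  then have "continuous_on UNIV (\<lambda>x. 1 / (z - complex_of_real x))" by (intro continuous_intros) auto
  moreover have "bounded (range (\<lambda>x. 1 / (z - complex_of_real x)))"
    unfolding bounded_iff using cauchy_kernel_bound[OF assms] by blast
  ultimately show ?thesis by (simp add: bcontfun_def)
qed

text \<open>The kernels of the Cauchy transform are bounded and continuous, so the moments
  \<open>\<langle>\<Omega>, h(X) \<Omega>\<rangle>\<close> determine the distribution.\<close>

theorem op_distribution_eq:
  assumes E: "selfadjoint_spectral X E" and "norm \<Omega> = 1"
  shows "op_distribution X \<Omega> = vector_measure E \<Omega>" and "real_distribution (vector_measure E \<Omega>)"
proof -
  interpret selfadjoint_spectral X E by fact
  show rd: "real_distribution (vector_measure E \<Omega>)"
    by (rule finite_borel_measure.real_distribution_of_mass[OF fin]) (simp add: measure_mu_UNIV assms(2))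
  have int: "cinner \<Omega> (fun_calc X h \<Omega>) = (\<integral>x. h x \<partial>vector_measure E \<Omega>)" if "h \<in> bcontfun" for h
    unfolding fun_calc_eq_calc[OF bcontfun_bounded_borel[OF that]]
    by (rule represents_basic(5)[OF represents_calc[OF bcontfun_bounded_borel[OF that]]])
  show "op_distribution X \<Omega> = vector_measure E \<Omega>"
    unfolding op_distribution_def
  proof (rule the_equality)
    show "real_distribution (vector_measure E \<Omega>) \<and>
      (\<forall>h. h \<in> bcontfun \<longrightarrow> cinner \<Omega> (fun_calc X h \<Omega>) = (\<integral>x. h x \<partial>vector_measure E \<Omega>))"
      using rd int by blast
    fix \<nu> assume \<nu>: "real_distribution \<nu> \<and> (\<forall>h. h \<in> bcontfun \<longrightarrow> cinner \<Omega> (fun_calc X h \<Omega>) = (\<integral>x. h x \<partial>\<nu>))"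
    then have "finite_borel_measure \<nu>" using real_distribution.finite_borel_measure_M by blast
    then show "\<nu> = vector_measure E \<Omega>"
    proof (rule cauchy_transform_eqI[OF _ fin])
      fix z assume "Im z > 0"
      then have "(\<lambda>x. 1 / (z - complex_of_real x)) \<in> bcontfun" by (intro cauchy_kernel_bcontfun) simp
      then show "cauchy_transform \<nu> z = cauchy_transform (vector_measure E \<Omega>) z"
        using \<nu> int unfolding cauchy_transform_def by metis
    qed
  qed
qed

section \<open>Boolean independence\<close>

lemma bcontfun_complex_iff:
  fixes h :: "'b::topological_space \<Rightarrow> complex"
  shows "h \<in> bcontfun \<longleftrightarrow> continuous_on UNIV h \<and> (\<exists>B. \<forall>x. cmod (h x) \<le> B)"
  unfolding bcontfun_def bounded_iff by auto

lemma bcontfun_mult: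
  fixes f g :: "real \<Rightarrow> complex"
  assumes "f \<in> bcontfun" "g \<in> bcontfun"
  shows "(\<lambda>x. f x * g x) \<in> bcontfun"
proof -
  obtain B C where B: "\<And>x. cmod (f x) \<le> B" and C: "\<And>x. cmod (g x) \<le> C"
    using assms unfolding bcontfun_complex_iff by blast
  have "B \<ge> 0" using B[of 0] norm_ge_zero order_trans by blast
  then have "cmod (f x * g x) \<le> B * C" for x using mult_mono[OF B C] by (simp add: norm_mult)
  moreover have "continuous_on UNIV (\<lambda>x. f x * g x)"
    using assms unfolding bcontfun_complex_iff by (intro continuous_intros) auto
  ultimately show ?thesis unfolding bcontfun_complex_iff by blast
qed

lemma bcontfun_add:
  fixes f g :: "real \<Rightarrow> complex"
  assumes "f \<in> bcontfun" "g \<in> bcontfun"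
  shows "(\<lambda>x. f x + g x) \<in> bcontfun"
proof -
  obtain B C where B: "\<And>x. cmod (f x) \<le> B" and C: "\<And>x. cmod (g x) \<le> C"
    using assms unfolding bcontfun_complex_iff by blast
  have "cmod (f x + g x) \<le> B + C" for x using norm_triangle_mono[OF B C] .
  moreover have "continuous_on UNIV (\<lambda>x. f x + g x)"
    using assms unfolding bcontfun_complex_iff by (intro continuous_intros) auto
  ultimately show ?thesis unfolding bcontfun_complex_iff by blast
qed

lemma bcontfun_const: "(\<lambda>_. c) \<in> bcontfun" for c :: complex
  unfolding bcontfun_complex_iff by auto

lemma bcontfun_cnj:
  fixes f :: "real \<Rightarrow> complex"
  shows "f \<in> bcontfun \<Longrightarrow> (\<lambda>x. cnj (f x)) \<in> bcontfun"
  unfolding bcontfun_complex_iff by (auto intro: continuous_intros)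

lemma fun_calc_in_alg0:
  assumes "h \<in> bcontfun" "h 0 = 0"
  shows "fun_calc X h \<in> alg0 X"
proof -
  have "(\<lambda>z. h (Re z)) \<in> bcontfun"
    using assms(1) unfolding bcontfun_complex_iff
    by (auto intro!: continuous_on_compose2[where g = h and t = UNIV] continuous_intros)
  then show ?thesis unfolding alg0_def using assms(2)
    by (intro CollectI exI[of _ "\<lambda>z. h (Re z)"]) simp
qed

lemma boolean_independent_sym:
  assumes "boolean_independent X Y \<Omega>"
  shows "boolean_independent Y X \<Omega>"
  unfolding boolean_independent_def boolean_independent_algebras_def
proof (intro allI ballI impI)
  fix k es Ts
  assume es: "es \<in> alternating_indices k"
    and Ts: "list_all2 (\<lambda>e T. T \<in> (if e = 1 then alg0 Y else alg0 X)) es Ts"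
  have "inj_on (\<lambda>e::nat. 3 - e) (set es)"
    using es by (auto simp: alternating_indices_def inj_on_def)
  then have "map (\<lambda>e. 3 - e) es \<in> alternating_indices k"
    using es by (auto simp: alternating_indices_def distinct_adj_mapI)
  moreover have "list_all2 (\<lambda>e T. T \<in> (if e = 1 then alg0 X else alg0 Y)) (map (\<lambda>e. 3 - e) es) Ts"
    unfolding list_all2_conv_all_nth
  proof (intro conjI allI impI)
    show "length (map (\<lambda>e. 3 - e) es) = length Ts" using Ts by (simp add: list_all2_lengthD)
    fix i assume i: "i < length (map (\<lambda>e. 3 - e) es)"
    have "set es \<subseteq> {1, 2}" using es by (simp add: alternating_indices_def)
    moreover have "es ! i \<in> set es" using i by simp
    ultimately have "es ! i \<in> {1, 2}" by blast
    then show "Ts ! i \<in> (if map (\<lambda>e. 3 - e) es ! i = 1 then alg0 X else alg0 Y)"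
      using Ts i by (auto simp: list_all2_conv_all_nth)
  qed
  ultimately show "cinner \<Omega> (foldr (\<lambda>T v. T v) Ts \<Omega>) = (\<Prod>T\<leftarrow>Ts. cinner \<Omega> (T \<Omega>))"
    using assms unfolding boolean_independent_def boolean_independent_algebras_def by blast
qed

lemma boolean_independent_products:
  assumes "boolean_independent X Y \<Omega>" and "S \<in> alg0 X" "T \<in> alg0 Y" "S' \<in> alg0 X"
  shows "cinner \<Omega> (S (T \<Omega>)) = cinner \<Omega> (S \<Omega>) * cinner \<Omega> (T \<Omega>)"
    and "cinner \<Omega> (T (S \<Omega>)) = cinner \<Omega> (T \<Omega>) * cinner \<Omega> (S \<Omega>)"
    and "cinner \<Omega> (S (T (S' \<Omega>))) = cinner \<Omega> (S \<Omega>) * (cinner \<Omega> (T \<Omega>) * cinner \<Omega> (S' \<Omega>))"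
proof -
  have fact: "cinner \<Omega> (foldr (\<lambda>T v. T v) Ts \<Omega>) = (\<Prod>T\<leftarrow>Ts. cinner \<Omega> (T \<Omega>))"
    if "es \<in> alternating_indices k" "list_all2 (\<lambda>e T. T \<in> (if e = 1 then alg0 X else alg0 Y)) es Ts" for k es Ts
    using assms(1) that unfolding boolean_independent_def boolean_independent_algebras_def by blast
  show "cinner \<Omega> (S (T \<Omega>)) = cinner \<Omega> (S \<Omega>) * cinner \<Omega> (T \<Omega>)"
    using fact[of "[1, 2]" 2 "[S, T]"] assms by (simp add: alternating_indices_def)
  show "cinner \<Omega> (T (S \<Omega>)) = cinner \<Omega> (T \<Omega>) * cinner \<Omega> (S \<Omega>)"
    using fact[of "[2, 1]" 2 "[T, S]"] assms by (simp add: alternating_indices_def)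
  show "cinner \<Omega> (S (T (S' \<Omega>))) = cinner \<Omega> (S \<Omega>) * (cinner \<Omega> (T \<Omega>) * cinner \<Omega> (S' \<Omega>))"
    using fact[of "[1, 2, 1]" 3 "[S, T, S']"] assms by (simp add: alternating_indices_def)
qed

lemma fun_calc_linear:
  assumes "selfadjoint X" "bounded_borel h"
  shows "fun_calc X h (x - y) = fun_calc X h x - fun_calc X h y"
    and "fun_calc X h (x + y) = fun_calc X h x + fun_calc X h y"
    and "fun_calc X h (c *\<^sub>C x) = c *\<^sub>C fun_calc X h x"
  using adjoint_pair_diff[OF fun_calc_adjoint[OF assms]] adjoint_pair_add[OF fun_calc_adjoint[OF assms]]
    adjoint_pair_scaleC[OF fun_calc_adjoint[OF assms]] by auto

text \<open>The computation at the heart of boolean independence. With \<open>m = \<langle>\<Omega>, h(X) \<Omega>\<rangle>\<close> and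
  \<open>\<xi> = h(X) \<Omega> - m \<Omega>\<close>, the squared norm of \<open>k(Y) \<xi>\<close> is a combination of four alternating moments, and
  it is \<open>|m|\<^sup>2 \<langle>\<Omega>, |k|\<^sup>2(Y) \<Omega>\<rangle>\<close> times \<open>1 - 1 - 1 + 1\<close>.\<close>

lemma boolean_independent_annihilates_alg0:
  assumes sa: "selfadjoint X" "selfadjoint Y" and bi: "boolean_independent X Y \<Omega>"
    and norm: "norm \<Omega> = 1"
    and h: "h \<in> bcontfun" "h 0 = 0" and k: "k \<in> bcontfun" "k 0 = 0"
  shows "fun_calc Y k (fun_calc X h \<Omega> - cinner \<Omega> (fun_calc X h \<Omega>) *\<^sub>C \<Omega>) = 0"
proof -
  define m where "m = cinner \<Omega> (fun_calc X h \<Omega>)"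
  define \<xi> where "\<xi> = fun_calc X h \<Omega> - m *\<^sub>C \<Omega>"
  define S where "S = fun_calc X h"
  define S' where "S' = fun_calc X (\<lambda>x. cnj (h x))"
  define K where "K = fun_calc Y (\<lambda>x. cnj (k x) * k x)"
  note hb = bcontfun_bounded_borel[OF h(1)] and kb = bcontfun_bounded_borel[OF k(1)]
  have kkb: "bounded_borel (\<lambda>x. cnj (k x) * k x)" by (intro bounded_borel_mult bounded_borel_cnj kb)
  have S: "S \<in> alg0 X" "S' \<in> alg0 X" "K \<in> alg0 Y"
    unfolding S_def S'_def K_def using h k by (auto intro!: fun_calc_in_alg0 bcontfun_cnj bcontfun_mult)
  have adjS: "cinner (S x) y = cinner x (S' y)" for x y
    unfolding S_def S'_def using adjoint_pairD[OF adjoint_pair_sym[OF fun_calc_adjoint[OF sa(1) hb]]] by simp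
  define \<kappa> where "\<kappa> = cinner \<Omega> (K \<Omega>)"
  have m': "cinner \<Omega> (S' \<Omega>) = cnj m"
    unfolding m_def S_def[symmetric] adjS[symmetric] by (rule cinner_commute)
  have one: "cinner \<Omega> \<Omega> = 1" using norm by (simp add: cinner_self)
  have "cinner (fun_calc Y k \<xi>) (fun_calc Y k \<xi>) = cinner \<xi> (K \<xi>)"
    unfolding K_def fun_calc_mult[OF sa(2) bounded_borel_cnj[OF kb] kb]
    using adjoint_pairD[OF adjoint_pair_sym[OF fun_calc_adjoint[OF sa(2) kb]]] by simp
  also have "K \<xi> = K (S \<Omega>) - m *\<^sub>C K \<Omega>"
    unfolding \<xi>_def K_def S_def fun_calc_linear[OF sa(2) kkb] ..
  also have "cinner \<xi> (K (S \<Omega>) - m *\<^sub>C K \<Omega>)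
      = cinner \<Omega> (S' (K (S \<Omega>))) - m * cinner \<Omega> (S' (K \<Omega>)) - cnj m * (cinner \<Omega> (K (S \<Omega>)) - m * cinner \<Omega> (K \<Omega>))"
    unfolding \<xi>_def S_def[symmetric] by (simp add: cinner_simps adjS algebra_simps)
  also have "\<dots> = 0"
    unfolding boolean_independent_products(3)[OF bi S(2) S(3) S(1)] boolean_independent_products(1)[OF bi S(2) S(3) S(2)]
      boolean_independent_products(2)[OF bi S(1) S(3) S(1)] m'
    by (simp add: m_def S_def algebra_simps)
  finally show ?thesis unfolding cinner_self m_def[symmetric] \<xi>_def[symmetric] by simp
qed

text \<open>Splitting off the values of \<open>F\<close> and \<open>k\<close> at \<open>0\<close> reduces to the preceding computation. This passes from
  the algebras in the definition of independence to all functions of the operators, and to \<open>Y\<close> itself.\<close>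

lemma boolean_independent_kernel:
  assumes sa: "selfadjoint X" "selfadjoint Y" and bi: "boolean_independent X Y \<Omega>"
    and norm: "norm \<Omega> = 1" and F: "F \<in> bcontfun"
  defines "\<xi> \<equiv> fun_calc X F \<Omega> - cinner \<Omega> (fun_calc X F \<Omega>) *\<^sub>C \<Omega>"
  shows "k \<in> bcontfun \<Longrightarrow> fun_calc Y k \<xi> = k 0 *\<^sub>C \<xi>" and "(\<xi>, 0) \<in> Y"
proof -
  have one: "cinner \<Omega> \<Omega> = 1" using norm by (simp add: cinner_self)
  define F0 where "F0 x = F x + (- F 0)" for x
  have F0: "F0 \<in> bcontfun" "F0 0 = 0"
    unfolding F0_def by (intro bcontfun_add F bcontfun_const) simp
  have F0eq: "fun_calc X F0 \<Omega> = fun_calc X F \<Omega> - F 0 *\<^sub>C \<Omega>"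
    unfolding F0_def fun_calc_add[OF sa(1) bcontfun_bounded_borel[OF F] bounded_borel_const] fun_calc_const[OF sa(1)]
    by (simp add: scaleC_minus_left)
  have \<xi>: "\<xi> = fun_calc X F0 \<Omega> - cinner \<Omega> (fun_calc X F0 \<Omega>) *\<^sub>C \<Omega>"
    unfolding F0eq \<xi>_def by (simp add: cinner_simps one scaleC_simps)
  show all: "fun_calc Y k \<xi> = k 0 *\<^sub>C \<xi>" if k: "k \<in> bcontfun" for k
  proof -
    define k0 where "k0 x = k x + (- k 0)" for x
    have k0: "k0 \<in> bcontfun" "k0 0 = 0"
      unfolding k0_def by (intro bcontfun_add k bcontfun_const) simp
    have "fun_calc Y k0 \<xi> = fun_calc Y k \<xi> - k 0 *\<^sub>C \<xi>"
      unfolding k0_def fun_calc_add[OF sa(2) bcontfun_bounded_borel[OF k] bounded_borel_const] fun_calc_const[OF sa(2)]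
      by (simp add: scaleC_minus_left)
    moreover have "fun_calc Y k0 \<xi> = 0"
      unfolding \<xi> by (rule boolean_independent_annihilates_alg0[OF sa bi norm F0 k0])
    ultimately show ?thesis by simp
  qed
  \<comment> \<open>Applied to the resolvent function this says that \<open>\<xi>\<close> is a multiple of a vector in the
     domain, on which \<open>Y\<close> acts as zero.\<close>
  define r where "r x = 1 / (\<i> - complex_of_real x)" for x
  have r: "r \<in> bcontfun" unfolding r_def by (rule cauchy_kernel_bcontfun) simp
  have "complex_of_real x * r x = \<i> * r x + (- 1)" for x
  proof -
    have "\<i> - complex_of_real x \<noteq> 0" by (simp add: complex_eq_iff)
    then show ?thesis by (simp add: r_def field_simps)
  qed
  then have xr: "(\<lambda>x. complex_of_real x * r x) \<in> bcontfun"
    by (simp only:) (intro bcontfun_add bcontfun_mult bcontfun_const r)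
  have "(fun_calc Y r \<xi>, fun_calc Y (\<lambda>x. complex_of_real x * r x) \<xi>) \<in> Y"
    by (intro fun_calc_in_operator sa bcontfun_bounded_borel r xr)
  then have "(r 0 *\<^sub>C \<xi>, 0) \<in> Y" unfolding all[OF r] all[OF xr] by simp
  from linear_operatorD(2)[OF _ this, of \<i>] show "(\<xi>, 0) \<in> Y"
    using sa(2) by (simp add: selfadjoint_def r_def scaleC_scaleC)
qed

section \<open>The sum of two boolean independent operators\<close>

lemma linear_op_sum:
  assumes "linear_operator X" "linear_operator Y"
  shows "linear_operator (op_sum X Y)"
proof -
  have "u = v" if "(x, u) \<in> op_sum X Y" "(x, v) \<in> op_sum X Y" for x u v
    using that linear_operatorD(4)[OF assms(1)] linear_operatorD(4)[OF assms(2)] unfolding op_sum_def by blast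
  moreover have "(0, 0) \<in> op_sum X Y"
    using linear_operatorD(3)[OF assms(1)] linear_operatorD(3)[OF assms(2)] unfolding op_sum_def by force
  moreover have "(x + y, u + v) \<in> op_sum X Y" if xy: "(x, u) \<in> op_sum X Y" "(y, v) \<in> op_sum X Y" for x u y v
  proof -
    obtain a b c d where ab: "(x, a) \<in> X" "(x, b) \<in> Y" "u = a + b" "(y, c) \<in> X" "(y, d) \<in> Y" "v = c + d"
      using xy unfolding op_sum_def by blast
    have "(x + y, a + c) \<in> X" "(x + y, b + d) \<in> Y" "u + v = (a + c) + (b + d)"
      using linear_operatorD(1)[OF assms(1) ab(1,4)] linear_operatorD(1)[OF assms(2) ab(2,5)] ab by simp_all
    then show ?thesis unfolding op_sum_def by blast
  qed
  moreover have "(c *\<^sub>C x, c *\<^sub>C u) \<in> op_sum X Y" if xu: "(x, u) \<in> op_sum X Y" for c x u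
  proof -
    obtain a b where ab: "(x, a) \<in> X" "(x, b) \<in> Y" "u = a + b" using xu unfolding op_sum_def by blast
    have "(c *\<^sub>C x, c *\<^sub>C a) \<in> X" "(c *\<^sub>C x, c *\<^sub>C b) \<in> Y" "c *\<^sub>C u = c *\<^sub>C a + c *\<^sub>C b"
      using linear_operatorD(2)[OF assms(1) ab(1)] linear_operatorD(2)[OF assms(2) ab(2)] ab by (simp_all add: scaleC_simps)
    then show ?thesis unfolding op_sum_def by blast
  qed
  ultimately show ?thesis unfolding linear_operator_def single_valued_def by blast
qed

lemma symmetric_op_sum:
  assumes "symmetric_operator X" "symmetric_operator Y"
  shows "symmetric_operator (op_sum X Y)"
  unfolding symmetric_operator_def op_sum_def
  by (auto simp: cinner_simps symmetric_operatorD[OF assms(1)] symmetric_operatorD[OF assms(2)])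

lemma cauchy_transform_op_distribution:
  assumes sa: "selfadjoint X" and norm: "norm \<Omega> = 1" and z: "Im z \<noteq> 0"
  shows "cauchy_transform (op_distribution X \<Omega>) z = cinner \<Omega> (fun_calc X (\<lambda>x. 1 / (z - complex_of_real x)) \<Omega>)"
proof -
  obtain E where E: "selfadjoint_spectral X E" using selfadjoint_spectral_exists[OF sa] by blast
  then interpret selfadjoint_spectral X E .
  have b: "bounded_borel (\<lambda>x. 1 / (z - complex_of_real x))"
    by (rule bcontfun_bounded_borel[OF cauchy_kernel_bcontfun[OF z]])
  show ?thesis
    unfolding op_distribution_eq(1)[OF E norm] fun_calc_eq_calc[OF b] represents_basic(5)[OF represents_calc[OF b]]
    by (simp add: cauchy_transform_def)
qed

lemma resolvent_function:
  assumes sa: "selfadjoint X" and z: "Im z \<noteq> 0" and p: "p \<in> bcontfun"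
  defines "F \<equiv> \<lambda>x. p x * (1 / (z - complex_of_real x))"
  shows "F \<in> bcontfun" "(\<lambda>x. complex_of_real x * F x) \<in> bcontfun"
    and "fun_calc X (\<lambda>x. complex_of_real x * F x) v = z *\<^sub>C fun_calc X F v - fun_calc X p v"
proof -
  show F: "F \<in> bcontfun" unfolding F_def by (intro bcontfun_mult p cauchy_kernel_bcontfun z)
  have "z - complex_of_real x \<noteq> 0" for x using z by (auto simp: complex_eq_iff)
  then have eq: "(\<lambda>x. complex_of_real x * F x) = (\<lambda>x. z * F x + (- 1) * p x)"
    by (auto simp: F_def fun_eq_iff field_simps)
  show "(\<lambda>x. complex_of_real x * F x) \<in> bcontfun"
    unfolding eq by (intro bcontfun_add bcontfun_mult bcontfun_const F p)
  note b = bcontfun_bounded_borel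
  show "fun_calc X (\<lambda>x. complex_of_real x * F x) v = z *\<^sub>C fun_calc X F v - fun_calc X p v"
    unfolding eq fun_calc_add[OF sa bounded_borel_mult[OF bounded_borel_const b[OF F]] bounded_borel_mult[OF bounded_borel_const b[OF p]]]
      fun_calc_scale[OF sa b[OF F]] fun_calc_scale[OF sa b[OF p]]
    by (simp add: scaleC_minus_left)
qed

text \<open>With \<open>\<rho> = (z - X)\<^sup>-\<^sup>1 \<Omega>\<close> and \<open>G = \<langle>\<Omega>, \<rho>\<rangle>\<close>, symmetry of \<open>X\<close> gives
  \<open>Im G = - Im z \<parallel>\<rho>\<parallel>\<^sup>2\<close>, while \<open>|G| \<le> \<parallel>\<rho>\<parallel>\<close>. So \<open>Im (1/G) = - Im G / |G|\<^sup>2\<close> is at least as large as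
  \<open>Im z\<close> in the direction of \<open>Im z\<close>.\<close>

lemma reciprocal_cauchy_transform_Im:
  assumes sa: "selfadjoint X" and norm: "norm \<Omega> = 1" and z: "Im z \<noteq> 0"
  defines "G \<equiv> cauchy_transform (op_distribution X \<Omega>) z"
  shows "G \<noteq> 0" and "1 \<le> Im (1 / G) / Im z"
proof -
  have lin: "linear_operator X" using sa by (simp add: selfadjoint_def)
  note r = resolvent_function[OF sa z bcontfun_const[of 1], simplified]
  define \<rho> where "\<rho> = fun_calc X (\<lambda>x. 1 / (z - complex_of_real x)) \<Omega>"
  have G: "G = cinner \<Omega> \<rho>"
    unfolding G_def \<rho>_def by (rule cauchy_transform_op_distribution[OF sa norm z])
  have r': "bounded_borel (\<lambda>x. complex_of_real x * (1 / (z - complex_of_real x)))"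
    using bcontfun_bounded_borel[OF r(2)] by simp
  have mem: "(\<rho>, z *\<^sub>C \<rho> - \<Omega>) \<in> X"
    using fun_calc_in_operator[OF sa bcontfun_bounded_borel[OF r(1)] r', of \<Omega>] r(3)[of \<Omega>]
    by (simp add: \<rho>_def fun_calc_const[OF sa])
  have "\<rho> \<noteq> 0"
  proof
    assume "\<rho> = 0"
    then have "(0, - \<Omega>) \<in> X" using mem by simp
    then have "- \<Omega> = 0" using linear_operatorD(3,4)[OF lin] by blast
    then show False using norm by simp
  qed
  have "cinner \<rho> (z *\<^sub>C \<rho> - \<Omega>) = cinner (z *\<^sub>C \<rho> - \<Omega>) \<rho>"
    by (rule symmetric_operatorD[OF selfadjoint_symmetric[OF sa] mem mem])
  then have "z * of_real ((norm \<rho>)\<^sup>2) - cnj G = cnj z * of_real ((norm \<rho>)\<^sup>2) - G"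
    unfolding G using cinner_commute[of \<rho> \<Omega>] by (simp add: cinner_simps cinner_self)
  then have "Im (z * of_real ((norm \<rho>)\<^sup>2) - cnj G) = Im (cnj z * of_real ((norm \<rho>)\<^sup>2) - G)" by (rule arg_cong)
  then have im: "Im G = - Im z * (norm \<rho>)\<^sup>2" by simp
  then have "Im G \<noteq> 0" using z \<open>\<rho> \<noteq> 0\<close> by simp
  then show G0: "G \<noteq> 0" by auto
  have "cmod G \<le> norm \<rho>" using cinner_Cauchy_Schwarz[of \<Omega> \<rho>] norm G by simp
  then have "(cmod G)\<^sup>2 \<le> (norm \<rho>)\<^sup>2" by (rule power_mono) simp
  moreover have "Im (1 / G) = Im z * (norm \<rho>)\<^sup>2 / (cmod G)\<^sup>2"
    using im by (simp add: Im_divide cmod_power2)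
  then have "Im (1 / G) / Im z = (norm \<rho>)\<^sup>2 / (cmod G)\<^sup>2" using z by simp
  ultimately show "1 \<le> Im (1 / G) / Im z" using G0 by simp
qed

text \<open>Multiplying \<open>F\<close> with \<open>N\<^sup>2 / (N\<^sup>2 + x\<^sup>2)\<close> for large \<open>N\<close> moves \<open>F(X) \<Omega>\<close> into the domain of \<open>X\<close> but changes its mean. A small
  multiple of the cutoff function restores the mean exactly, as gluing requires; its coefficient tends to
  \<open>0\<close>, since the defect of the mean tends to \<open>0\<close> and the mean of the cutoff function tends to \<open>1\<close>.\<close>

lemma cutoff_approximation:
  assumes sa: "selfadjoint X" and norm: "norm \<Omega> = 1" and F: "F \<in> bcontfun"
  defines "\<alpha> \<equiv> cinner \<Omega> (fun_calc X F \<Omega>)"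
  shows "\<exists>f. (\<forall>n::nat. f n \<in> bcontfun \<and> (\<lambda>x. complex_of_real x * f n x) \<in> bcontfun \<and> cinner \<Omega> (fun_calc X (f n) \<Omega>) = \<alpha>)
    \<and> (\<lambda>n. fun_calc X (f n) \<Omega>) \<longlonglongrightarrow> fun_calc X F \<Omega>"
proof -
  note b = bcontfun_bounded_borel
  have one: "cinner \<Omega> \<Omega> = 1" using norm by (simp add: cinner_self)
  define c where "c n x = complex_of_real (1 / (1 + (x * inverse (real (Suc n)))\<^sup>2))" for n x
  have pos: "0 < 1 + (x * inverse (real (Suc n)))\<^sup>2" for n and x :: real by (simp add: add_pos_nonneg)
  have cbound: "cmod (c n x) \<le> 1" for n x
    unfolding c_def norm_of_real using pos[of x n] by (simp add: divide_le_eq_1)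
  have ccont: "continuous_on UNIV (c n)" for n
    unfolding c_def by (intro continuous_intros) (use pos in \<open>auto simp: less_le\<close>)
  have cb: "c n \<in> bcontfun" for n unfolding bcontfun_complex_iff using cbound ccont by blast
  have xcbound: "cmod (complex_of_real x * c n x) \<le> real (Suc n)" for n x
  proof -
    define y where "y = x * inverse (real (Suc n))"
    have x: "x = y * real (Suc n)" unfolding y_def by simp
    have "\<bar>y\<bar> \<le> 1 + y\<^sup>2" using sum_squares_bound[of 1 "\<bar>y\<bar>"] by simp
    then have y: "\<bar>y\<bar> / (1 + y\<^sup>2) \<le> 1" using pos[of x n] unfolding y_def[symmetric] by simp
    have "cmod (complex_of_real x * c n x) = \<bar>x\<bar> * \<bar>1 / (1 + y\<^sup>2)\<bar>"
      unfolding c_def norm_mult norm_of_real y_def[symmetric] ..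
    also have "\<dots> = real (Suc n) * (\<bar>y\<bar> / (1 + y\<^sup>2))"
      unfolding x abs_mult using pos[of x n] unfolding y_def[symmetric] by simp
    also have "\<dots> \<le> real (Suc n) * 1" by (rule mult_left_mono[OF y]) simp
    finally show ?thesis by simp
  qed
  have xcb: "(\<lambda>x. complex_of_real x * c n x) \<in> bcontfun" for n
    unfolding bcontfun_complex_iff using xcbound ccont by (auto intro!: continuous_intros)
  have clim: "(\<lambda>n. c n x) \<longlonglongrightarrow> 1" for x
  proof -
    have "(\<lambda>n. 1 / (1 + (x * inverse (real (Suc n)))\<^sup>2)) \<longlonglongrightarrow> 1 / (1 + (x * 0)\<^sup>2)"
      by (intro tendsto_intros LIMSEQ_inverse_real_of_nat) simp
    then have "(\<lambda>n. 1 / (1 + (x * inverse (real (Suc n)))\<^sup>2)) \<longlonglongrightarrow> 1"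
      by (simp only: mult_zero_right power_zero_numeral add_0_right div_by_1)
    from tendsto_of_real[OF this] show ?thesis unfolding c_def by (simp only: of_real_1)
  qed
  have Fc: "(\<lambda>x. F x * c n x) \<in> bcontfun" for n by (intro bcontfun_mult F cb)
  have lim1: "(\<lambda>n. fun_calc X (c n) \<Omega>) \<longlonglongrightarrow> \<Omega>"
    using fun_calc_limit[OF sa b[OF cb] cbound clim bounded_borel_const, of \<Omega>] by (simp add: fun_calc_const[OF sa])
  have limF: "(\<lambda>n. fun_calc X (\<lambda>x. F x * c n x) \<Omega>) \<longlonglongrightarrow> fun_calc X F \<Omega>"
  proof -
    obtain B where B: "\<And>x. cmod (F x) \<le> B" using F unfolding bcontfun_complex_iff by blast
    have "B \<ge> 0" using B[of 0] norm_ge_zero order_trans by blast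
    then have "cmod (F x * c n x) \<le> B" for n x
      using mult_mono[OF B cbound] by (simp add: norm_mult)
    moreover have "(\<lambda>n. F x * c n x) \<longlonglongrightarrow> F x" for x
      using tendsto_mult[OF tendsto_const clim, of "F x"] by simp
    ultimately show ?thesis by (intro fun_calc_limit sa b Fc F)
  qed
  define m where "m n = cinner \<Omega> (fun_calc X (c n) \<Omega>)" for n
  define d where "d n = (\<alpha> - cinner \<Omega> (fun_calc X (\<lambda>x. F x * c n x) \<Omega>)) / m n" for n
  have m1: "m \<longlonglongrightarrow> 1" unfolding m_def using tendsto_cinner[OF tendsto_const lim1, of \<Omega>] one by simp
  have d0: "d \<longlonglongrightarrow> 0"
  proof -
    have "d \<longlonglongrightarrow> (\<alpha> - \<alpha>) / 1" unfolding d_def \<alpha>_def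
      by (intro tendsto_divide tendsto_diff tendsto_const tendsto_cinner limF m1) simp
    then show ?thesis by simp
  qed
  have "\<forall>\<^sub>F n in sequentially. m n \<noteq> 0" using tendsto_imp_eventually_ne[OF m1] by simp
  then obtain N where N: "\<And>n. n \<ge> N \<Longrightarrow> m n \<noteq> 0" unfolding eventually_sequentially by blast
  define f where "f n x = F x * c (n + N) x + d (n + N) * c (n + N) x" for n x
  have f1: "f n \<in> bcontfun" for n unfolding f_def by (intro bcontfun_add bcontfun_mult bcontfun_const F cb)
  have "(\<lambda>x. complex_of_real x * f n x) = (\<lambda>x. (F x + d (n + N)) * (complex_of_real x * c (n + N) x))" for n
    by (simp add: f_def fun_eq_iff algebra_simps)
  then have f2: "(\<lambda>x. complex_of_real x * f n x) \<in> bcontfun" for n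
    by (simp only:) (intro bcontfun_add bcontfun_mult bcontfun_const F xcb)
  have f3: "fun_calc X (f n) \<Omega> = fun_calc X (\<lambda>x. F x * c (n + N) x) \<Omega> + d (n + N) *\<^sub>C fun_calc X (c (n + N)) \<Omega>" for n
    unfolding f_def fun_calc_add[OF sa b[OF Fc] bounded_borel_mult[OF bounded_borel_const b[OF cb]]] fun_calc_scale[OF sa b[OF cb]] ..
  have f4: "cinner \<Omega> (fun_calc X (f n) \<Omega>) = \<alpha>" for n
    unfolding f3 using N[of "n + N"] by (simp add: cinner_simps d_def m_def)
  have "(\<lambda>n. d (n + N) *\<^sub>C fun_calc X (c (n + N)) \<Omega>) \<longlonglongrightarrow> 0"
  proof (rule tendsto_norm_zero_cancel)
    have "(\<lambda>n. cmod (d (n + N)) * norm (fun_calc X (c (n + N)) \<Omega>)) \<longlonglongrightarrow> cmod 0 * norm \<Omega>"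
      by (intro tendsto_mult tendsto_norm LIMSEQ_ignore_initial_segment lim1 d0)
    then show "(\<lambda>n. norm (d (n + N) *\<^sub>C fun_calc X (c (n + N)) \<Omega>)) \<longlonglongrightarrow> 0" by simp
  qed
  from tendsto_add[OF LIMSEQ_ignore_initial_segment[OF limF, of N] this]
  have "(\<lambda>n. fun_calc X (f n) \<Omega>) \<longlonglongrightarrow> fun_calc X F \<Omega>" by (simp add: f3)
  then show ?thesis using f1 f2 f4 by blast
qed

locale boolean_pair =
  fixes X Y :: "'a::complex_hilbert_space operator" and \<Omega> :: 'a
  assumes saX: "selfadjoint X" and saY: "selfadjoint Y" and norm_Omega: "norm \<Omega> = 1"
    and indep: "boolean_independent X Y \<Omega>" and cyclic: "cyclic_vector X Y \<Omega>"
begin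

definition core :: "'a set" where
  "core = {fun_calc X p \<Omega> + fun_calc Y q \<Omega> | p q. p \<in> bcontfun \<and> q \<in> bcontfun}"

lemma cinner_Omega: "cinner \<Omega> \<Omega> = 1"
  using norm_Omega by (simp add: cinner_self)

lemmas kernelY = boolean_independent_kernel[OF saX saY indep norm_Omega]
lemmas kernelX = boolean_independent_kernel[OF saY saX boolean_independent_sym[OF indep] norm_Omega]

lemma coreI: "p \<in> bcontfun \<Longrightarrow> q \<in> bcontfun \<Longrightarrow> fun_calc X p \<Omega> + fun_calc Y q \<Omega> \<in> core"
  unfolding core_def by blast

lemma core_add:
  assumes "v \<in> core" "w \<in> core"
  shows "v + w \<in> core"
proof -
  note b = bcontfun_bounded_borel
  obtain p q p' q' where v: "v = fun_calc X p \<Omega> + fun_calc Y q \<Omega>" "p \<in> bcontfun" "q \<in> bcontfun"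
    and w: "w = fun_calc X p' \<Omega> + fun_calc Y q' \<Omega>" "p' \<in> bcontfun" "q' \<in> bcontfun"
    using assms unfolding core_def by blast
  have "v + w = fun_calc X (\<lambda>x. p x + p' x) \<Omega> + fun_calc Y (\<lambda>x. q x + q' x) \<Omega>"
    unfolding v(1) w(1) fun_calc_add[OF saX b[OF v(2)] b[OF w(2)]] fun_calc_add[OF saY b[OF v(3)] b[OF w(3)]]
    by (simp add: algebra_simps)
  also have "\<dots> \<in> core" by (intro coreI bcontfun_add v w)
  finally show ?thesis .
qed

lemma core_scale:
  assumes "v \<in> core"
  shows "c *\<^sub>C v \<in> core"
proof -
  note b = bcontfun_bounded_borel
  obtain p q where v: "v = fun_calc X p \<Omega> + fun_calc Y q \<Omega>" "p \<in> bcontfun" "q \<in> bcontfun"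
    using assms unfolding core_def by blast
  have "c *\<^sub>C v = fun_calc X (\<lambda>x. c * p x) \<Omega> + fun_calc Y (\<lambda>x. c * q x) \<Omega>"
    unfolding v(1) fun_calc_scale[OF saX b[OF v(2)]] fun_calc_scale[OF saY b[OF v(3)]]
    by (simp add: scaleC_simps)
  also have "\<dots> \<in> core" by (intro coreI bcontfun_mult bcontfun_const v)
  finally show ?thesis .
qed

lemma core_X: "p \<in> bcontfun \<Longrightarrow> fun_calc X p \<Omega> \<in> core"
  using coreI[OF _ bcontfun_const[of 0]] by (simp add: fun_calc_const[OF saY])

lemma core_Y: "q \<in> bcontfun \<Longrightarrow> fun_calc Y q \<Omega> \<in> core"
  using coreI[OF bcontfun_const[of 0]] by (simp add: fun_calc_const[OF saX])

lemma core_Omega: "\<Omega> \<in> core"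
  using core_X[OF bcontfun_const[of 1]] by (simp add: fun_calc_const[OF saX])

text \<open>On \<open>q(Y) \<Omega>\<close> minus its mean, \<open>f(X)\<close> is multiplication by \<open>f 0\<close>, so only \<open>f(X)\<close> applied to vectors of the
  form \<open>p(X) \<Omega>\<close> produces anything new.\<close>

lemma core_invariant_X:
  assumes f: "f \<in> bcontfun" and "v \<in> core"
  shows "fun_calc X f v \<in> core"
proof -
  note b = bcontfun_bounded_borel
  obtain p q where v: "v = fun_calc X p \<Omega> + fun_calc Y q \<Omega>" "p \<in> bcontfun" "q \<in> bcontfun"
    using assms unfolding core_def by blast
  define n where "n = cinner \<Omega> (fun_calc Y q \<Omega>)"
  define \<xi> where "\<xi> = fun_calc Y q \<Omega> - n *\<^sub>C \<Omega>"
  have "v = fun_calc X p \<Omega> + (\<xi> + n *\<^sub>C \<Omega>)" by (simp add: v \<xi>_def)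
  then have "fun_calc X f v = fun_calc X f (fun_calc X p \<Omega>) + (fun_calc X f \<xi> + n *\<^sub>C fun_calc X f \<Omega>)"
    by (simp only: fun_calc_linear[OF saX b[OF f]])
  also have "fun_calc X f (fun_calc X p \<Omega>) = fun_calc X (\<lambda>x. f x * p x) \<Omega>"
    by (rule fun_calc_mult[OF saX b[OF f] b[OF v(2)], symmetric])
  also have "fun_calc X f \<xi> = f 0 *\<^sub>C \<xi>" unfolding \<xi>_def n_def by (rule kernelX(1)[OF v(3) f])
  also have "\<xi> = fun_calc Y q \<Omega> + (- n) *\<^sub>C \<Omega>" by (simp add: \<xi>_def scaleC_minus_left)
  finally show ?thesis
    by (simp only:) (intro core_add core_scale core_X core_Y core_Omega bcontfun_mult f v)
qed

lemma core_invariant_Y: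
  assumes f: "f \<in> bcontfun" and "v \<in> core"
  shows "fun_calc Y f v \<in> core"
proof -
  interpret sw: boolean_pair Y X \<Omega>
  proof
    show "cyclic_vector Y X \<Omega>" using cyclic unfolding cyclic_vector_def by (simp add: Un_commute)
  qed (use saX saY norm_Omega boolean_independent_sym[OF indep] in auto)
  have "sw.core = core" unfolding sw.core_def core_def by (auto simp: add.commute)
  then show ?thesis using sw.core_invariant_X[OF f] assms(2) by simp
qed

lemma core_dense: "closure core = UNIV"
proof -
  have "\<forall>v\<in>core. T v \<in> core" if "T \<in> generated_algebra (fun_calc X ` bcontfun \<union> fun_calc Y ` bcontfun)" for T
    using that
  proof induction
    case zero
    then show ?case using core_scale[OF core_Omega, of 0] by simp
  next
    case (gen T)
    then show ?case using core_invariant_X core_invariant_Y by auto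
  next
    case (add T U)
    then show ?case using core_add by blast
  next
    case (scale T c)
    then show ?case using core_scale by blast
  next
    case (mult T U)
    then show ?case by simp
  qed
  then have "{T \<Omega> | T. T \<in> generated_algebra (fun_calc X ` bcontfun \<union> fun_calc Y ` bcontfun)} \<subseteq> core"
    using core_Omega by blast
  from closure_mono[OF this] show ?thesis using cyclic unfolding cyclic_vector_def by auto
qed

text \<open>The vectors on which the sum is explicit: \<open>F(X) \<Omega>\<close> and \<open>G(Y) \<Omega>\<close> with the same mean \<open>\<alpha>\<close> are glued
  along \<open>\<Omega>\<close>. As \<open>G(Y) \<Omega> - \<alpha> \<Omega>\<close> is in the kernel of \<open>X\<close>, the operator \<open>X\<close> acts on \<open>F(X) \<Omega>\<close> only.\<close>

lemma op_sum_glued: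
  assumes F: "F \<in> bcontfun" "(\<lambda>x. complex_of_real x * F x) \<in> bcontfun" "cinner \<Omega> (fun_calc X F \<Omega>) = \<alpha>"
    and G: "G \<in> bcontfun" "(\<lambda>x. complex_of_real x * G x) \<in> bcontfun" "cinner \<Omega> (fun_calc Y G \<Omega>) = \<alpha>"
  shows "(fun_calc X F \<Omega> + fun_calc Y G \<Omega> - \<alpha> *\<^sub>C \<Omega>,
    fun_calc X (\<lambda>x. complex_of_real x * F x) \<Omega> + fun_calc Y (\<lambda>x. complex_of_real x * G x) \<Omega>) \<in> op_sum X Y"
proof -
  note b = bcontfun_bounded_borel
  have lin: "linear_operator X" "linear_operator Y" using saX saY by (auto simp: selfadjoint_def)
  have 1: "(fun_calc X F \<Omega> + (fun_calc Y G \<Omega> - \<alpha> *\<^sub>C \<Omega>), fun_calc X (\<lambda>x. complex_of_real x * F x) \<Omega> + 0) \<in> X"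
    using fun_calc_in_operator[OF saX b[OF F(1)] b[OF F(2)]] kernelX(2)[OF G(1)]
    unfolding G(3) by (rule linear_operatorD(1)[OF lin(1)])
  have 2: "((fun_calc X F \<Omega> - \<alpha> *\<^sub>C \<Omega>) + fun_calc Y G \<Omega>, 0 + fun_calc Y (\<lambda>x. complex_of_real x * G x) \<Omega>) \<in> Y"
    using kernelY(2)[OF F(1)] fun_calc_in_operator[OF saY b[OF G(1)] b[OF G(2)]]
    unfolding F(3) by (rule linear_operatorD(1)[OF lin(2)])
  have eq: "fun_calc X F \<Omega> + (fun_calc Y G \<Omega> - \<alpha> *\<^sub>C \<Omega>) = fun_calc X F \<Omega> + fun_calc Y G \<Omega> - \<alpha> *\<^sub>C \<Omega>"
    "(fun_calc X F \<Omega> - \<alpha> *\<^sub>C \<Omega>) + fun_calc Y G \<Omega> = fun_calc X F \<Omega> + fun_calc Y G \<Omega> - \<alpha> *\<^sub>C \<Omega>"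
    by (simp_all add: algebra_simps)
  show ?thesis unfolding op_sum_def
    using 1[unfolded eq add_0_right] 2[unfolded eq add_0_left] by blast
qed

text \<open>A vector \<open>p(X) \<Omega> + q(Y) \<Omega>\<close> is a glued vector except that its parts need not be in the domains;
  cutting off both parts without changing their means approximates it by vectors in the domain.\<close>

lemma op_sum_densely_defined: "densely_defined (op_sum X Y)"
proof -
  have "v \<in> closure (Domain (op_sum X Y))" if vcore: "v \<in> core" for v
  proof -
    note b = bcontfun_bounded_borel
    obtain p q where v: "v = fun_calc X p \<Omega> + fun_calc Y q \<Omega>" and p: "p \<in> bcontfun" and q: "q \<in> bcontfun"
      using vcore unfolding core_def by blast
    define P where "P = cinner \<Omega> (fun_calc X p \<Omega>)"
    define Q where "Q = cinner \<Omega> (fun_calc Y q \<Omega>)"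
    \<comment> \<open>Adding to each function the mean of the other one makes the means equal.\<close>
    define F where "F x = p x + Q" for x
    define G where "G x = q x + P" for x
    have F: "F \<in> bcontfun" and G: "G \<in> bcontfun" unfolding F_def G_def by (intro bcontfun_add bcontfun_const p q)+
    have FO: "fun_calc X F \<Omega> = fun_calc X p \<Omega> + Q *\<^sub>C \<Omega>" "fun_calc Y G \<Omega> = fun_calc Y q \<Omega> + P *\<^sub>C \<Omega>"
      unfolding F_def G_def fun_calc_add[OF saX b[OF p] bounded_borel_const] fun_calc_add[OF saY b[OF q] bounded_borel_const]
        fun_calc_const[OF saX] fun_calc_const[OF saY] by auto
    have mF: "cinner \<Omega> (fun_calc X F \<Omega>) = P + Q" "cinner \<Omega> (fun_calc Y G \<Omega>) = P + Q"
      unfolding FO by (simp_all add: cinner_simps cinner_Omega P_def Q_def)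
    obtain f where f: "\<And>n. f n \<in> bcontfun" "\<And>n. (\<lambda>x. complex_of_real x * f n x) \<in> bcontfun"
      "\<And>n. cinner \<Omega> (fun_calc X (f n) \<Omega>) = P + Q" "(\<lambda>n::nat. fun_calc X (f n) \<Omega>) \<longlonglongrightarrow> fun_calc X F \<Omega>"
      using cutoff_approximation[OF saX norm_Omega F] unfolding mF by blast
    obtain g where g: "\<And>n. g n \<in> bcontfun" "\<And>n. (\<lambda>x. complex_of_real x * g n x) \<in> bcontfun"
      "\<And>n. cinner \<Omega> (fun_calc Y (g n) \<Omega>) = P + Q" "(\<lambda>n::nat. fun_calc Y (g n) \<Omega>) \<longlonglongrightarrow> fun_calc Y G \<Omega>"
      using cutoff_approximation[OF saY norm_Omega G] unfolding mF by blast
    have "fun_calc X (f n) \<Omega> + fun_calc Y (g n) \<Omega> - (P + Q) *\<^sub>C \<Omega> \<in> Domain (op_sum X Y)" for n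
      using op_sum_glued[OF f(1,2,3) g(1,2,3), of n n] by (rule DomainI)
    moreover have "(\<lambda>n. fun_calc X (f n) \<Omega> + fun_calc Y (g n) \<Omega> - (P + Q) *\<^sub>C \<Omega>)
        \<longlonglongrightarrow> fun_calc X F \<Omega> + fun_calc Y G \<Omega> - (P + Q) *\<^sub>C \<Omega>"
      by (intro tendsto_intros f g)
    moreover have "fun_calc X F \<Omega> + fun_calc Y G \<Omega> - (P + Q) *\<^sub>C \<Omega> = v"
      unfolding FO v by (simp add: scaleC_simps)
    ultimately show ?thesis unfolding closure_sequential by (metis (no_types, lifting))
  qed
  then have "closure core \<subseteq> closure (Domain (op_sum X Y))" by (intro closure_minimal) auto
  then show ?thesis unfolding densely_defined_def core_dense by auto
qed

text \<open>Solving \<open>(X + Y - z) v = p(X) \<Omega> + q(Y) \<Omega>\<close> with a glued vector: take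
  \<open>F = (s - p) / (z - x)\<close> and \<open>G = (t - q) / (z - y)\<close> with constants \<open>s\<close> and \<open>t\<close>. The equation holds when
  \<open>s + t = z \<alpha>\<close>, and equality of the means is \<open>\<alpha> = s G\<^sub>X - P = t G\<^sub>Y - Q\<close>. These are three linear
  equations for \<open>s\<close>, \<open>t\<close>, \<open>\<alpha>\<close>. Eliminating \<open>s\<close> and \<open>t\<close> leaves an equation for \<open>\<alpha>\<close> with the coefficient
  \<open>1/G\<^sub>X + 1/G\<^sub>Y - z\<close>, which is the reciprocal Cauchy transform of the boolean convolution.\<close>

lemma op_sum_resolvent:
  fixes z :: complex
  assumes z: "Im z \<noteq> 0" and p: "p \<in> bcontfun" and q: "q \<in> bcontfun"
  defines "GX \<equiv> cauchy_transform (op_distribution X \<Omega>) z"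
    and "GY \<equiv> cauchy_transform (op_distribution Y \<Omega>) z"
    and "P \<equiv> cinner \<Omega> (fun_calc X (\<lambda>x. p x * (1 / (z - complex_of_real x))) \<Omega>)"
    and "Q \<equiv> cinner \<Omega> (fun_calc Y (\<lambda>x. q x * (1 / (z - complex_of_real x))) \<Omega>)"
  shows "1 / GX + 1 / GY - z \<noteq> 0"
    and "\<exists>v. (v, (fun_calc X p \<Omega> + fun_calc Y q \<Omega>) + z *\<^sub>C v) \<in> op_sum X Y \<and>
      cinner \<Omega> v = - (P / GX + Q / GY) / (1 / GX + 1 / GY - z)"
proof -
  define D where "D = 1 / GX + 1 / GY - z"
  have GX0: "GX \<noteq> 0" and imX: "1 \<le> Im (1 / GX) / Im z"
    unfolding GX_def by (rule reciprocal_cauchy_transform_Im[OF saX norm_Omega z])+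
  have GY0: "GY \<noteq> 0" and imY: "1 \<le> Im (1 / GY) / Im z"
    unfolding GY_def by (rule reciprocal_cauchy_transform_Im[OF saY norm_Omega z])+
  have "Im D / Im z = Im (1 / GX) / Im z + Im (1 / GY) / Im z - 1"
    unfolding D_def using z by (simp add: field_simps)
  then have "Im D / Im z \<ge> 1" using imX imY by linarith
  then have D0: "D \<noteq> 0" by auto
  then show "1 / GX + 1 / GY - z \<noteq> 0" by (simp add: D_def)
  define \<alpha> where "\<alpha> = - (P / GX + Q / GY) / D"
  define s where "s = (\<alpha> + P) / GX"
  define t where "t = (\<alpha> + Q) / GY"
  have st: "s + t = z * \<alpha>"
  proof -
    have "s + t = \<alpha> * (1 / GX + 1 / GY) + (P / GX + Q / GY)"
      by (simp add: s_def t_def add_divide_distrib distrib_left)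
    also have "1 / GX + 1 / GY = D + z" by (simp add: D_def)
    also have "\<alpha> * (D + z) = - (P / GX + Q / GY) + z * \<alpha>"
    proof -
      have "\<alpha> * D = - (P / GX + Q / GY)" using D0 by (simp add: \<alpha>_def)
      then show ?thesis by (simp only: distrib_left mult.commute[of z])
    qed
    finally show ?thesis by simp
  qed
  note b = bcontfun_bounded_borel
  let ?r = "\<lambda>x. 1 / (z - complex_of_real x)"
  have rb: "?r \<in> bcontfun" by (rule cauchy_kernel_bcontfun[OF z])
  have p': "(\<lambda>x. s + (- 1) * p x) \<in> bcontfun" and q': "(\<lambda>x. t + (- 1) * q x) \<in> bcontfun"
    by (intro bcontfun_add bcontfun_mult bcontfun_const p q)+
  define F where "F x = (s + (- 1) * p x) * ?r x" for x
  define G where "G x = (t + (- 1) * q x) * ?r x" for x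
  note FX = resolvent_function[OF saX z p', folded F_def] and GY = resolvent_function[OF saY z q', folded G_def]
  have mean: "cinner \<Omega> (fun_calc A (\<lambda>x. (c + (- 1) * h x) * ?r x) \<Omega>)
      = c * cauchy_transform (op_distribution A \<Omega>) z - cinner \<Omega> (fun_calc A (\<lambda>x. h x * ?r x) \<Omega>)"
    if A: "selfadjoint A" and h: "h \<in> bcontfun" for A h c
  proof -
    have hr: "(\<lambda>x. h x * ?r x) \<in> bcontfun" by (intro bcontfun_mult h rb)
    have "(\<lambda>x. (c + (- 1) * h x) * ?r x) = (\<lambda>x. c * ?r x + (- 1) * (h x * ?r x))"
      by (simp only: distrib_right mult.assoc)
    then show ?thesis
      by (simp only: fun_calc_add[OF A bounded_borel_mult[OF bounded_borel_const b[OF rb]] bounded_borel_mult[OF bounded_borel_const b[OF hr]]]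
        fun_calc_scale[OF A b[OF rb]] fun_calc_scale[OF A b[OF hr]] cauchy_transform_op_distribution[OF A norm_Omega z] cinner_simps)
        simp
  qed
  have mX: "cinner \<Omega> (fun_calc X F \<Omega>) = \<alpha>"
    unfolding F_def mean[OF saX p] GX_def[symmetric] P_def[symmetric] s_def using GX0 by simp
  have mY: "cinner \<Omega> (fun_calc Y G \<Omega>) = \<alpha>"
    unfolding G_def mean[OF saY q] GY_def[symmetric] Q_def[symmetric] t_def using GY0 by simp
  define v where "v = fun_calc X F \<Omega> + fun_calc Y G \<Omega> - \<alpha> *\<^sub>C \<Omega>"
  have c: "fun_calc A (\<lambda>x. c + (- 1) * h x) \<Omega> = c *\<^sub>C \<Omega> - fun_calc A h \<Omega>"
    if A: "selfadjoint A" and h: "h \<in> bcontfun" for A h c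
    unfolding fun_calc_add[OF A bounded_borel_const bounded_borel_mult[OF bounded_borel_const b[OF h]]]
      fun_calc_scale[OF A b[OF h]] fun_calc_const[OF A] by (simp add: scaleC_minus_left)
  have "(v, (z *\<^sub>C fun_calc X F \<Omega> - (s *\<^sub>C \<Omega> - fun_calc X p \<Omega>)) + (z *\<^sub>C fun_calc Y G \<Omega> - (t *\<^sub>C \<Omega> - fun_calc Y q \<Omega>))) \<in> op_sum X Y"
    using op_sum_glued[OF FX(1,2) mX GY(1,2) mY] unfolding FX(3) GY(3) c[OF saX p] c[OF saY q] v_def .
  moreover have "(z *\<^sub>C fun_calc X F \<Omega> - (s *\<^sub>C \<Omega> - fun_calc X p \<Omega>)) + (z *\<^sub>C fun_calc Y G \<Omega> - (t *\<^sub>C \<Omega> - fun_calc Y q \<Omega>))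
      = (fun_calc X p \<Omega> + fun_calc Y q \<Omega>) + z *\<^sub>C v"
  proof -
    have "s *\<^sub>C \<Omega> + t *\<^sub>C \<Omega> = z *\<^sub>C \<alpha> *\<^sub>C \<Omega>"
      unfolding scaleC_add_left[symmetric] st scaleC_scaleC ..
    then show ?thesis unfolding v_def scaleC_diff_right scaleC_add_right by (simp add: algebra_simps)
  qed
  moreover have "cinner \<Omega> v = \<alpha>"
    unfolding v_def by (simp add: cinner_simps mX mY cinner_Omega)
  ultimately show "\<exists>v. (v, (fun_calc X p \<Omega> + fun_calc Y q \<Omega>) + z *\<^sub>C v) \<in> op_sum X Y \<and>
      cinner \<Omega> v = - (P / GX + Q / GY) / (1 / GX + 1 / GY - z)"
    unfolding \<alpha>_def D_def by auto
qed

theorem op_sum_essentially_selfadjoint: "essentially_selfadjoint (op_sum X Y)"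
proof (rule essentially_selfadjoint_criterion)
  show "linear_operator (op_sum X Y)"
    using saX saY by (intro linear_op_sum) (auto simp: selfadjoint_def)
  show "densely_defined (op_sum X Y)" by (rule op_sum_densely_defined)
  show "symmetric_operator (op_sum X Y)"
    by (intro symmetric_op_sum selfadjoint_symmetric saX saY)
  have ran: "core \<subseteq> {u - z *\<^sub>C x | x u. (x, u) \<in> op_sum X Y}" if z: "Im z \<noteq> 0" for z
  proof
    fix w assume "w \<in> core"
    then obtain p q where w: "w = fun_calc X p \<Omega> + fun_calc Y q \<Omega>" "p \<in> bcontfun" "q \<in> bcontfun"
      unfolding core_def by blast
    obtain v where v: "(v, w + z *\<^sub>C v) \<in> op_sum X Y"
      using op_sum_resolvent(2)[OF z w(2,3)] unfolding w(1) by blast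
    have "w = (w + z *\<^sub>C v) - z *\<^sub>C v" by simp
    then show "w \<in> {u - z *\<^sub>C x | x u. (x, u) \<in> op_sum X Y}" using v by blast
  qed
  have dense: "closure {u - z *\<^sub>C x | x u. (x, u) \<in> op_sum X Y} = UNIV" if "Im z \<noteq> 0" for z
    using closure_mono[OF ran[OF that]] core_dense by auto
  show "closure {u + \<i> *\<^sub>C x | x u. (x, u) \<in> op_sum X Y} = UNIV"
    using dense[of "- \<i>"] by (simp add: scaleC_minus_left)
  show "closure {u - \<i> *\<^sub>C x | x u. (x, u) \<in> op_sum X Y} = UNIV"
    using dense[of \<i>] by simp
qed

text \<open>For \<open>w = \<Omega>\<close> the solution \<open>v\<close> of \<open>(X + Y - z) v = w\<close> has \<open>\<langle>\<Omega>, v\<rangle> = - 1 / (1/G\<^sub>X + 1/G\<^sub>Y - z)\<close>, and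
  \<open>\<langle>\<Omega>, v\<rangle>\<close> is up to sign the Cauchy transform of the distribution of the closure.\<close>

theorem op_sum_distribution:
  "op_distribution (closure (op_sum X Y)) \<Omega> = op_distribution X \<Omega> \<uplus> op_distribution Y \<Omega>"
proof -
  define \<rho> where "\<rho> = op_distribution (closure (op_sum X Y)) \<Omega>"
  have sa: "selfadjoint (closure (op_sum X Y))"
    using op_sum_essentially_selfadjoint by (simp add: essentially_selfadjoint_def)
  obtain E where E: "selfadjoint_spectral (closure (op_sum X Y)) E"
    using selfadjoint_spectral_exists[OF sa] by blast
  have \<rho>: "\<rho> = vector_measure E \<Omega>" "real_distribution \<rho>"
    unfolding \<rho>_def op_distribution_eq(1)[OF E norm_Omega] by (auto intro: op_distribution_eq(2)[OF E norm_Omega])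
  have rec: "reciprocal_cauchy_transform \<rho> z = reciprocal_cauchy_transform (op_distribution X \<Omega>) z
      + reciprocal_cauchy_transform (op_distribution Y \<Omega>) z - z" if "Im z > 0" for z
  proof -
    have z: "Im z \<noteq> 0" using that by simp
    define GX where "GX = cauchy_transform (op_distribution X \<Omega>) z"
    define GY where "GY = cauchy_transform (op_distribution Y \<Omega>) z"
    have "GX \<noteq> 0" unfolding GX_def by (rule reciprocal_cauchy_transform_Im[OF saX norm_Omega z])
    then have m: "cinner \<Omega> (fun_calc X (\<lambda>x. 1 * (1 / (z - complex_of_real x))) \<Omega>) / GX = 1"
      unfolding GX_def cauchy_transform_op_distribution[OF saX norm_Omega z] by simp
    obtain v where v: "(v, \<Omega> + z *\<^sub>C v) \<in> op_sum X Y" "cinner \<Omega> v = - 1 / (1 / GX + 1 / GY - z)"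
      using op_sum_resolvent(2)[OF z bcontfun_const[of 1] bcontfun_const[of 0]] m
      unfolding GX_def[symmetric] GY_def[symmetric]
      by (auto simp: fun_calc_const[OF saX] fun_calc_const[OF saY])
    have "(v, \<Omega> + z *\<^sub>C v) \<in> closure (op_sum X Y)" using v(1) closure_subset by blast
    from selfadjoint_spectral.cauchy_transform_resolvent[OF E z this]
    have "cauchy_transform \<rho> z = 1 / (1 / GX + 1 / GY - z)" unfolding \<rho>(1) v(2) by simp
    then show ?thesis by (simp add: reciprocal_cauchy_transform_def GX_def GY_def)
  qed
  have "op_distribution X \<Omega> \<uplus> op_distribution Y \<Omega> = \<rho>"
    unfolding boolean_convolution_def
  proof (rule the_equality)
    fix \<nu> assume \<nu>: "real_distribution \<nu> \<and> (\<forall>z. Im z > 0 \<longrightarrow> reciprocal_cauchy_transform \<nu> z =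
        reciprocal_cauchy_transform (op_distribution X \<Omega>) z + reciprocal_cauchy_transform (op_distribution Y \<Omega>) z - z)"
    show "\<nu> = \<rho>"
    proof (rule cauchy_transform_eqI)
      fix z assume "Im z > 0"
      then have "1 / cauchy_transform \<nu> z = 1 / cauchy_transform \<rho> z"
        using \<nu> rec unfolding reciprocal_cauchy_transform_def by simp
      then show "cauchy_transform \<nu> z = cauchy_transform \<rho> z"
        by (metis divide_inverse inverse_inverse_eq mult_1)
    qed (use \<nu> \<rho>(2) in \<open>auto intro: real_distribution.finite_borel_measure_M\<close>)
  qed (use \<rho>(2) rec in auto)
  then show ?thesis unfolding \<rho>_def by simp
qed

end

theorem theorem4p9:
  fixes X Y :: "'a::complex_hilbert_space operator" and \<Omega> :: 'a
  assumes "selfadjoint X" and "selfadjoint Y"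
    and "norm \<Omega> = 1"
    and "boolean_independent X Y \<Omega>"
    and "cyclic_vector X Y \<Omega>"
  shows "essentially_selfadjoint (op_sum X Y) \<and>
    op_distribution (closure (op_sum X Y)) \<Omega> = op_distribution X \<Omega> \<uplus> op_distribution Y \<Omega>"
proof -
  interpret boolean_pair X Y \<Omega> using assms by unfold_locales
  show ?thesis using op_sum_essentially_selfadjoint op_sum_distribution by blast
qed

end
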